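(* Let $\Gamma$ be a finite connected metric graph (not a point and not homeomorphic to $[0,1]$ or $S^1$) with $E$ edges. Counting the empty set as a type, the number of homotopy types in the family $\{\Gamma^2_r\}_{r>0}$ is at most $\frac92E^2-\frac52E$, and the number of isotopy types (in $\Gamma^2$) in this family is at most $9E^2-5E-1$.
   Context: A metric graph $\Gamma$ is a finite connected one-dimensional CW complex with a positive length $L_e$ assigned to each edge $e$ (closed 1-cell); $\delta$ is the resulting path metric on $\Gamma$. Multiple edges are allowed. The underlying space is assumed not to be a point and not homeomorphic to $[0,1]$ or $S^1$. $\Gamma$ is given its minimal regular cell structure: the cell structure with the minimum number of cells (so that no node has valence two), modified by subdividing each loop at its midpoint. $E$ is the number of edges in this structure. For real $r$, $\Gamma^2_r=\{(x,y)\in\Gamma^2\mid\delta(x,y)\ge r\}$. Two subspaces $X,Y\subseteq\Gamma^2$ are isotopic in $\Gamma^2$ (have the same isotopy type) if there is a continuous map $\Phi\colon X\times[0,1]\to\Gamma^2$ such that $\Phi(-,0)$ is the inclusion of $X$, each $\Phi(-,t)$ is a homeomorphism onto its image, and $\Phi(-,1)$ has image $Y$. *)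

theory Defs
  imports "HOL-Analysis.Analysis"
begin

text \<open>A finite CW structure of dimension at most one on a space is given by its set \<open>V\<close> of
  0-cells (as points) and its set \<open>E\<close> of open 1-cells (as subsets); parallel edges are distinct
  open cells with the same end points. For finite structures on a Hausdorff space the closure and weak
  topology conditions of a CW complex hold automatically.\<close>

definition characteristic_map :: "'a topology \<Rightarrow> 'a set \<Rightarrow> 'a set \<Rightarrow> (real \<Rightarrow> 'a) \<Rightarrow> bool" where
  "characteristic_map X V e \<phi> \<longleftrightarrow>
     continuous_map (top_of_set {0..1}) X \<phi> \<and>
     homeomorphic_map (top_of_set {0<..<1}) (subtopology X e) \<phi> \<and>
     \<phi> 0 \<in> V \<and> \<phi> 1 \<in> V"

definition cell_structure :: "'a topology \<Rightarrow> 'a set \<Rightarrow> 'a set set \<Rightarrow> bool" where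
  "cell_structure X V E \<longleftrightarrow>
     Hausdorff_space X \<and> finite V \<and> finite E \<and>
     V \<union> \<Union>E = topspace X \<and> disjnt V (\<Union>E) \<and> pairwise disjnt E \<and>
     (\<forall>e\<in>E. \<exists>\<phi>. characteristic_map X V e \<phi>)"

text \<open>The edge \<open>e\<close> is identified with the interval of length \<open>L e\<close> by
  \<open>\<phi> e t \<mapsto> L e * t\<close>.\<close>

definition metric_graph ::
  "'a topology \<Rightarrow> 'a set \<Rightarrow> 'a set set \<Rightarrow> ('a set \<Rightarrow> real \<Rightarrow> 'a) \<Rightarrow> ('a set \<Rightarrow> real) \<Rightarrow> bool" where
  "metric_graph X V E \<phi> L \<longleftrightarrow>
     cell_structure X V E \<and> connected_space X \<and> topspace X \<noteq> {} \<and>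
     (\<forall>e\<in>E. characteristic_map X V e (\<phi> e) \<and> 0 < L e)"

text \<open>A piecewise linear path is recorded by its list of segments \<open>(e, s, t)\<close>, each running
  linearly from \<open>\<phi> e s\<close> to \<open>\<phi> e t\<close> inside the closed edge \<open>e\<close>.\<close>

fun pl_path ::
  "'a set set \<Rightarrow> ('a set \<Rightarrow> real \<Rightarrow> 'a) \<Rightarrow> 'a \<Rightarrow> ('a set \<times> real \<times> real) list \<Rightarrow> 'a \<Rightarrow> bool" where
  "pl_path E \<phi> x [] y \<longleftrightarrow> x = y"
| "pl_path E \<phi> x ((e, s, t) # p) y \<longleftrightarrow>
     e \<in> E \<and> s \<in> {0..1} \<and> t \<in> {0..1} \<and> \<phi> e s = x \<and> pl_path E \<phi> (\<phi> e t) p y"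

definition pl_length :: "('a set \<Rightarrow> real) \<Rightarrow> ('a set \<times> real \<times> real) list \<Rightarrow> real" where
  "pl_length L p = (\<Sum>(e, s, t)\<leftarrow>p. L e * \<bar>t - s\<bar>)"

definition path_metric ::
  "'a set set \<Rightarrow> ('a set \<Rightarrow> real \<Rightarrow> 'a) \<Rightarrow> ('a set \<Rightarrow> real) \<Rightarrow> 'a \<Rightarrow> 'a \<Rightarrow> real" where
  "path_metric E \<phi> L x y = Inf {pl_length L p |p. pl_path E \<phi> x p y}"

definition minimal_cell_structure :: "'a topology \<Rightarrow> 'a set \<Rightarrow> 'a set set \<Rightarrow> bool" where
  "minimal_cell_structure X V E \<longleftrightarrow>
     cell_structure X V E \<and>
     (\<forall>V' E'. cell_structure X V' E' \<longrightarrow> card V + card E \<le> card V' + card E')"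

definition loops :: "'a topology \<Rightarrow> 'a set \<Rightarrow> 'a set set \<Rightarrow> 'a set set" where
  "loops X V E = {e \<in> E. \<exists>\<phi>. characteristic_map X V e \<phi> \<and> \<phi> 0 = \<phi> 1}"

text \<open>Constant speed can be required only locally: an edge need not be a shortest path between
  points on it that are far apart.\<close>

definition constant_speed :: "('a \<Rightarrow> 'a \<Rightarrow> real) \<Rightarrow> (real \<Rightarrow> 'a) \<Rightarrow> bool" where
  "constant_speed \<delta> \<phi> \<longleftrightarrow>
     (\<exists>l>0. \<exists>\<epsilon>>0. \<forall>s\<in>{0..1}. \<forall>t\<in>{0..1}. \<bar>s - t\<bar> < \<epsilon> \<longrightarrow> \<delta> (\<phi> s) (\<phi> t) = l * \<bar>s - t\<bar>)"

definition minimal_regular_structure ::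
  "'a topology \<Rightarrow> ('a \<Rightarrow> 'a \<Rightarrow> real) \<Rightarrow> 'a set \<Rightarrow> 'a set set \<Rightarrow> bool" where
  "minimal_regular_structure X \<delta> V E \<longleftrightarrow>
     (\<exists>V\<^sub>0 E\<^sub>0 \<phi>. minimal_cell_structure X V\<^sub>0 E\<^sub>0 \<and>
        (\<forall>e\<in>loops X V\<^sub>0 E\<^sub>0. characteristic_map X V\<^sub>0 e (\<phi> e) \<and> constant_speed \<delta> (\<phi> e)) \<and>
        V = V\<^sub>0 \<union> (\<lambda>e. \<phi> e (1/2)) ` loops X V\<^sub>0 E\<^sub>0 \<and>
        E = (E\<^sub>0 - loops X V\<^sub>0 E\<^sub>0)
            \<union> (\<lambda>e. \<phi> e ` {0<..<1/2}) ` loops X V\<^sub>0 E\<^sub>0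
            \<union> (\<lambda>e. \<phi> e ` {1/2<..<1}) ` loops X V\<^sub>0 E\<^sub>0)"

definition far_pairs :: "'a topology \<Rightarrow> ('a \<Rightarrow> 'a \<Rightarrow> real) \<Rightarrow> real \<Rightarrow> ('a \<times> 'a) set" where
  "far_pairs X \<delta> r = {(x, y) \<in> topspace X \<times> topspace X. \<delta> x y \<ge> r}"

definition isotopic_in :: "'b topology \<Rightarrow> 'b set \<Rightarrow> 'b set \<Rightarrow> bool" where
  "isotopic_in Z A B \<longleftrightarrow>
     (\<exists>\<Phi>. continuous_map (prod_topology (subtopology Z A) (top_of_set {0..1::real})) Z \<Phi> \<and>
          (\<forall>p\<in>A. \<Phi> (p, 0) = p) \<and>
          (\<forall>t\<in>{0..1}. embedding_map (subtopology Z A) Z (\<lambda>p. \<Phi> (p, t))) \<and>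
          (\<lambda>p. \<Phi> (p, 1)) ` A = B)"

definition homotopy_types :: "'b topology \<Rightarrow> 'b set set \<Rightarrow> 'b set set set" where
  "homotopy_types Z F =
     F // {(A, B). A \<in> F \<and> B \<in> F \<and> subtopology Z A homotopy_equivalent_space subtopology Z B}"

definition isotopy_types :: "'b topology \<Rightarrow> 'b set set \<Rightarrow> 'b set set set" where
  "isotopy_types Z F = F // {(A, B). A \<in> F \<and> B \<in> F \<and> isotopic_in Z A B}"

end

theory Submission
  imports Defs
begin

text \<open>Away from finitely many \<^emph>\<open>critical values\<close> of \<open>r\<close> the set \<open>far_pairs X \<delta> r\<close> only varies by isotopy.
The number of types is therefore bounded by counting critical values.

Parametrize the \<open>E\<close> edges by arc length. On a product \<open>e \<times> f\<close> of two distinct edges, a rectangle, the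
distance is the minimum of four affine functions, one for each corner (\<open>dist_pt_pt\<close>), because a shortest
path leaves \<open>e\<close> through an end and enters \<open>f\<close> through an end. So the pairs at distance at least \<open>r\<close> form
the rectangle with four diagonal cuts, a convex polygon. On \<open>e \<times> e\<close> two corners are cut off, and a strip
around the diagonal is removed (\<open>dist_pt_same\<close>). As \<open>r\<close> grows, such a polygon changes its shape only when a
corner starts to be cut off, when a side of the rectangle is used up, or when it vanishes. The values
of \<open>r\<close> at which this happens are the distances between vertices, the maxima of the distance from a
vertex on an edge, and the maxima of the distance on products of two edges.

Between critical values the polygons are isotopic. Each level set of the distance consists of diagonal
segments whose ends move linearly with the level, and dividing the segments proportionally decomposes
the region between two levels into lines along which the distance increases at unit speed. These lines
agree wherever pieces from different corners or different rectangles meet (\<open>strips_parallel\<close>), so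
pushing along them is an isotopy of the whole superlevel set (\<open>isotopic_far_pairs\<close>, by
\<open>isotopic_superlevels_if_parallel_strips\<close>).

It remains to count. With \<open>V\<close> vertices there are at most \<open>V(V - 1)/2 + (V - 1)E + E(E - 1)/2\<close> critical
values. Connectedness gives \<open>V \<le> E + 1\<close>, and in the extreme case of a tree the values of the second kind
are distances between vertices. In both cases at most \<open>2E(E - 1)\<close> values remain (\<open>card_critical\<close>), so that
there are at most \<open>4E(E - 1) + 1\<close> isotopy types: one for each critical value and one for each gap. Since
an isotopy ends in a homeomorphism, the same bound holds for homotopy types. For \<open>E \<ge> 2\<close>, which holds
because the space is not an arc and loops have been subdivided, it implies both claims.

The metric is given by an arbitrary cell structure, whereas the edges to be counted belong to the
regular one. Arc length along the latter is constructed in \<open>arc_length_parametrization\<close>. That the metric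
is also the path metric of the regular structure is transferred by \<open>length_graph_exists\<close>, using that it
is the largest distance function for which all edges are 1-Lipschitz.\<close>

section \<open>Isotopy of subspaces\<close>

text \<open>Each \<open>g i\<close> is a closed map, so the preimage of a closed set under \<open>F\<close> is a finite union of closed
sets. The pieces may overlap in any way; only the values of \<open>F\<close> have to be well defined.\<close>

lemma continuous_map_from_compact_cover:
  assumes "finite I" and "Hausdorff_space Y"
    and K: "\<And>i. i \<in> I \<Longrightarrow> compact_space (K i)"
    and g: "\<And>i. i \<in> I \<Longrightarrow> continuous_map (K i) Y (g i)"
    and cover: "topspace Y \<subseteq> (\<Union>i\<in>I. g i ` topspace (K i))"
    and F: "\<And>i. i \<in> I \<Longrightarrow> continuous_map (K i) Z (\<lambda>k. F (g i k))"
  shows "continuous_map Y Z F"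
  unfolding continuous_map_closedin
proof (intro conjI ballI allI impI)
  show "F \<in> topspace Y \<rightarrow> topspace Z"
    using cover F unfolding continuous_map_def by fastforce
next
  fix C assume C: "closedin Z C"
  let ?D = "\<lambda>i. {k \<in> topspace (K i). F (g i k) \<in> C}"
  have "closedin Y (g i ` ?D i)" if "i \<in> I" for i
  proof -
    have "closedin (K i) (?D i)"
      using F[OF that] C by (simp add: continuous_map_closedin)
    moreover have "closed_map (K i) Y (g i)"
      using K g assms(2) that by (simp add: continuous_imp_closed_map)
    ultimately show ?thesis by (simp add: closed_map_def)
  qed
  then have "closedin Y (\<Union>i\<in>I. g i ` ?D i)"
    using assms(1) by (intro closedin_Union) auto
  moreover have "{x \<in> topspace Y. F x \<in> C} = (\<Union>i\<in>I. g i ` ?D i)"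
    using cover g by (fastforce simp: continuous_map_def)
  ultimately show "closedin Y {x \<in> topspace Y. F x \<in> C}" by simp
qed

lemma isotopic_in_refl:
  assumes "A \<subseteq> topspace Z"
  shows "isotopic_in Z A A"
proof -
  have "continuous_map (prod_topology (subtopology Z A) (top_of_set {0..1::real})) Z fst"
    by (metis continuous_map_fst continuous_map_into_fulltopology)
  moreover have "embedding_map (subtopology Z A) Z (\<lambda>p. p)"
    using assms homeomorphic_map_id[of "subtopology Z A" "subtopology Z A"]
    by (simp add: embedding_map_def Int_absorb1 id_def)
  ultimately show ?thesis unfolding isotopic_in_def
    by (intro exI[of _ fst]) auto
qed

lemma homeomorphic_map_imp_embedding_map:
  "homeomorphic_map X Y f \<Longrightarrow> embedding_map X Y f"
  by (metis embedding_map_def homeomorphic_imp_surjective_map subtopology_topspace)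

lemma isotopic_in_end_homeomorphism:
  assumes "embedding_map (subtopology Z A) Z f" "f ` A = B" "A \<subseteq> topspace Z"
  obtains g where "homeomorphic_maps (subtopology Z A) (subtopology Z B) f g"
proof -
  have "homeomorphic_map (subtopology Z A) (subtopology Z B) f"
    using assms by (simp add: embedding_map_def Int_absorb1)
  then show thesis using that by (auto simp: homeomorphic_map_maps)
qed

text \<open>The isotopy is run backwards, starting from the inverse of the homeomorphism at its end.\<close>

lemma isotopic_in_sym:
  assumes "isotopic_in Z A B" "A \<subseteq> topspace Z"
  shows "isotopic_in Z B A"
proof -
  obtain \<Phi> where c: "continuous_map (prod_topology (subtopology Z A) (top_of_set {0..1::real})) Z \<Phi>"
    and z: "\<And>p. p \<in> A \<Longrightarrow> \<Phi> (p, 0) = p"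
    and e: "\<And>t. t \<in> {0..1} \<Longrightarrow> embedding_map (subtopology Z A) Z (\<lambda>p. \<Phi> (p, t))"
    and i: "(\<lambda>p. \<Phi> (p, 1)) ` A = B"
    using assms(1) unfolding isotopic_in_def by blast
  obtain g where g: "homeomorphic_maps (subtopology Z A) (subtopology Z B) (\<lambda>p. \<Phi> (p, 1)) g"
    using isotopic_in_end_homeomorphism[OF e[of 1] i assms(2)] by auto
  have BZ: "B \<subseteq> topspace Z"
    using e[of 1] i assms(2) by (auto simp: embedding_map_def homeomorphic_eq_everything_map Int_absorb1)
  have gc: "continuous_map (subtopology Z B) (subtopology Z A) g"
    and gA: "\<And>p. p \<in> A \<Longrightarrow> g (\<Phi> (p, 1)) = p" and gB: "\<And>q. q \<in> B \<Longrightarrow> \<Phi> (g q, 1) = q"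
    using g assms(2) BZ by (auto simp: homeomorphic_maps_def)
  have ghom: "homeomorphic_map (subtopology Z B) (subtopology Z A) g"
    using g homeomorphic_map_maps homeomorphic_maps_sym by blast
  define \<Psi> where "\<Psi> = (\<lambda>(q, t). \<Phi> (g q, 1 - t))"
  have "continuous_map (prod_topology (subtopology Z B) (top_of_set {0..1::real}))
          (prod_topology (subtopology Z A) (top_of_set {0..1::real})) (\<lambda>(q, t). (g q, 1 - t))"
  proof -
    have "continuous_map (top_of_set {0..1::real}) (top_of_set {0..1::real}) (\<lambda>t. 1 - t)"
      by (auto simp: continuous_map_in_subtopology intro!: continuous_intros)
    then show ?thesis using gc 
      by (simp add: continuous_map_prod_top)
  qed
  from continuous_map_compose[OF this c]
  have "continuous_map (prod_topology (subtopology Z B) (top_of_set {0..1::real})) Z \<Psi>"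
    by (simp add: \<Psi>_def o_def case_prod_unfold)
  moreover have "\<forall>p\<in>B. \<Psi> (p, 0) = p" by (simp add: \<Psi>_def gB)
  moreover have "\<forall>t\<in>{0..1}. embedding_map (subtopology Z B) Z (\<lambda>p. \<Psi> (p, t))"
  proof
    fix t :: real assume "t \<in> {0..1}"
    then have "embedding_map (subtopology Z A) Z (\<lambda>p. \<Phi> (p, 1 - t))" by (intro e) auto
    moreover have "embedding_map (subtopology Z B) (subtopology Z A) g"
      using ghom by (simp add: homeomorphic_map_imp_embedding_map)
    ultimately have "embedding_map (subtopology Z B) Z ((\<lambda>p. \<Phi> (p, 1 - t)) \<circ> g)"
      using embedding_map_compose by blast
    then show "embedding_map (subtopology Z B) Z (\<lambda>p. \<Psi> (p, t))"
      by (simp add: \<Psi>_def o_def)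
  qed
  moreover have "(\<lambda>p. \<Psi> (p, 1)) ` B = A"
  proof -
    have "(\<lambda>p. \<Psi> (p, 1)) ` B = g ` B"
      using continuous_map_image_subset_topspace[OF gc] assms(2) BZ
      by (intro image_cong) (auto simp: \<Psi>_def Int_absorb1 intro!: z)
    also have "\<dots> = A" using i gA by force
    finally show ?thesis .
  qed
  ultimately show ?thesis unfolding isotopic_in_def by blast
qed

lemma isotopic_in_trans:
  assumes "isotopic_in Z A B" "isotopic_in Z B C" "A \<subseteq> topspace Z"
  shows "isotopic_in Z A C"
proof -
  obtain \<Phi> where c: "continuous_map (prod_topology (subtopology Z A) (top_of_set {0..1::real})) Z \<Phi>"
    and z: "\<And>p. p \<in> A \<Longrightarrow> \<Phi> (p, 0) = p"
    and e: "\<And>t. t \<in> {0..1} \<Longrightarrow> embedding_map (subtopology Z A) Z (\<lambda>p. \<Phi> (p, t))"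
    and i: "(\<lambda>p. \<Phi> (p, 1)) ` A = B"
    using assms(1) unfolding isotopic_in_def by blast
  obtain \<Psi> where c': "continuous_map (prod_topology (subtopology Z B) (top_of_set {0..1::real})) Z \<Psi>"
    and z': "\<And>p. p \<in> B \<Longrightarrow> \<Psi> (p, 0) = p"
    and e': "\<And>t. t \<in> {0..1} \<Longrightarrow> embedding_map (subtopology Z B) Z (\<lambda>p. \<Psi> (p, t))"
    and i': "(\<lambda>p. \<Psi> (p, 1)) ` B = C"
    using assms(2) unfolding isotopic_in_def by blast
  let ?P = "prod_topology (subtopology Z A) (top_of_set {0..1::real})"
  have hom: "homeomorphic_map (subtopology Z A) (subtopology Z B) (\<lambda>p. \<Phi> (p, 1))"
    using e[of 1] i assms(3) by (simp add: embedding_map_def Int_absorb1)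
  define \<Theta> where "\<Theta> = (\<lambda>x. if snd x \<le> 1/2 then \<Phi> (fst x, 2 * snd x)
                       else \<Psi> (\<Phi> (fst x, 1), 2 * snd x - 1))"
  have "continuous_map ?P Z \<Theta>"
    unfolding \<Theta>_def
  proof (rule continuous_map_cases_le)
    show "continuous_map ?P euclideanreal snd"
      by (rule continuous_map_into_fulltopology[OF continuous_map_snd])
    show "continuous_map ?P euclideanreal (\<lambda>x. 1/2)" by simp
    show "continuous_map (subtopology ?P {x \<in> topspace ?P. snd x \<le> 1/2}) Z (\<lambda>x. \<Phi> (fst x, 2 * snd x))"
    proof -
      have "continuous_map (subtopology ?P {x \<in> topspace ?P. snd x \<le> 1/2}) ?P (\<lambda>x. (fst x, 2 * snd x))"
        unfolding continuous_map_pairwise o_def fst_conv snd_conv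
      proof
        show "continuous_map (subtopology ?P {x \<in> topspace ?P. snd x \<le> 1/2}) (subtopology Z A) fst"
          by (rule continuous_map_from_subtopology[OF continuous_map_fst])
        have "continuous_map ?P euclideanreal snd"
          by (rule continuous_map_into_fulltopology[OF continuous_map_snd])
        then show "continuous_map (subtopology ?P {x \<in> topspace ?P. snd x \<le> 1/2}) (top_of_set {0..1}) (\<lambda>x. 2 * snd x)"
          by (auto simp: continuous_map_in_subtopology intro!: continuous_map_real_mult continuous_map_from_subtopology)
      qed
      from continuous_map_compose[OF this c] show ?thesis by (simp add: o_def)
    qed
    show "continuous_map (subtopology ?P {x \<in> topspace ?P. 1/2 \<le> snd x}) Z (\<lambda>x. \<Psi> (\<Phi> (fst x, 1), 2 * snd x - 1))"
    proof -
      have "continuous_map (subtopology ?P {x \<in> topspace ?P. 1/2 \<le> snd x}) 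
          (prod_topology (subtopology Z B) (top_of_set {0..1::real})) (\<lambda>x. (\<Phi> (fst x, 1), 2 * snd x - 1))"
        unfolding continuous_map_pairwise o_def fst_conv snd_conv
      proof
        have "continuous_map (subtopology ?P {x \<in> topspace ?P. 1/2 \<le> snd x}) (subtopology Z A) fst"
          by (rule continuous_map_from_subtopology[OF continuous_map_fst])
        from continuous_map_compose[OF this homeomorphic_imp_continuous_map[OF hom]]
        show "continuous_map (subtopology ?P {x \<in> topspace ?P. 1/2 \<le> snd x}) (subtopology Z B) (\<lambda>x. \<Phi> (fst x, 1))"
          by (simp add: o_def)
        have "continuous_map ?P euclideanreal snd"
          by (rule continuous_map_into_fulltopology[OF continuous_map_snd])
        then show "continuous_map (subtopology ?P {x \<in> topspace ?P. 1/2 \<le> snd x}) (top_of_set {0..1}) (\<lambda>x. 2 * snd x - 1)"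
          by (auto simp: continuous_map_in_subtopology intro!: continuous_map_real_mult continuous_map_diff continuous_map_from_subtopology)
      qed
      from continuous_map_compose[OF this c'] show ?thesis by (simp add: o_def)
    qed
    show "\<Phi> (fst x, 2 * snd x) = \<Psi> (\<Phi> (fst x, 1), 2 * snd x - 1)"
      if "x \<in> topspace ?P" "snd x = 1/2" for x
    proof -
      have "\<Phi> (fst x, 1) \<in> B" using that i by auto
      moreover have "2 * snd x = 1" using that(2) by simp
      ultimately show ?thesis by (simp add: z')
    qed
  qed
  moreover have "\<forall>p\<in>A. \<Theta> (p, 0) = p" by (simp add: \<Theta>_def z)
  moreover have "\<forall>t\<in>{0..1}. embedding_map (subtopology Z A) Z (\<lambda>p. \<Theta> (p, t))"
  proof
    fix t :: real assume t: "t \<in> {0..1}"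
    show "embedding_map (subtopology Z A) Z (\<lambda>p. \<Theta> (p, t))"
    proof (cases "t \<le> 1/2")
      case True
      then show ?thesis using t e[of "2 * t"] by (simp add: \<Theta>_def)
    next
      case False
      then have "embedding_map (subtopology Z A) Z ((\<lambda>p. \<Psi> (p, 2*t - 1)) \<circ> (\<lambda>p. \<Phi> (p, 1)))"
        using t e'[of "2*t - 1"] homeomorphic_map_imp_embedding_map[OF hom]
        by (intro embedding_map_compose) auto
      with False show ?thesis by (simp add: \<Theta>_def o_def)
    qed
  qed
  moreover have "(\<lambda>p. \<Theta> (p, 1)) ` A = C"
    using i i' by (auto simp: \<Theta>_def image_image)
  ultimately show ?thesis unfolding isotopic_in_def by blast
qed

text \<open>The end of an isotopy is a homeomorphism. Hence a bound for the number of isotopy types is also one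
for the number of homotopy types.\<close>

lemma isotopic_in_imp_homotopy_equivalent:
  assumes "isotopic_in Z A B" "A \<subseteq> topspace Z"
  shows "subtopology Z A homotopy_equivalent_space subtopology Z B"
proof -
  obtain \<Phi> :: "'a \<times> real \<Rightarrow> 'a" where "embedding_map (subtopology Z A) Z (\<lambda>p. \<Phi> (p, 1))" "(\<lambda>p. \<Phi> (p, 1)) ` A = B"
    using assms(1) unfolding isotopic_in_def by force
  from isotopic_in_end_homeomorphism[OF this assms(2)] obtain g where
    "homeomorphic_maps (subtopology Z A) (subtopology Z B) (\<lambda>p. \<Phi> (p, 1)) g" .
  then have "subtopology Z A homeomorphic_space subtopology Z B"
    unfolding homeomorphic_space_def by blast
  then show ?thesis by (rule homeomorphic_imp_homotopy_equivalent_space)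
qed

section \<open>Superlevel sets swept out by parallel strips\<close>

text \<open>A strip is a family of lines \<open>h \<mapsto> \<sigma> i u h\<close> along which \<open>\<delta>\<close> increases at unit speed. If lines that meet
at one level coincide at all levels, then moving along the line through a point is a well-defined
flow on the slab \<open>r \<le> \<delta> \<le> t\<close>. Compressing the levels \<open>[r, t]\<close> onto \<open>[s, t]\<close> along this flow, and
fixing everything above level \<open>t\<close>, gives the isotopy.\<close>

lemma isotopic_superlevels_if_parallel_strips:
  fixes \<delta> :: "'b \<Rightarrow> real" and \<sigma> :: "'i \<Rightarrow> real \<Rightarrow> real \<Rightarrow> 'b"
  assumes Z: "compact_space Z" "Hausdorff_space Z"
    and \<delta>: "continuous_map Z euclideanreal \<delta>"
    and rs: "r \<le> s" "s < t"
    and I: "finite I"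
    and cont: "\<And>i. i \<in> I \<Longrightarrow> continuous_map (top_of_set ({0..1} \<times> {r..t})) Z (\<lambda>(u, h). \<sigma> i u h)"
    and level: "\<And>i u h. \<lbrakk>i \<in> I; u \<in> {0..1}; h \<in> {r..t}\<rbrakk> \<Longrightarrow> \<delta> (\<sigma> i u h) = h"
    and cover: "\<And>z. \<lbrakk>z \<in> topspace Z; \<delta> z \<in> {r..t}\<rbrakk> \<Longrightarrow> \<exists>i\<in>I. \<exists>u\<in>{0..1}. z = \<sigma> i u (\<delta> z)"
    and parallel: "\<And>i j u v h h'. \<lbrakk>i \<in> I; j \<in> I; u \<in> {0..1}; v \<in> {0..1}; h \<in> {r..t}; h' \<in> {r..t};
       \<sigma> i u h = \<sigma> j v h\<rbrakk> \<Longrightarrow> \<sigma> i u h' = \<sigma> j v h'"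
  shows "isotopic_in Z {z \<in> topspace Z. r \<le> \<delta> z} {z \<in> topspace Z. s \<le> \<delta> z}"
proof -
  let ?A = "{z \<in> topspace Z. r \<le> \<delta> z}" and ?B = "{z \<in> topspace Z. s \<le> \<delta> z}"
  have in_Z: "\<sigma> i u h \<in> topspace Z" if "i \<in> I" "u \<in> {0..1}" "h \<in> {r..t}" for i u h
    using continuous_map_image_subset_topspace[OF cont[OF that(1)]] that(2,3) by (force simp: image_subset_iff)
  \<comment> \<open>At time \<open>\<tau>\<close> the levels \<open>[r, t]\<close> are mapped affinely onto \<open>[r + \<tau> * (s - r), t]\<close>. Level \<open>t\<close> stays
    fixed, so that the flow fits together with the identity above it.\<close>
  define lam where "lam = (\<lambda>\<tau> h. t - (t - h) * (t - r - \<tau> * (s - r)) / (t - r))"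
  have fac: "0 < t - r - \<tau> * (s - r)" "t - r - \<tau> * (s - r) \<le> t - r" if "\<tau> \<in> {0..1}" for \<tau>
  proof -
    have "\<tau> * (s - r) \<le> 1 * (s - r)" using that rs by (intro mult_right_mono) auto
    also have "\<dots> < t - r" using rs by simp
    finally show "0 < t - r - \<tau> * (s - r)" by simp
    show "t - r - \<tau> * (s - r) \<le> t - r" using that rs by simp
  qed
  have lam_in: "lam \<tau> h \<in> {r..t}" if "\<tau> \<in> {0..1}" "h \<in> {r..t}" for \<tau> h
  proof -
    have "(t - h) * (t - r - \<tau> * (s - r)) \<le> (t - r) * (t - r)"
      using fac[OF that(1)] that(2) by (intro mult_mono) auto
    then have "(t - h) * (t - r - \<tau> * (s - r)) / (t - r) \<le> t - r"
      using rs by (simp add: divide_le_eq)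
    moreover have "0 \<le> (t - h) * (t - r - \<tau> * (s - r)) / (t - r)"
      using fac[OF that(1)] that(2) rs by (intro divide_nonneg_pos mult_nonneg_nonneg) auto
    ultimately show ?thesis unfolding lam_def by auto
  qed
  have lam_inj: "h = h'" if "\<tau> \<in> {0..1}" "lam \<tau> h = lam \<tau> h'" for \<tau> h h'
    using that fac[OF that(1)] rs by (auto simp: lam_def)
  have lam_t: "lam \<tau> t = t" for \<tau> by (simp add: lam_def)
  have lam_0: "lam 0 h = h" for h using rs by (simp add: lam_def)
  \<comment> \<open>\<open>T z h\<close> follows the line through \<open>z\<close> to level \<open>h\<close>; by parallelism the chosen line is immaterial.\<close>
  define T where "T = (\<lambda>z h. let (i, u) = SOME (i, u). i \<in> I \<and> u \<in> {0..1} \<and> z = \<sigma> i u (\<delta> z) in \<sigma> i u h)"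
  have T: "T (\<sigma> i u h) h' = \<sigma> i u h'"
    if "i \<in> I" "u \<in> {0..1}" "h \<in> {r..t}" "h' \<in> {r..t}" for i u h h'
  proof -
    let ?P = "\<lambda>(j, v). j \<in> I \<and> v \<in> {0..1} \<and> \<sigma> i u h = \<sigma> j v (\<delta> (\<sigma> i u h))"
    obtain j v where jv: "(SOME x. ?P x) = (j, v)" by fastforce
    have "?P (i, u)" using that level by simp
    then have "?P (SOME x. ?P x)" by (rule someI)
    then have "?P (j, v)" unfolding jv .
    then have "\<sigma> i u h' = \<sigma> j v h'"
      using that level parallel[of i j u v h h'] by auto
    then show ?thesis unfolding T_def using jv by simp
  qed
  define \<Phi> where "\<Phi> = (\<lambda>(z, \<tau>). if t \<le> \<delta> z then z else T z (lam \<tau> (\<delta> z)))"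
  have \<Phi>_strip: "\<Phi> (\<sigma> i u h, \<tau>) = \<sigma> i u (lam \<tau> h)"
    if "i \<in> I" "u \<in> {0..1}" "h \<in> {r..t}" "\<tau> \<in> {0..1}" for i u h \<tau>
    using that level T lam_in lam_t by (cases "h = t") (auto simp: \<Phi>_def)
  have \<Phi>_top: "\<Phi> (z, \<tau>) = z" if "t \<le> \<delta> z" for z \<tau>
    using that by (simp add: \<Phi>_def)
  have cases_A: thesis if z: "z \<in> ?A"
    and 1: "t \<le> \<delta> z \<Longrightarrow> thesis"
    and 2: "\<And>i u h. \<lbrakk>i \<in> I; u \<in> {0..1}; h \<in> {r..t}; h < t; z = \<sigma> i u h; \<delta> z = h\<rbrakk> \<Longrightarrow> thesis" for z thesis
  proof (cases "t \<le> \<delta> z")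
    case False
    then have "\<delta> z \<in> {r..t}" "z \<in> topspace Z" using z by auto
    with cover[of z] 2[of _ _ "\<delta> z"] False show ?thesis by force
  qed (rule 1)
  have level_\<Phi>: "\<delta> (\<Phi> (z, \<tau>)) = (if t \<le> \<delta> z then \<delta> z else lam \<tau> (\<delta> z))" 
    if "z \<in> ?A" "\<tau> \<in> {0..1}" for z \<tau>
  proof (rule cases_A[OF that(1)])
    assume "t \<le> \<delta> z" then show ?thesis by (simp add: \<Phi>_top)
  next
    fix i u h assume "i \<in> I" "u \<in> {0..1}" "h \<in> {r..t}" "h < t" "z = \<sigma> i u h" "\<delta> z = h"
    then show ?thesis using \<Phi>_strip[of i u h \<tau>] level[of i u "lam \<tau> h"] lam_in that(2) by auto
  qed
  have below_t: "lam \<tau> h < t" if "\<tau> \<in> {0..1}" "h \<in> {r..t}" "h < t" for \<tau> h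
    using lam_in[OF that(1,2)] lam_inj[OF that(1), of h t] lam_t[of \<tau>] that(3) by fastforce
  have \<Phi>_Z: "\<Phi> (z, \<tau>) \<in> topspace Z" if "z \<in> ?A" "\<tau> \<in> {0..1}" for z \<tau>
  proof (rule cases_A[OF that(1)])
    assume "t \<le> \<delta> z" then show ?thesis using that by (simp add: \<Phi>_top)
  next
    fix i u h assume "i \<in> I" "u \<in> {0..1}" "h \<in> {r..t}" "h < t" "z = \<sigma> i u h" "\<delta> z = h"
    then show ?thesis using \<Phi>_strip[of i u h \<tau>] in_Z[of i u "lam \<tau> h"] lam_in that(2) by auto
  qed
  have inj: "inj_on (\<lambda>z. \<Phi> (z, \<tau>)) ?A" if \<tau>: "\<tau> \<in> {0..1}" for \<tau>
  proof (rule inj_onI)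
    fix z w assume z: "z \<in> ?A" and w: "w \<in> ?A" and eq: "\<Phi> (z, \<tau>) = \<Phi> (w, \<tau>)"
    have lev: "(if t \<le> \<delta> z then \<delta> z else lam \<tau> (\<delta> z)) = (if t \<le> \<delta> w then \<delta> w else lam \<tau> (\<delta> w))"
      using level_\<Phi>[OF z \<tau>] level_\<Phi>[OF w \<tau>] eq by simp
    show "z = w"
    proof (rule cases_A[OF z])
      assume "t \<le> \<delta> z"
      moreover from this lev below_t[OF \<tau>, of "\<delta> w"] w have "t \<le> \<delta> w" by (auto split: if_splits)
      ultimately show ?thesis using eq by (simp add: \<Phi>_top)
    next
      fix i u h assume 1: "i \<in> I" "u \<in> {0..1}" "h \<in> {r..t}" "h < t" "z = \<sigma> i u h" "\<delta> z = h"
      show ?thesis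
      proof (rule cases_A[OF w])
        assume "t \<le> \<delta> w"
        with 1 lev below_t[OF \<tau>, of h] show ?thesis by auto
      next
        fix j v h' assume 2: "j \<in> I" "v \<in> {0..1}" "h' \<in> {r..t}" "h' < t" "w = \<sigma> j v h'" "\<delta> w = h'"
        have "lam \<tau> h = lam \<tau> h'" using lev 1 2 by auto
        then have "h' = h" using lam_inj[OF \<tau>] by metis
        with 1 2 eq \<tau> have "\<sigma> i u (lam \<tau> h) = \<sigma> j v (lam \<tau> h)" by (simp add: \<Phi>_strip)
        with parallel[of i j u v "lam \<tau> h" h] show ?thesis
          using 1 2 \<open>h' = h\<close> lam_in[OF \<tau>] by simp
      qed
    qed
  qed
  have image: "(\<lambda>z. \<Phi> (z, 1)) ` ?A = ?B"
  proof (intro subset_antisym subsetI)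
    have ge: "s \<le> lam 1 h" if "h \<in> {r..t}" for h
    proof -
      have "(t - h) * (t - s) \<le> (t - r) * (t - s)" using that rs by (intro mult_right_mono) auto
      then have "(t - h) * (t - s) / (t - r) \<le> t - s" using rs by (simp add: divide_le_eq mult.commute)
      then show ?thesis by (simp add: lam_def)
    qed
    fix y assume "y \<in> (\<lambda>z. \<Phi> (z, 1)) ` ?A"
    then obtain z where "z \<in> ?A" "y = \<Phi> (z, 1)" by blast
    with \<Phi>_Z[of z 1] level_\<Phi>[of z 1] ge[of "\<delta> z"] rs show "y \<in> ?B" by auto
  next
    fix y assume y: "y \<in> ?B"
    then have "y \<in> ?A" using rs by auto
    then show "y \<in> (\<lambda>z. \<Phi> (z, 1)) ` ?A"
    proof (rule cases_A)
      assume "t \<le> \<delta> y"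
      with \<open>y \<in> ?A\<close> show ?thesis by (intro image_eqI[of _ _ y]) (auto simp: \<Phi>_top)
    next
      fix i u h assume 1: "i \<in> I" "u \<in> {0..1}" "h \<in> {r..t}" "h < t" "y = \<sigma> i u h" "\<delta> y = h"
      define h' where "h' = t - (t - h) * (t - r) / (t - s)"
      have "lam 1 h' = h" using rs by (simp add: lam_def h'_def)
      moreover have "h' \<in> {r..t}"
      proof -
        have "(t - h) * (t - r) \<le> (t - s) * (t - r)" using y 1 rs by (intro mult_right_mono) auto
        then have "(t - h) * (t - r) / (t - s) \<le> t - r" using rs by (simp add: divide_le_eq mult.commute)
        moreover have "0 \<le> (t - h) * (t - r) / (t - s)" using 1 rs by (intro divide_nonneg_pos mult_nonneg_nonneg) auto
        ultimately show ?thesis by (auto simp: h'_def)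
      qed
      ultimately have "\<Phi> (\<sigma> i u h', 1) = y" "\<sigma> i u h' \<in> ?A"
        using 1 \<Phi>_strip[of i u h' 1] in_Z level by auto
      then show ?thesis by (intro image_eqI[of _ _ "\<sigma> i u h'"]) auto
    qed
  qed
  have closedA: "closedin Z ?A"
  proof -
    have "closedin Z {z \<in> topspace Z. \<delta> z \<in> {r..}}"
      using \<delta> by (rule closedin_continuous_map_preimage) simp
    then show ?thesis by simp
  qed
  then have compA: "compact_space (subtopology Z ?A)"
    using Z closedin_compact_space compact_space_subtopology by blast
  have HA: "Hausdorff_space (subtopology Z ?A)" using Z Hausdorff_space_subtopology by blast
  let ?Y = "prod_topology (subtopology Z ?A) (top_of_set {0..1::real})"
  have cont\<Phi>: "continuous_map ?Y Z \<Phi>"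
  proof -
    define C where "C = {z \<in> topspace Z. t \<le> \<delta> z}"
    have "closedin Z {z \<in> topspace Z. \<delta> z \<in> {t..}}"
      using \<delta> by (rule closedin_continuous_map_preimage) simp
    then have "closedin Z C" by (simp add: C_def)
    then have compC: "compact_space (subtopology Z C)"
      using Z closedin_compact_space compact_space_subtopology by blast
    have closed1: "continuous_map (subtopology ?Y (C \<times> {0..1})) Z \<Phi>"
    proof (rule continuous_map_eq[of _ _ fst])
      show "continuous_map (subtopology ?Y (C \<times> {0..1})) Z fst"
        by (rule continuous_map_from_subtopology[OF continuous_map_into_fulltopology[OF continuous_map_fst]])
    qed (auto simp: C_def \<Phi>_top)
    have closedI: "closedin ?Y {x \<in> topspace ?Y. \<Phi> x \<in> D}" if D: "closedin Z D" for D
    proof -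
      define S where "S i = {x \<in> {0..1} \<times> {r..t} \<times> {0..1}. \<sigma> i (fst x) (lam (snd (snd x)) (fst (snd x))) \<in> D}" for i
      define g where "g i = (\<lambda>x::real \<times> real \<times> real. (\<sigma> i (fst x) (fst (snd x)), snd (snd x)))" for i
      let ?K = "top_of_set ({0..1::real} \<times> {r..t} \<times> {0..1::real})"
      have K: "compact_space ?K" 
        by (simp add: compact_space_subtopology compact_Times)
      have "closedin ?Y (g i ` S i)" if i: "i \<in> I" for i
      proof -
        have "continuous_map ?K (top_of_set ({0..1} \<times> {r..t})) (\<lambda>x. (fst x, lam (snd (snd x)) (fst (snd x))))"
          using lam_in rs unfolding lam_def by (auto intro!: continuous_intros)
        from continuous_map_compose[OF this cont[OF i]]
        have "continuous_map ?K Z (\<lambda>x. \<sigma> i (fst x) (lam (snd (snd x)) (fst (snd x))))"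
          by (simp add: o_def)
        then have "closedin ?K {x \<in> topspace ?K. \<sigma> i (fst x) (lam (snd (snd x)) (fst (snd x))) \<in> D}"
          using D by (rule closedin_continuous_map_preimage)
        then have "closedin ?K (S i)" by (simp add: S_def)
        moreover have "continuous_map ?K ?Y (g i)"
          unfolding continuous_map_pairwise
        proof
          have "continuous_map ?K (top_of_set ({0..1} \<times> {r..t})) (\<lambda>x. (fst x, fst (snd x)))"
            by (auto intro!: continuous_intros)
          from continuous_map_compose[OF this cont[OF i]]
          have "continuous_map ?K Z (fst \<circ> g i)"
            by (simp add: o_def g_def)
          then show "continuous_map ?K (subtopology Z ?A) (fst \<circ> g i)"
            using i in_Z level by (auto simp: continuous_map_in_subtopology g_def)
          show "continuous_map ?K (top_of_set {0..1}) (snd \<circ> g i)"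
            by (auto simp: g_def o_def intro!: continuous_intros)
        qed
        then have "closed_map ?K ?Y (g i)"
          using K HA by (intro continuous_imp_closed_map) (auto simp: Hausdorff_space_prod_topology intro: Hausdorff_space_subtopology)
        ultimately show ?thesis by (simp add: closed_map_def)
      qed
      then have "closedin ?Y (\<Union>i\<in>I. g i ` S i)" using I by (intro closedin_Union) auto
      moreover have "closedin ?Y ((D \<inter> C) \<times> {0..1})"
      proof -
        have "closedin Z (D \<inter> C)" using D \<open>closedin Z C\<close> by blast
        then have "closedin (subtopology Z ?A) (D \<inter> C)"
          using rs closedin_subset[OF D] by (intro closedin_subset_topspace) (auto simp: C_def)
        then show ?thesis by (simp add: closedin_prod_Times_iff)
      qed
      moreover have "{x \<in> topspace ?Y. \<Phi> x \<in> D} = (D \<inter> C) \<times> {0..1} \<union> (\<Union>i\<in>I. g i ` S i)" (is "?L = ?R")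
      proof (intro subset_antisym subsetI)
        fix x assume x: "x \<in> ?L"
        obtain z \<tau> where [simp]: "x = (z, \<tau>)" by (cases x)
        have z: "z \<in> ?A" and \<tau>: "\<tau> \<in> {0..1}" and D': "\<Phi> (z, \<tau>) \<in> D" using x by auto
        show "x \<in> ?R"
        proof (rule cases_A[OF z])
          assume "t \<le> \<delta> z" then show ?thesis using z \<tau> D' by (auto simp: \<Phi>_top C_def)
        next
          fix i u h assume 1: "i \<in> I" "u \<in> {0..1}" "h \<in> {r..t}" "h < t" "z = \<sigma> i u h" "\<delta> z = h"
          then have "(u, h, \<tau>) \<in> S i" using D' \<tau> by (simp add: S_def \<Phi>_strip)
          moreover have "g i (u, h, \<tau>) = x" using 1 by (simp add: g_def)
          ultimately show ?thesis using 1 by blast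
        qed
      next
        fix x assume "x \<in> ?R"
        then consider "x \<in> (D \<inter> C) \<times> {0..1}" | i y where "i \<in> I" "y \<in> S i" "x = g i y" by blast
        then show "x \<in> ?L"
        proof cases
          case 1 then show ?thesis using rs by (auto simp: C_def \<Phi>_top)
        next
          case 2
          then show ?thesis using in_Z level by (auto simp: S_def g_def \<Phi>_strip)
        qed
      qed
      ultimately show ?thesis by (simp only: closedin_Un)
    qed
    moreover have "\<Phi> \<in> topspace ?Y \<rightarrow> topspace Z"
      using \<Phi>_Z by auto
    ultimately show ?thesis unfolding continuous_map_closedin by blast
  qed
  have emb: "embedding_map (subtopology Z ?A) Z (\<lambda>z. \<Phi> (z, \<tau>))" if \<tau>: "\<tau> \<in> {0..1}" for \<tau>
  proof (rule continuous_imp_embedding_map)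
    have "continuous_map (subtopology Z ?A) ?Y (\<lambda>z. (z, \<tau>))"
      using \<tau> by (intro continuous_map_pairedI) auto
    from continuous_map_compose[OF this cont\<Phi>]
    show "continuous_map (subtopology Z ?A) Z (\<lambda>z. \<Phi> (z, \<tau>))" by (simp add: o_def)
    show "inj_on (\<lambda>z. \<Phi> (z, \<tau>)) (topspace (subtopology Z ?A))"
      by (rule inj_on_subset[OF inj[OF \<tau>]]) auto
  qed (use compA Z in auto)
  have "\<Phi> (z, 0) = z" if "z \<in> ?A" for z
  proof (rule cases_A[OF that])
    fix i u h assume 1: "i \<in> I" "u \<in> {0..1}" "h \<in> {r..t}" "h < t" "z = \<sigma> i u h" "\<delta> z = h"
    then show ?thesis using \<Phi>_strip[OF 1(1-3), of 0] by (simp add: lam_0)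
  qed (rule \<Phi>_top)
  then show ?thesis unfolding isotopic_in_def
    by (intro exI[of _ \<Phi>] conjI ballI cont\<Phi> emb image)
qed

section \<open>Distances in a graph with edges parametrized by arc length\<close>

text \<open>The parameter \<open>x\<close> of \<open>\<psi> e x\<close> is arc length, and \<open>\<delta>\<close> is the path metric. The latter is expressed by
two properties instead of paths: \<open>\<delta>\<close> makes every edge 1-Lipschitz, and every function that is
1-Lipschitz along all edges is 1-Lipschitz for \<open>\<delta>\<close>. Lower bounds for distances are then obtained by
exhibiting functions, and a change of the cell structure does not require any surgery on paths.\<close>

locale length_graph =
  fixes X :: "'a topology" and V :: "'a set" and E :: "'e set"
    and \<psi> :: "'e \<Rightarrow> real \<Rightarrow> 'a" and a :: "'e \<Rightarrow> real" and \<delta> :: "'a \<Rightarrow> 'a \<Rightarrow> real"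
  assumes Hausdorff: "Hausdorff_space X"
    and finite_V: "finite V" and finite_E: "finite E"
    and V_subset: "V \<subseteq> topspace X"
    and a_pos: "e \<in> E \<Longrightarrow> 0 < a e"
    and cont: "e \<in> E \<Longrightarrow> continuous_map (top_of_set {0..a e}) X (\<psi> e)"
    and start_in_V: "e \<in> E \<Longrightarrow> \<psi> e 0 \<in> V"
    and end_in_V: "e \<in> E \<Longrightarrow> \<psi> e (a e) \<in> V"
    and no_loop: "e \<in> E \<Longrightarrow> \<psi> e 0 \<noteq> \<psi> e (a e)"
    and inner: "\<lbrakk>e \<in> E; 0 < x; x < a e\<rbrakk> \<Longrightarrow> \<psi> e x \<notin> V"
    and inj: "\<lbrakk>e \<in> E; f \<in> E; 0 < x; x < a e; y \<in> {0..a f}; \<psi> e x = \<psi> f y\<rbrakk> \<Longrightarrow> e = f \<and> x = y"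
    and covered: "p \<in> topspace X \<Longrightarrow> \<exists>e\<in>E. \<exists>x\<in>{0..a e}. p = \<psi> e x"
    and dist_self: "p \<in> topspace X \<Longrightarrow> \<delta> p p = 0"
    and dist_sym: "\<lbrakk>p \<in> topspace X; q \<in> topspace X\<rbrakk> \<Longrightarrow> \<delta> p q = \<delta> q p"
    and dist_triangle: "\<lbrakk>p \<in> topspace X; q \<in> topspace X; s \<in> topspace X\<rbrakk> \<Longrightarrow> \<delta> p s \<le> \<delta> p q + \<delta> q s"
    and dist_le: "\<lbrakk>e \<in> E; x \<in> {0..a e}; y \<in> {0..a e}\<rbrakk> \<Longrightarrow> \<delta> (\<psi> e x) (\<psi> e y) \<le> \<bar>x - y\<bar>"
    and dist_greatest: "\<lbrakk>\<And>e x y. \<lbrakk>e \<in> E; x \<in> {0..a e}; y \<in> {0..a e}\<rbrakk> \<Longrightarrow> h (\<psi> e x) - h (\<psi> e y) \<le> \<bar>x - y\<bar>;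
         p \<in> topspace X; q \<in> topspace X\<rbrakk> \<Longrightarrow> h p - h q \<le> \<delta> p q"
begin

lemma in_X: "\<lbrakk>e \<in> E; x \<in> {0..a e}\<rbrakk> \<Longrightarrow> \<psi> e x \<in> topspace X"
  using continuous_map_image_subset_topspace[OF cont] by fastforce

lemma dist_nonneg: "\<lbrakk>p \<in> topspace X; q \<in> topspace X\<rbrakk> \<Longrightarrow> 0 \<le> \<delta> p q"
  using dist_triangle[of p q p] dist_self[of p] dist_sym[of p q] by simp

lemma dist_lipschitz:
  assumes "e \<in> E" "x \<in> {0..a e}" "y \<in> {0..a e}" "q \<in> topspace X"
  shows "\<bar>\<delta> (\<psi> e x) q - \<delta> (\<psi> e y) q\<bar> \<le> \<bar>x - y\<bar>"
proof -
  note X = in_X[OF assms(1,2)] in_X[OF assms(1,3)]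
  show ?thesis
    using dist_triangle[OF X assms(4)] dist_triangle[OF X(2,1) assms(4)] dist_sym[OF X]
      dist_le[OF assms(1-3)] by linarith
qed

text \<open>Replacing the values of \<open>\<delta> _ q\<close> on the single edge \<open>e\<close> by those of \<open>k\<close> leaves the function 1-Lipschitz
along all edges.\<close>

lemma dist_from_edge_ge:
  assumes e: "e \<in> E" and q: "q \<in> topspace X" and x: "x \<in> {0..a e}"
    and k: "\<And>x y. \<lbrakk>x \<in> {0..a e}; y \<in> {0..a e}\<rbrakk> \<Longrightarrow> k x - k y \<le> \<bar>x - y\<bar>"
    and ends: "k 0 = \<delta> (\<psi> e 0) q" "k (a e) = \<delta> (\<psi> e (a e)) q"
    and at_q: "\<And>y. \<lbrakk>0 < y; y < a e; q = \<psi> e y\<rbrakk> \<Longrightarrow> k y \<le> 0"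
  shows "k x \<le> \<delta> (\<psi> e x) q"
proof -
  define h where "h p = (if \<exists>x. 0 < x \<and> x < a e \<and> p = \<psi> e x
    then k (SOME x. 0 < x \<and> x < a e \<and> p = \<psi> e x) else \<delta> p q)" for p
  have h_in: "h (\<psi> e y) = k y" if "0 < y" "y < a e" for y
  proof -
    have "(SOME x. 0 < x \<and> x < a e \<and> \<psi> e y = \<psi> e x) = y"
    proof (rule some_equality)
      fix x assume "0 < x \<and> x < a e \<and> \<psi> e y = \<psi> e x"
      with inj[OF e e that, of x] show "x = y" by simp
    qed (use that in simp)
    then show ?thesis using that by (auto simp: h_def)
  qed
  have h_e: "h (\<psi> e y) = k y" if y: "y \<in> {0..a e}" for y
  proof (cases "y = 0 \<or> y = a e")
    case True
    then have "\<psi> e y \<in> V" using start_in_V end_in_V e by auto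
    then have "\<nexists>x. 0 < x \<and> x < a e \<and> \<psi> e y = \<psi> e x" using inner[OF e] by metis
    then show ?thesis using True ends by (auto simp: h_def)
  next
    case False
    then show ?thesis using y h_in by auto
  qed
  have h_f: "h (\<psi> f y) = \<delta> (\<psi> f y) q" if "f \<in> E" "f \<noteq> e" "y \<in> {0..a f}" for f y
  proof -
    have "\<nexists>x. 0 < x \<and> x < a e \<and> \<psi> f y = \<psi> e x" using inj[OF e that(1)] that(2,3) by metis
    then show ?thesis by (auto simp: h_def)
  qed
  have "h q \<le> 0"
  proof (cases "\<exists>y. 0 < y \<and> y < a e \<and> q = \<psi> e y")
    case True
    then show ?thesis using at_q h_in by force
  next
    case False
    then show ?thesis unfolding h_def using dist_self[OF q] by auto
  qed
  moreover have "h (\<psi> e x) - h q \<le> \<delta> (\<psi> e x) q"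
  proof (rule dist_greatest[OF _ in_X[OF e x] q])
    fix f x y assume f: "f \<in> E" and xy: "x \<in> {0..a f}" "y \<in> {0..a f}"
    show "h (\<psi> f x) - h (\<psi> f y) \<le> \<bar>x - y\<bar>"
    proof (cases "f = e")
      case True then show ?thesis using k h_e xy by simp
    next
      case False then show ?thesis using h_f f xy dist_lipschitz[OF f xy q] by simp
    qed
  qed
  ultimately show ?thesis using h_e[OF x] by simp
qed

text \<open>A path from a point of an edge to a point outside leaves the edge through one of its ends.\<close>

lemma dist_outside_edge:
  assumes e: "e \<in> E" and q: "q \<in> topspace X" and x: "x \<in> {0..a e}"
    and out: "\<And>y. \<lbrakk>0 < y; y < a e\<rbrakk> \<Longrightarrow> q \<noteq> \<psi> e y"
  shows "\<delta> (\<psi> e x) q = min (x + \<delta> (\<psi> e 0) q) (a e - x + \<delta> (\<psi> e (a e)) q)"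
proof (rule antisym)
  have z: "0 \<in> {0..a e}" "a e \<in> {0..a e}" using a_pos[OF e] by auto
  show "\<delta> (\<psi> e x) q \<le> min (x + \<delta> (\<psi> e 0) q) (a e - x + \<delta> (\<psi> e (a e)) q)"
    using dist_lipschitz[OF e x z(1) q] dist_lipschitz[OF e x z(2) q] x by auto
  show "min (x + \<delta> (\<psi> e 0) q) (a e - x + \<delta> (\<psi> e (a e)) q) \<le> \<delta> (\<psi> e x) q"
    using dist_lipschitz[OF e z q] out a_pos[OF e]
    by (intro dist_from_edge_ge[where k = "\<lambda>x. min (x + \<delta> (\<psi> e 0) q) (a e - x + \<delta> (\<psi> e (a e)) q)", OF e q x])
      (auto simp: min_def)
qed

lemma vertex_not_inside:
  "\<lbrakk>e \<in> E; v \<in> V; 0 < y; y < a e\<rbrakk> \<Longrightarrow> v \<noteq> \<psi> e y"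
  using inner by blast

text \<open>A path between two points of an edge either stays inside, or leaves through one end and comes back
through the other.\<close>

lemma dist_same_edge:
  assumes e: "e \<in> E" and x: "x \<in> {0..a e}" and y: "y \<in> {0..a e}"
  defines "D \<equiv> \<delta> (\<psi> e 0) (\<psi> e (a e))"
  shows "\<delta> (\<psi> e x) (\<psi> e y) = min \<bar>x - y\<bar> (min (x + D + a e - y) (y + D + a e - x))"
proof (rule antisym)
  have z: "0 \<in> {0..a e}" "a e \<in> {0..a e}" using a_pos[OF e] by auto
  note X = in_X[OF e z(1)] in_X[OF e z(2)] in_X[OF e x] in_X[OF e y]
  let ?q = "\<psi> e y"
  have A: "\<delta> (\<psi> e 0) ?q = min y (a e - y + D)"
    using dist_outside_edge[OF e X(1) y] vertex_not_inside[OF e start_in_V[OF e]] dist_sym[OF X(1,4)]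
      dist_self[OF X(1)] dist_sym[OF X(1,2)] by (simp add: D_def)
  have B: "\<delta> (\<psi> e (a e)) ?q = min (y + D) (a e - y)"
    using dist_outside_edge[OF e X(2) y] vertex_not_inside[OF e end_in_V[OF e]] dist_sym[OF X(2,4)]
      dist_self[OF X(2)] by (simp add: D_def)
  show "\<delta> (\<psi> e x) ?q \<le> min \<bar>x - y\<bar> (min (x + D + a e - y) (y + D + a e - x))"
    using dist_le[OF e x y] dist_lipschitz[OF e x z(1) X(4)] dist_lipschitz[OF e x z(2) X(4)] A B x y
    by (auto simp: min_def split: if_splits)
  let ?k = "\<lambda>x. min \<bar>x - y\<bar> (min (x + D + a e - y) (y + D + a e - x))"
  have D: "0 \<le> D" "D \<le> a e" using dist_nonneg[OF X(1,2)] dist_le[OF e z] a_pos[OF e] by (auto simp: D_def)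
  show "?k x \<le> \<delta> (\<psi> e x) ?q"
  proof (rule dist_from_edge_ge[where k = ?k, OF e X(4) x])
    show "?k 0 = \<delta> (\<psi> e 0) ?q" using A y D by (auto simp: min_def)
    show "?k (a e) = \<delta> (\<psi> e (a e)) ?q" using B y D by (auto simp: min_def)
    show "?k w \<le> 0" if "0 < w" "w < a e" "?q = \<psi> e w" for w
      using inj[OF e e that(1,2) y] that D by auto
  qed (auto simp: min_def abs_if)
qed

text \<open>A pair \<open>(e, b)\<close> is a dart: the edge \<open>e\<close> with a direction, reversed if \<open>b\<close> holds. With darts the four
corners of a product of two edges are treated alike.\<close>

definition pt :: "'e \<Rightarrow> bool \<Rightarrow> real \<Rightarrow> 'a" where
  "pt e b x = \<psi> e (if b then a e - x else x)"

abbreviation src :: "'e \<Rightarrow> bool \<Rightarrow> 'a" where "src e b \<equiv> pt e b 0"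

lemma pt_in_X: "\<lbrakk>e \<in> E; x \<in> {0..a e}\<rbrakk> \<Longrightarrow> pt e b x \<in> topspace X"
  by (auto simp: pt_def intro: in_X)

lemma src_in_V: "e \<in> E \<Longrightarrow> src e b \<in> V"
  using start_in_V end_in_V by (auto simp: pt_def)

lemma src_in_X: "e \<in> E \<Longrightarrow> src e b \<in> topspace X"
  using src_in_V V_subset by blast

lemma pt_reverse: "pt e (\<not> b) x = pt e b (a e - x)"
  by (simp add: pt_def)

lemma src_neq: "e \<in> E \<Longrightarrow> src e b \<noteq> src e (\<not> b)"
  using no_loop by (cases b) (force simp: pt_def)+

lemma dist_pt_outside:
  assumes e: "e \<in> E" and q: "q \<in> topspace X" and x: "x \<in> {0..a e}"
    and out: "\<And>y. \<lbrakk>0 < y; y < a e\<rbrakk> \<Longrightarrow> q \<noteq> \<psi> e y"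
  shows "\<delta> (pt e b x) q = min (x + \<delta> (src e b) q) (a e - x + \<delta> (src e (\<not> b)) q)"
proof (cases b)
  case True
  then show ?thesis using dist_outside_edge[OF e q _ out, of "a e - x"] x by (simp add: pt_def min.commute)
next
  case False
  then show ?thesis using dist_outside_edge[OF e q x out] by (simp add: pt_def)
qed

lemma dist_vertex_pt:
  assumes "e \<in> E" "v \<in> V" "x \<in> {0..a e}"
  shows "\<delta> v (pt e b x) = min (x + \<delta> v (src e b)) (a e - x + \<delta> v (src e (\<not> b)))"
proof -
  have "v \<in> topspace X" using assms V_subset by auto
  then show ?thesis
    using dist_pt_outside[OF assms(1) _ assms(3)] vertex_not_inside[OF assms(1,2)] 
      dist_sym[of v] pt_in_X[OF assms(1)] src_in_X[OF assms(1)] assms(3) by simp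
qed

text \<open>On a product of two distinct edges the distance is the minimum of four affine functions, one for each
corner of the rectangle. Its superlevel sets are the rectangle with four diagonal cuts.\<close>

lemma dist_pt_pt:
  assumes "e \<in> E" "f \<in> E" "e \<noteq> f" "x \<in> {0..a e}" "y \<in> {0..a f}"
  shows "\<delta> (pt e b x) (pt f c y) =
    min (min (x + y + \<delta> (src e b) (src f c)) (x + (a f - y) + \<delta> (src e b) (src f (\<not> c))))
        (min ((a e - x) + y + \<delta> (src e (\<not> b)) (src f c)) ((a e - x) + (a f - y) + \<delta> (src e (\<not> b)) (src f (\<not> c))))"
proof -
  have "pt f c y \<noteq> \<psi> e z" if "0 < z" "z < a e" for z
    using inj[OF assms(1,2) that, of "if c then a f - y else y"] assms(3,5) by (auto simp: pt_def)
  then have "\<delta> (pt e b x) (pt f c y) = min (x + \<delta> (src e b) (pt f c y)) (a e - x + \<delta> (src e (\<not> b)) (pt f c y))"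
    using assms by (intro dist_pt_outside pt_in_X) auto
  then show ?thesis
    using dist_vertex_pt[OF assms(2) src_in_V[OF assms(1)] assms(5)] by (simp add: min_def)
qed

lemma dist_pt_same:
  assumes "e \<in> E" "x \<in> {0..a e}" "y \<in> {0..a e}"
  shows "\<delta> (pt e b x) (pt e b y) = min \<bar>x - y\<bar> (min (x + \<delta> (src e b) (src e (\<not> b)) + a e - y) (y + \<delta> (src e b) (src e (\<not> b)) + a e - x))"
proof (cases b)
  case True
  have "\<delta> (\<psi> e (a e)) (\<psi> e 0) = \<delta> (\<psi> e 0) (\<psi> e (a e))"
    using dist_sym in_X[OF assms(1)] a_pos[OF assms(1)] by simp
  then show ?thesis using True dist_same_edge[OF assms(1), of "a e - x" "a e - y"] assms(2,3) 
    by (simp add: pt_def)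
next
  case False
  then show ?thesis using dist_same_edge[OF assms] by (simp add: pt_def)
qed

lemma dist_pt_le:
  assumes "e \<in> E" "f \<in> E" "x \<in> {0..a e}" "y \<in> {0..a f}"
  shows "\<delta> (pt e b x) (pt f c y) \<le> x + y + \<delta> (src e b) (src f c)"
proof -
  note X = pt_in_X[OF assms(1,3), of b] pt_in_X[OF assms(2,4), of c] src_in_X[OF assms(1), of b] src_in_X[OF assms(2), of c]
  have 1: "\<delta> (pt e b x) (src e b) \<le> x" if "e \<in> E" "x \<in> {0..a e}" for e b x
    using dist_le[OF that(1), of "if b then a e - x else x" "if b then a e else 0"] that(2) by (auto simp: pt_def)
  show ?thesis
    using 1[OF assms(1,3), of b] 1[OF assms(2,4), of c] dist_triangle[OF X(1,3,2)] dist_triangle[OF X(3,4,2)]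
      dist_sym[OF X(4,2)] by linarith
qed

lemma continuous_dist: "continuous_map (prod_topology X X) euclideanreal (\<lambda>(p, q). \<delta> p q)"
proof (rule continuous_map_from_compact_cover[where I = "E \<times> E" and K = "\<lambda>(e, f). top_of_set ({0..a e} \<times> {0..a f})"
      and g = "\<lambda>(e, f) (x, y). (\<psi> e x, \<psi> f y)"])
  show "finite (E \<times> E)" using finite_E by simp
  show "Hausdorff_space (prod_topology X X)" using Hausdorff by (simp add: Hausdorff_space_prod_topology)
  show "topspace (prod_topology X X) \<subseteq> (\<Union>i\<in>E \<times> E. (case i of (e, f) \<Rightarrow> \<lambda>(x, y). (\<psi> e x, \<psi> f y)) ` topspace (case i of (e, f) \<Rightarrow> top_of_set ({0..a e} \<times> {0..a f})))"
  proof
    fix z assume "z \<in> topspace (prod_topology X X)"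
    then obtain p q where z: "z = (p, q)" "p \<in> topspace X" "q \<in> topspace X" by auto
    then obtain e x f y where "e \<in> E" "x \<in> {0..a e}" "p = \<psi> e x" "f \<in> E" "y \<in> {0..a f}" "q = \<psi> f y"
      using covered by metis
    then show "z \<in> (\<Union>i\<in>E \<times> E. (case i of (e, f) \<Rightarrow> \<lambda>(x, y). (\<psi> e x, \<psi> f y)) ` topspace (case i of (e, f) \<Rightarrow> top_of_set ({0..a e} \<times> {0..a f})))"
      using z by (intro UN_I[of "(e, f)"]) force+
  qed
next
  fix i assume "i \<in> E \<times> E"
  then obtain e f where i: "i = (e, f)" "e \<in> E" "f \<in> E" by auto
  show "compact_space (case i of (e, f) \<Rightarrow> top_of_set ({0..a e} \<times> {0..a f}))"
    using i by (simp add: compact_space_subtopology compact_Times)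
  show "continuous_map (case i of (e, f) \<Rightarrow> top_of_set ({0..a e} \<times> {0..a f})) (prod_topology X X)
          (case i of (e, f) \<Rightarrow> \<lambda>(x, y). (\<psi> e x, \<psi> f y))"
  proof -
    have "continuous_map (prod_topology (top_of_set {0..a e}) (top_of_set {0..a f})) (prod_topology X X) (\<lambda>(x, y). (\<psi> e x, \<psi> f y))"
      unfolding continuous_map_prod_top using cont i by blast
    then show ?thesis using i by simp
  qed
  have "continuous_on ({0..a e} \<times> {0..a f}) (\<lambda>(x, y). \<delta> (\<psi> e x) (\<psi> f y))"
  proof (rule lipschitz_on_continuous_on[of 2], rule lipschitz_onI)
    fix z w assume "z \<in> {0..a e} \<times> {0..a f}" "w \<in> {0..a e} \<times> {0..a f}"
    then obtain x y x' y' where zw: "z = (x, y)" "w = (x', y')" "x \<in> {0..a e}" "x' \<in> {0..a e}"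
      "y \<in> {0..a f}" "y' \<in> {0..a f}" by auto
    note X = in_X[OF i(2) zw(3)] in_X[OF i(2) zw(4)] in_X[OF i(3) zw(5)] in_X[OF i(3) zw(6)]
    have "\<bar>\<delta> (\<psi> e x) (\<psi> f y) - \<delta> (\<psi> e x') (\<psi> f y')\<bar> \<le> \<bar>x - x'\<bar> + \<bar>y - y'\<bar>"
      using dist_lipschitz[OF i(2) zw(3,4) X(3)] dist_lipschitz[OF i(3) zw(5,6) X(2)]
        dist_sym[OF X(2,3)] dist_sym[OF X(2,4)] by linarith
    also have "\<dots> \<le> 2 * dist z w"
      using dist_fst_le[of z w] dist_snd_le[of z w] zw by (simp add: dist_real_def)
    finally show "dist (case z of (x, y) \<Rightarrow> \<delta> (\<psi> e x) (\<psi> f y)) (case w of (x, y) \<Rightarrow> \<delta> (\<psi> e x) (\<psi> f y)) \<le> 2 * dist z w"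
      using zw by (simp add: dist_real_def)
  qed simp
  then show "continuous_map (case i of (e, f) \<Rightarrow> top_of_set ({0..a e} \<times> {0..a f})) euclideanreal
          (\<lambda>k. case (case i of (e, f) \<Rightarrow> \<lambda>(x, y). (\<psi> e x, \<psi> f y)) k of (p, q) \<Rightarrow> \<delta> p q)"
    using i by (simp add: case_prod_unfold)
qed

section \<open>Critical values and their number\<close>

text \<open>The maximum of \<open>\<delta> v\<close> on the closed edge \<open>e\<close>, where the distances around both ends agree.\<close>

definition peak :: "'a \<Rightarrow> 'e \<Rightarrow> real" where
  "peak v e = (\<delta> v (\<psi> e 0) + \<delta> v (\<psi> e (a e)) + a e) / 2"

text \<open>The maximum of \<open>\<delta>\<close> on the product of two distinct edges, where the distances through a pair of opposite
corners agree.\<close>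

definition pair_peak :: "'e \<Rightarrow> 'e \<Rightarrow> real" where
  "pair_peak e f = (a e + a f + min (\<delta> (\<psi> e 0) (\<psi> f 0) + \<delta> (\<psi> e (a e)) (\<psi> f (a f)))
                          (\<delta> (\<psi> e 0) (\<psi> f (a f)) + \<delta> (\<psi> e (a e)) (\<psi> f 0))) / 2"

text \<open>The superlevel set of \<open>\<delta>\<close> in a rectangle is a polygon. Its shape can change only when a corner begins
to be cut off, when a side is used up, or when the polygon vanishes. These are the three kinds of
values; the maximum of \<open>\<delta>\<close> on a square \<open>e \<times> e\<close> is the peak of \<open>e\<close> as seen from either end.\<close>

definition critical :: "real set" where
  "critical = {\<delta> v w |v w. v \<in> V \<and> w \<in> V \<and> v \<noteq> w} \<union> {peak v e |v e. v \<in> V \<and> e \<in> E}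
     \<union> {pair_peak e f |e f. e \<in> E \<and> f \<in> E \<and> e \<noteq> f}"

lemma peak_src: "peak v e = (\<delta> v (src e b) + \<delta> v (src e (\<not> b)) + a e) / 2"
  by (simp add: peak_def pt_def)

lemma pair_peak_src_le:
  "2 * pair_peak e f \<le> a e + a f + \<delta> (src e b) (src f c) + \<delta> (src e (\<not> b)) (src f (\<not> c))"
  "2 * pair_peak e f \<le> a e + a f + \<delta> (src e b) (src f (\<not> c)) + \<delta> (src e (\<not> b)) (src f c)"
  by (cases b; cases c; auto simp: pair_peak_def pt_def min_def)+

lemma pair_peak_ge:
  assumes "2 * h \<le> a e + a f + \<delta> (src e b) (src f c) + \<delta> (src e (\<not> b)) (src f (\<not> c))"
    "2 * h \<le> a e + a f + \<delta> (src e b) (src f (\<not> c)) + \<delta> (src e (\<not> b)) (src f c)"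
  shows "h \<le> pair_peak e f"
  using assms by (cases b; cases c; auto simp: pair_peak_def pt_def min_def)+

text \<open>If no edge at \<open>v\<close> ended a shortest path from \<open>w\<close>, then \<open>\<delta> w\<close> could be raised at the vertex \<open>v\<close> alone
by a small amount and extended over the edges as a 1-Lipschitz function. It would exceed the distance
at \<open>v\<close>.\<close>

lemma predecessor:
  assumes v: "v \<in> V" and w: "w \<in> V" and "v \<noteq> w"
  shows "\<exists>e\<in>E. \<exists>b. src e b = v \<and> \<delta> w v = \<delta> w (src e (\<not> b)) + a e"
proof (rule ccontr)
  assume no: "\<not> ?thesis"
  have vX: "v \<in> topspace X" and wX: "w \<in> topspace X" using v w V_subset by auto
  \<comment> \<open>The slack left by the edge of a dart that starts at \<open>v\<close>.\<close>
  define gap where "gap = (\<lambda>(e, b). \<delta> w (src e (\<not> b)) + a e - \<delta> w v)"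
  define G where "G = {(e, b). e \<in> E \<and> src e b = v}"
  have "G \<subseteq> E \<times> UNIV" by (auto simp: G_def)
  then have finG: "finite G" using finite_E by (rule finite_subset[OF _ finite_cartesian_product]) simp_all
  have ends_le: "\<delta> w (src e b) \<le> \<delta> w (src e (\<not> b)) + a e" if "e \<in> E" for e b
    using dist_vertex_pt[OF that w, of 0 b] a_pos[OF that] by (simp add: min_def split: if_splits)
  have "0 < gap x" if G: "x \<in> G" for x
  proof -
    obtain e b where x: "x = (e, b)" "e \<in> E" "src e b = v" using G by (cases x) (auto simp: G_def)
    then have "\<delta> w v \<noteq> \<delta> w (src e (\<not> b)) + a e" using no by blast
    then show ?thesis using ends_le[OF x(2), of b] x by (simp add: gap_def)
  qed
  then have \<eta>: "0 < Min (insert 1 (gap ` G))" using finG by (subst Min_gr_iff) auto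
  define \<eta> where "\<eta> = Min (insert 1 (gap ` G))"
  have \<eta>_le: "\<eta> \<le> gap x" if "x \<in> G" for x
    unfolding \<eta>_def using that finG by (intro Min_le) auto
  note \<eta> = \<eta>[folded \<eta>_def]
  define g where "g u = \<delta> w u + (if u = v then \<eta> else 0)" for u
  have g_le: "g (src e b) \<le> g (src e (\<not> b)) + a e" if e: "e \<in> E" for e b
  proof (cases "src e b = v")
    case True
    then have "\<eta> \<le> gap (e, b)" using e by (intro \<eta>_le) (simp add: G_def)
    then show ?thesis using True src_neq[OF e, of b] by (auto simp: g_def gap_def)
  next
    case False
    then show ?thesis using ends_le[OF e, of b] \<eta> by (auto simp: g_def)
  qed
  define l where "l e x = min (g (\<psi> e 0) + x) (g (\<psi> e (a e)) + a e - x)" for e x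
  define h where "h p = (if p \<in> V then g p else case (SOME (e, x). e \<in> E \<and> 0 < x \<and> x < a e \<and> p = \<psi> e x) of (e, x) \<Rightarrow> l e x)" for p
  have h: "h (\<psi> e x) = l e x" if e: "e \<in> E" and x: "x \<in> {0..a e}" for e x
  proof -
    consider "x = 0" | "x = a e" | "0 < x" "x < a e" using x by (auto simp: less_le)
    then show ?thesis
    proof cases
      case 1
      then show ?thesis using g_le[OF e, of False] start_in_V[OF e] by (simp add: h_def l_def pt_def)
    next
      case 2
      then show ?thesis using g_le[OF e, of True] end_in_V[OF e] by (simp add: h_def l_def pt_def)
    next
      case 3
      have "(SOME (f, y). f \<in> E \<and> 0 < y \<and> y < a f \<and> \<psi> e x = \<psi> f y) = (e, x)"
      proof (rule some_equality)
        show "case (e, x) of (f, y) \<Rightarrow> f \<in> E \<and> 0 < y \<and> y < a f \<and> \<psi> e x = \<psi> f y" using e 3 by simp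
        fix z assume z: "case z of (f, y) \<Rightarrow> f \<in> E \<and> 0 < y \<and> y < a f \<and> \<psi> e x = \<psi> f y"
        obtain f y where fy: "z = (f, y)" by (cases z)
        then have f: "f \<in> E" "y \<in> {0..a f}" "\<psi> e x = \<psi> f y" using z by simp_all
        from inj[OF e f(1) 3 f(2,3)] show "z = (e, x)" using fy by simp
      qed
      then show ?thesis using inner[OF e 3] by (simp add: h_def)
    qed
  qed
  have "h v - h w \<le> \<delta> v w"
  proof (rule dist_greatest[where h = h, OF _ vX wX])
    fix e x y assume "e \<in> E" "x \<in> {0..a e}" "y \<in> {0..a e}"
    then have "h (\<psi> e x) = l e x" "h (\<psi> e y) = l e y" using h by blast+
    moreover have "l e x - l e y \<le> \<bar>x - y\<bar>" unfolding l_def by linarith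
    ultimately show "h (\<psi> e x) - h (\<psi> e y) \<le> \<bar>x - y\<bar>" by simp
  qed
  moreover have "h v = \<delta> w v + \<eta>" "h w = 0"
    using v w \<open>v \<noteq> w\<close> dist_self[OF wX] by (simp_all add: h_def g_def)
  ultimately show False using \<eta> dist_sym[OF vX wX] by linarith
qed

text \<open>Every vertex other than a root \<open>v\<close> is sent to an edge by which a shortest path from \<open>v\<close> arrives. The
map is injective, as the far end of that edge is strictly closer to \<open>v\<close>. If \<open>card V = card E + 1\<close> (the
case of a tree), it is onto, so that along every edge the distance from \<open>v\<close> increases all the way to
one end: the peak is attained at a vertex.\<close>

lemma card_V_le: "card V \<le> card E + 1"
  and tree_midpoint: "\<lbrakk>card V = card E + 1; v \<in> V; e \<in> E\<rbrakk> \<Longrightarrow> \<exists>w\<in>V. w \<noteq> v \<and> peak v e = \<delta> v w"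
proof -
  have main: "card V \<le> card E + 1 \<and> (card V = card E + 1 \<longrightarrow> (\<forall>e\<in>E. \<exists>w\<in>V. w \<noteq> v \<and> peak v e = \<delta> v w))"
    if v: "v \<in> V" for v
  proof -
    have "\<forall>u\<in>V - {v}. \<exists>e. e \<in> E \<and> (\<exists>b. src e b = u \<and> \<delta> v u = \<delta> v (src e (\<not> b)) + a e)"
    proof
      fix u assume "u \<in> V - {v}"
      with predecessor[of u v] v show "\<exists>e. e \<in> E \<and> (\<exists>b. src e b = u \<and> \<delta> v u = \<delta> v (src e (\<not> b)) + a e)" by auto
    qed
    from bchoice[OF this] obtain F where
      F0: "\<forall>u\<in>V - {v}. F u \<in> E \<and> (\<exists>b. src (F u) b = u \<and> \<delta> v u = \<delta> v (src (F u) (\<not> b)) + a (F u))" ..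
    have F: "F u \<in> E" "\<exists>b. src (F u) b = u \<and> \<delta> v u = \<delta> v (src (F u) (\<not> b)) + a (F u)"
      if "u \<in> V - {v}" for u
      using F0 that by auto
    have inj: "inj_on F (V - {v})"
    proof (rule inj_onI, rule ccontr)
      fix u u' assume u: "u \<in> V - {v}" "u' \<in> V - {v}" "F u = F u'" "u \<noteq> u'"
      obtain b where b: "src (F u) b = u" "\<delta> v u = \<delta> v (src (F u) (\<not> b)) + a (F u)" using F(2)[OF u(1)] by blast
      obtain c where c: "src (F u) c = u'" "\<delta> v u' = \<delta> v (src (F u) (\<not> c)) + a (F u)" using F(2)[OF u(2)] u(3) by auto
      have "b \<noteq> c"
      proof
        assume "b = c"
        then show False using b(1) c(1) u(4) by simp
      qed
      then have "c = (\<not> b)" by auto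
      then show False using b c a_pos[OF F(1)[OF u(1)]] by simp
    qed
    have "card V = card (V - {v}) + 1" using card.remove[OF finite_V v] by simp
    moreover have "card (V - {v}) \<le> card E" using inj F(1) finite_E by (intro card_inj_on_le[of F]) auto
    moreover have "\<exists>w\<in>V. w \<noteq> v \<and> peak v e = \<delta> v w" if eq: "card (V - {v}) = card E" and e: "e \<in> E" for e
    proof -
      have "F ` (V - {v}) = E"
        using inj F(1) finite_E eq by (intro card_subset_eq) (auto simp: card_image)
      then obtain u where u: "u \<in> V - {v}" "F u = e" using e by (metis imageE)
      with F(2)[OF u(1)] obtain b where u': "src e b = u" "\<delta> v u = \<delta> v (src e (\<not> b)) + a e" by auto
      have "peak v e = \<delta> v u" using peak_src[of v e b] u' by simp
      then show ?thesis using u by blast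
    qed
    ultimately show ?thesis by auto
  qed
  show "card V \<le> card E + 1"
    using main by (cases "V = {}") auto
  show "\<lbrakk>card V = card E + 1; v \<in> V; e \<in> E\<rbrakk> \<Longrightarrow> \<exists>w\<in>V. w \<noteq> v \<and> peak v e = \<delta> v w"
    using main by blast
qed

lemma card_symmetric_values:
  assumes "finite A" and "\<And>x y. \<lbrakk>x \<in> A; y \<in> A\<rbrakk> \<Longrightarrow> F x y = F y x"
  shows "finite {F x y |x y. x \<in> A \<and> y \<in> A \<and> x \<noteq> y} \<and>
         2 * card {F x y |x y. x \<in> A \<and> y \<in> A \<and> x \<noteq> y} \<le> card A * (card A - 1)"
  using assms
proof (induction A rule: finite_induct)
  case empty
  then show ?case by simp
next
  case (insert z A)
  let ?S = "\<lambda>A. {F x y |x y. x \<in> A \<and> y \<in> A \<and> x \<noteq> y}"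
  have IH: "finite (?S A)" "2 * card (?S A) \<le> card A * (card A - 1)"
  proof -
    have "F x y = F y x" if "x \<in> A" "y \<in> A" for x y
      using that by (intro insert.prems insertI2)
    from insert.IH[OF this] show "finite (?S A)" "2 * card (?S A) \<le> card A * (card A - 1)" by blast+
  qed
  have sub: "?S (insert z A) \<subseteq> ?S A \<union> F z ` A"
  proof
    fix c assume "c \<in> ?S (insert z A)"
    then obtain x y where c: "c = F x y" "x \<in> insert z A" "y \<in> insert z A" "x \<noteq> y" by blast
    then consider "x = z" "y \<in> A" | "y = z" "x \<in> A" | "x \<in> A" "y \<in> A" by blast
    then show "c \<in> ?S A \<union> F z ` A"
    proof cases
      case 2
      then have "c = F z x" using c insert.prems[OF c(2,3)] by simp
      then show ?thesis using 2 by blast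
    qed (use c in blast)+
  qed
  have fin: "finite (?S A \<union> F z ` A)" using IH insert.hyps by simp
  have "card (?S (insert z A)) \<le> card (?S A \<union> F z ` A)" by (rule card_mono[OF fin sub])
  also have "\<dots> \<le> card (?S A) + card A"
    using card_Un_le[of "?S A" "F z ` A"] card_image_le[OF insert.hyps(1), of "F z"] by linarith
  finally have "2 * card (?S (insert z A)) \<le> card A * (card A - 1) + 2 * card A" using IH by linarith
  also have "\<dots> = card (insert z A) * (card (insert z A) - 1)"
    using insert.hyps by (cases "card A") auto
  finally show ?case using finite_subset[OF sub fin] by blast
qed

lemma pair_peak_sym: "\<lbrakk>e \<in> E; f \<in> E\<rbrakk> \<Longrightarrow> pair_peak e f = pair_peak f e"
proof -
  assume e: "e \<in> E" and f: "f \<in> E"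
  have "\<delta> v w = \<delta> w v" if "v \<in> V" "w \<in> V" for v w
    using that dist_sym V_subset by blast
  note this[OF start_in_V[OF e] start_in_V[OF f]] this[OF start_in_V[OF e] end_in_V[OF f]]
    this[OF end_in_V[OF e] start_in_V[OF f]] this[OF end_in_V[OF e] end_in_V[OF f]]
  moreover have "(x + y + min (A + B) (C + D)) / 2 = (y + x + min (A' + B') (D' + C')) / 2"
    if "A = A'" "B = B'" "C = C'" "D = D'" for x y A B C D A' B' C' D' :: real
    using that by (simp add: add.commute)
  ultimately show ?thesis unfolding pair_peak_def by blast
qed

text \<open>With \<open>n\<close> vertices and \<open>m\<close> edges there are at most \<open>n(n - 1)/2\<close> distances between vertices, \<open>(n - 1)m\<close>
peaks (the two ends of an edge see the same peak on it) and \<open>m(m - 1)/2\<close> pair peaks. If \<open>n \<le> m\<close>, this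
adds up to at most \<open>2m(m - 1)\<close>. Otherwise the graph is a tree, and the peaks are distances between
vertices; then the sum is at most \<open>m\<^sup>2\<close>.\<close>

lemma card_critical:
  assumes "2 \<le> card E"
  shows "finite critical" "card critical \<le> 2 * card E * (card E - 1)"
proof -
  define C1 where "C1 = {\<delta> v w |v w. v \<in> V \<and> w \<in> V \<and> v \<noteq> w}"
  define C2 where "C2 = {peak v e |v e. v \<in> V \<and> e \<in> E}"
  define C3 where "C3 = {pair_peak e f |e f. e \<in> E \<and> f \<in> E \<and> e \<noteq> f}"
  let ?n = "card V" and ?m = "card E"
  have 1: "finite C1" "2 * card C1 \<le> ?n * (?n - 1)"
  proof -
    have "\<delta> v w = \<delta> w v" if "v \<in> V" "w \<in> V" for v w
      using that dist_sym V_subset by blast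
    note card_symmetric_values[of V \<delta>, OF finite_V this]
    then show "finite C1" "2 * card C1 \<le> ?n * (?n - 1)" unfolding C1_def by blast+
  qed
  have 3: "finite C3" "2 * card C3 \<le> ?m * (?m - 1)"
  proof -
    note card_symmetric_values[of E pair_peak, OF finite_E pair_peak_sym]
    then show "finite C3" "2 * card C3 \<le> ?m * (?m - 1)" unfolding C3_def by blast+
  qed
  define P where "P = V \<times> E - (\<lambda>e. (\<psi> e 0, e)) ` E"
  have C2: "C2 \<subseteq> (\<lambda>(v, e). peak v e) ` P"
  proof
    fix c assume "c \<in> C2"
    then obtain v e where c: "c = peak v e" "v \<in> V" "e \<in> E" by (auto simp: C2_def)
    show "c \<in> (\<lambda>(v, e). peak v e) ` P"
    proof (cases "v = \<psi> e 0")
      case True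
      have "\<psi> e 0 \<in> topspace X" "\<psi> e (a e) \<in> topspace X"
        using c start_in_V end_in_V V_subset by auto
      then have "c = peak (\<psi> e (a e)) e"
        unfolding c(1) True peak_def using dist_sym[of "\<psi> e 0" "\<psi> e (a e)"] by (simp add: dist_self)
      moreover have "(\<psi> e (a e), e) \<in> P"
        using c(3) end_in_V[OF c(3)] no_loop[OF c(3)] by (simp add: P_def image_iff)
      ultimately show ?thesis by (intro image_eqI[of _ _ "(\<psi> e (a e), e)"]) simp_all
    next
      case False
      then have "(v, e) \<in> P" using c by (auto simp: P_def)
      then show ?thesis using c by (intro image_eqI[of _ _ "(v, e)"]) simp_all
    qed
  qed
  have finP: "finite P" using finite_V finite_E by (simp add: P_def)
  have "card P = ?n * ?m - ?m"
  proof -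
    have "card ((\<lambda>e. (\<psi> e 0, e)) ` E) = ?m" by (intro card_image inj_onI) auto
    moreover have "(\<lambda>e. (\<psi> e 0, e)) ` E \<subseteq> V \<times> E" using start_in_V by auto
    ultimately show ?thesis using finite_E by (simp add: P_def card_Diff_subset card_cartesian_product)
  qed
  moreover have "card C2 \<le> card P" by (rule surj_card_le[OF finP C2])
  ultimately have 2: "card C2 \<le> (?n - 1) * ?m" by (simp add: diff_mult_distrib)
  have fin2: "finite C2" by (rule finite_subset[OF C2 finite_imageI[OF finP]])
  have crit: "critical = C1 \<union> C2 \<union> C3" by (simp add: critical_def C1_def C2_def C3_def)
  show "finite critical" using 1 fin2 3 crit by simp
  show "card critical \<le> 2 * ?m * (?m - 1)"
  proof (cases "?n \<le> ?m")
    case True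
    have "?n * (?n - 1) \<le> ?m * (?m - 1)" by (rule mult_le_mono[OF True diff_le_mono[OF True]])
    moreover have "(?n - 1) * ?m \<le> (?m - 1) * ?m" by (rule mult_le_mono1[OF diff_le_mono[OF True]])
    moreover have "card critical \<le> card C1 + card C2 + card C3"
      unfolding crit using card_Un_le[of "C1 \<union> C2" C3] card_Un_le[of C1 C2] by linarith
    ultimately have "2 * card critical \<le> ?m * (?m - 1) + 2 * ((?m - 1) * ?m) + ?m * (?m - 1)"
      using 1 2 3 by linarith
    then show ?thesis by (simp add: algebra_simps)
  next
    case False
    then have n: "?n = ?m + 1" using card_V_le by simp
    have "C2 \<subseteq> C1"
    proof
      fix c assume "c \<in> C2"
      then obtain v e where c: "c = peak v e" "v \<in> V" "e \<in> E" by (auto simp: C2_def)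
      obtain w where "w \<in> V" "w \<noteq> v" "peak v e = \<delta> v w" using tree_midpoint[OF n c(2,3)] by blast
      with c show "c \<in> C1" unfolding C1_def by blast
    qed
    then have "critical = C1 \<union> C3" using crit by blast
    then have "card critical \<le> card C1 + card C3" by (simp add: card_Un_le)
    then have "2 * card critical \<le> (?m + 1) * ?m + ?m * (?m - 1)" using 1 3 n by simp
    also have "\<dots> = 2 * (?m * ?m)" by (cases ?m) auto
    also have "\<dots> \<le> 2 * (?m * (2 * (?m - 1)))" using assms by (intro mult_le_mono) auto
    finally show ?thesis by (simp add: algebra_simps)
  qed
qed

end

section \<open>The level sets between two critical values\<close>

lemma between_convex_comb:
  fixes l h u :: real
  assumes "u \<in> {0..1}" "l \<le> h"
  shows "l \<le> (1 - u) * l + u * h" "(1 - u) * l + u * h \<le> h"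
proof -
  have "0 \<le> u * (h - l)" "0 \<le> (1 - u) * (h - l)" using assms by auto
  then show "l \<le> (1 - u) * l + u * h" "(1 - u) * l + u * h \<le> h" by (simp_all add: algebra_simps)
qed

lemma convex_comb_ex:
  fixes l h x :: real
  assumes "l \<le> x" "x \<le> h"
  shows "\<exists>u\<in>{0..1}. x = (1 - u) * l + u * h"
proof (cases "l = h")
  case True
  then show ?thesis using assms by (intro bexI[of _ 0]) auto
next
  case False
  then have lh: "l < h" using assms by simp
  define u where "u = (x - l) / (h - l)"
  have "u * (h - l) = x - l" using lh by (simp add: u_def)
  then have "x = (1 - u) * l + u * h" by (simp add: algebra_simps)
  moreover have "u \<in> {0..1}" using lh assms by (simp add: u_def)
  ultimately show ?thesis by blast
qed

text \<open>An affine function that attains an extreme value of its range at an interior point is constant.\<close>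

lemma slope_zero_if_range_attained:
  fixes \<alpha> :: real
  assumes "h \<in> {lo<..<hi}" and range: "\<And>h'. h' \<in> {lo<..<hi} \<Longrightarrow> x + \<alpha> * (h' - h) \<in> {0..A}"
    and "x = 0 \<or> x = A"
  shows "\<alpha> = 0"
proof -
  have "x + \<alpha> * ((h + hi) / 2 - h) \<in> {0..A}" "x + \<alpha> * ((h + lo) / 2 - h) \<in> {0..A}"
    using assms(1) by (intro range; simp)+
  then have 1: "x + \<alpha> * ((hi - h) / 2) \<in> {0..A}" and 2: "x - \<alpha> * ((h - lo) / 2) \<in> {0..A}"
    by (simp_all add: field_simps)
  have pos: "0 < (hi - h) / 2" "0 < (h - lo) / 2" using assms(1) by auto
  show ?thesis
    using assms(3)
  proof
    assume "x = 0"
    with 1 2 pos show ?thesis by (auto simp: zero_le_mult_iff mult_le_0_iff)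
  next
    assume "x = A"
    with 1 2 pos show ?thesis by (auto simp: zero_le_mult_iff mult_le_0_iff)
  qed
qed

text \<open>The graph of an affine function that lies above the identity and touches it at an interior point is
the identity. The absolute value is harmless near a positive value.\<close>

lemma slope_one_if_majorant:
  fixes m :: real
  assumes h: "h \<in> {lo<..<hi}" and "0 \<le> lo"
    and le: "\<And>h'. h' \<in> {lo<..<hi} \<Longrightarrow> h' \<le> \<bar>h + m * (h' - h)\<bar>"
  shows "m = 1"
proof -
  define \<epsilon> where "\<epsilon> = min (min ((hi - h) / 2) ((h - lo) / 2)) (h / (\<bar>m\<bar> + 1))"
  have \<epsilon>: "0 < \<epsilon>" using assms by (auto simp: \<epsilon>_def)
  have "\<bar>m\<bar> * \<epsilon> \<le> (\<bar>m\<bar> + 1) * (h / (\<bar>m\<bar> + 1))"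
    using \<epsilon> by (intro mult_mono) (auto simp: \<epsilon>_def)
  also have "\<dots> = h" by (simp add: add_nonneg_eq_0_iff)
  finally have "\<bar>m * \<epsilon>\<bar> \<le> h" using \<epsilon> by (simp add: abs_mult)
  moreover have "h + \<epsilon> \<le> \<bar>h + m * \<epsilon>\<bar>"
  proof -
    have "\<epsilon> \<le> (hi - h) / 2" unfolding \<epsilon>_def by linarith
    then have "h + \<epsilon> \<in> {lo<..<hi}" using h \<epsilon> by auto
    from le[OF this] show ?thesis by simp
  qed
  moreover have "h - \<epsilon> \<le> \<bar>h - m * \<epsilon>\<bar>"
  proof -
    have "\<epsilon> \<le> (h - lo) / 2" unfolding \<epsilon>_def by linarith
    then have "h - \<epsilon> \<in> {lo<..<hi}" using h \<epsilon> by auto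
    from le[OF this] show ?thesis by simp
  qed
  ultimately have "\<epsilon> = m * \<epsilon>" by linarith
  then show ?thesis using \<epsilon> by simp
qed

context length_graph
begin

lemma dist_src_le:
  assumes "e \<in> E" "v \<in> V"
  shows "\<delta> v (src e b) \<le> \<delta> v (src e (\<not> b)) + a e"
  using dist_vertex_pt[OF assms, of 0 b] a_pos[OF assms(1)] by (simp add: min_def split: if_splits)

text \<open>The maximum of \<open>\<delta>\<close> on the product of the closed edges \<open>e\<close> and \<open>f\<close>, including the case \<open>e = f\<close>.\<close>

definition threshold :: "'e \<Rightarrow> 'e \<Rightarrow> real" where
  "threshold e f = (if e = f then peak (\<psi> e 0) e else pair_peak e f)"

text \<open>A strip \<open>(e, b, f, c, k)\<close> is a part of the rectangle \<open>e \<times> f\<close> on which \<open>\<delta> = x + y + offset\<close> in the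
coordinates of the two darts.

If \<open>k\<close> holds, the distance runs through the corner at which both darts start. The level \<open>h\<close> is then a
segment of the diagonal \<open>x + y = h - offset\<close>. Its lower end \<open>xlo\<close> lies on the side \<open>x = 0\<close> as long as
\<open>h\<close> is below the peak of that side, and afterwards at the point where the neighbouring corner takes
over; symmetrically for \<open>xhi\<close> and the side \<open>y = 0\<close>.

If \<open>k\<close> does not hold, then \<open>f = e\<close> and the darts are opposite, so that the points have the coordinates
\<open>x\<close> and \<open>a e - y\<close> on the first dart. Their distance is \<open>x - (a e - y)\<close>, measured inside the edge.\<close>

definition offset :: "'e \<Rightarrow> bool \<Rightarrow> 'e \<Rightarrow> bool \<Rightarrow> bool \<Rightarrow> real" where
  "offset e b f c k = (if k then \<delta> (src e b) (src f c) else - a e)"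

definition xlo :: "'e \<Rightarrow> bool \<Rightarrow> 'e \<Rightarrow> bool \<Rightarrow> bool \<Rightarrow> real \<Rightarrow> real" where
  "xlo e b f c k h = (if k then max 0 (h - peak (src e b) f) else h)"

definition xhi :: "'e \<Rightarrow> bool \<Rightarrow> 'e \<Rightarrow> bool \<Rightarrow> bool \<Rightarrow> real \<Rightarrow> real" where
  "xhi e b f c k h = (if k then min h (peak (src f c) e) - \<delta> (src e b) (src f c) else a e)"

text \<open>The coordinates at level \<open>h\<close> of the line \<open>u\<close> of a strip; the segment is divided proportionally.\<close>

definition sx where "sx e b f c k u h = (1 - u) * xlo e b f c k h + u * xhi e b f c k h"

definition sy where "sy e b f c k u h = h - offset e b f c k - sx e b f c k u h"

definition strip :: "'e \<times> bool \<times> 'e \<times> bool \<times> bool \<Rightarrow> real \<Rightarrow> real \<Rightarrow> 'a \<times> 'a" where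
  "strip = (\<lambda>(e, b, f, c, k) u h. (pt e b (sx e b f c k u h), pt f c (sy e b f c k u h)))"

text \<open>The strips that are met by the levels between \<open>lo\<close> and \<open>hi\<close>. A corner is cut off only above its own
distance, and a rectangle is left above its maximum. A square \<open>e \<times> e\<close> has just two corners off the
diagonal.\<close>

definition strips :: "real \<Rightarrow> real \<Rightarrow> ('e \<times> bool \<times> 'e \<times> bool \<times> bool) set" where
  "strips lo hi = {(e, b, f, c, k). e \<in> E \<and> f \<in> E \<and> hi \<le> threshold e f \<and>
     (if k then (e \<noteq> f \<or> c = (\<not> b)) \<and> \<delta> (src e b) (src f c) \<le> lo else e = f \<and> c = (\<not> b))}"

lemma finite_strips: "finite (strips lo hi)"
proof (rule finite_subset)
  show "strips lo hi \<subseteq> E \<times> UNIV \<times> E \<times> UNIV \<times> UNIV" by (auto simp: strips_def)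
  show "finite (E \<times> (UNIV :: bool set) \<times> E \<times> (UNIV :: bool set) \<times> (UNIV :: bool set))"
    using finite_E by (intro finite_cartesian_product) simp_all
qed

lemma threshold_same:
  assumes "e \<in> E"
  shows "threshold e e = (a e + \<delta> (src e b) (src e (\<not> b))) / 2" "peak (src e b) e = threshold e e"
    "threshold e e \<le> a e"
proof -
  have X: "\<psi> e 0 \<in> topspace X" "\<psi> e (a e) \<in> topspace X"
    using start_in_V[OF assms] end_in_V[OF assms] V_subset by auto
  show "threshold e e = (a e + \<delta> (src e b) (src e (\<not> b))) / 2" "peak (src e b) e = threshold e e"
    using dist_sym[OF X] dist_self[OF X(1)] dist_self[OF X(2)] by (cases b; simp add: threshold_def peak_def pt_def)+
  show "threshold e e \<le> a e"
    using dist_self[OF X(1)] dist_le[OF assms, of 0 "a e"] a_pos[OF assms] by (simp add: threshold_def peak_def)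
qed

lemma threshold_src_le:
  assumes "e \<in> E" "f \<in> E" "e \<noteq> f \<or> c = (\<not> b)"
  shows "2 * threshold e f \<le> a e + a f + \<delta> (src e b) (src f (\<not> c)) + \<delta> (src e (\<not> b)) (src f c)"
proof (cases "e = f")
  case True
  then show ?thesis using assms threshold_same(3)[OF assms(1)] dist_self[OF src_in_X[OF assms(1)]] by simp
next
  case False
  then show ?thesis using pair_peak_src_le(2)[of e f b c] by (simp add: threshold_def)
qed

context
  fixes lo hi :: real
  assumes lo: "0 \<le> lo" and noncritical: "\<And>c. c \<in> critical \<Longrightarrow> c \<le> lo \<or> hi \<le> c"
begin

lemma noncritical_peak: "\<lbrakk>v \<in> V; e \<in> E\<rbrakk> \<Longrightarrow> peak v e \<le> lo \<or> hi \<le> peak v e"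
  by (rule noncritical) (auto simp: critical_def)

lemma noncritical_threshold: "\<lbrakk>e \<in> E; f \<in> E\<rbrakk> \<Longrightarrow> threshold e f \<le> lo \<or> hi \<le> threshold e f"
  using noncritical_peak[OF start_in_V[of e], of e] noncritical[of "pair_peak e f"]
  by (auto simp: threshold_def critical_def)

lemma noncritical_dist:
  assumes "v \<in> V" "w \<in> V"
  shows "\<delta> v w \<le> lo \<or> hi \<le> \<delta> v w"
proof (cases "v = w")
  case True
  then show ?thesis using dist_self[of v] lo V_subset assms by auto
next
  case False
  then have "\<delta> v w \<in> critical" using assms unfolding critical_def by blast
  then show ?thesis by (rule noncritical)
qed

lemma strip_bounds:
  assumes i: "(e, b, f, c, k) \<in> strips lo hi" and h: "h \<in> {lo<..<hi}"
  shows "0 \<le> xlo e b f c k h" "xlo e b f c k h \<le> xhi e b f c k h" "xhi e b f c k h \<le> a e"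
    "xhi e b f c k h \<le> h - offset e b f c k" "h - offset e b f c k - a f \<le> xlo e b f c k h"
proof -
  have e: "e \<in> E" and f: "f \<in> E" and thr: "hi \<le> threshold e f" using i by (auto simp: strips_def)
  have "0 \<le> xlo e b f c k h \<and> xlo e b f c k h \<le> xhi e b f c k h \<and> xhi e b f c k h \<le> a e \<and>
    xhi e b f c k h \<le> h - offset e b f c k \<and> h - offset e b f c k - a f \<le> xlo e b f c k h"
  proof (cases k)
    case True
    have or: "e \<noteq> f \<or> c = (\<not> b)" and d: "\<delta> (src e b) (src f c) \<le> lo" using i True by (auto simp: strips_def)
    note src_in_V[OF e, of b] src_in_V[OF f, of c] src_in_X[OF e, of b] src_in_X[OF f, of c] src_in_X[OF e, of "\<not> b"]
    note V = this
    have mu: "peak (src f c) e = (\<delta> (src e b) (src f c) + \<delta> (src e (\<not> b)) (src f c) + a e) / 2"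
      using peak_src[of "src f c" e b] dist_sym[OF V(4,3)] dist_sym[OF V(4,5)] by simp
    have "\<delta> (src e (\<not> b)) (src f c) \<le> \<delta> (src e b) (src f c) + a e"
      "\<delta> (src e b) (src f c) \<le> \<delta> (src e (\<not> b)) (src f c) + a e"
      using dist_src_le[OF e V(2), of b] dist_src_le[OF e V(2), of "\<not> b"] dist_sym[OF V(4,3)] dist_sym[OF V(4,5)] by auto
    moreover have "\<delta> (src e b) (src f (\<not> c)) \<le> \<delta> (src e b) (src f c) + a f"
      "\<delta> (src e b) (src f c) \<le> \<delta> (src e b) (src f (\<not> c)) + a f"
      using dist_src_le[OF f V(1), of c] dist_src_le[OF f V(1), of "\<not> c"] by auto
    moreover have "2 * h \<le> a e + a f + \<delta> (src e b) (src f (\<not> c)) + \<delta> (src e (\<not> b)) (src f c)"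
      using threshold_src_le[OF e f or] thr h by simp
    ultimately show ?thesis
      using True d h by (auto simp: xlo_def xhi_def offset_def mu peak_src[of "src e b" f c] max_def min_def field_simps)
  next
    case False
    then have "e = f" using i by (auto simp: strips_def)
    then show ?thesis using False h lo thr threshold_same(3)[OF e] by (auto simp: xlo_def xhi_def offset_def)
  qed
  then show "0 \<le> xlo e b f c k h" "xlo e b f c k h \<le> xhi e b f c k h" "xhi e b f c k h \<le> a e"
    "xhi e b f c k h \<le> h - offset e b f c k" "h - offset e b f c k - a f \<le> xlo e b f c k h" by blast+
qed

lemma strip_range:
  assumes i: "(e, b, f, c, k) \<in> strips lo hi" and h: "h \<in> {lo<..<hi}" and u: "u \<in> {0..1}"
  shows "xlo e b f c k h \<le> sx e b f c k u h" "sx e b f c k u h \<le> xhi e b f c k h"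
    "sx e b f c k u h \<in> {0..a e}" "sy e b f c k u h \<in> {0..a f}"
proof -
  show 1: "xlo e b f c k h \<le> sx e b f c k u h" "sx e b f c k u h \<le> xhi e b f c k h"
    using between_convex_comb[OF u strip_bounds(2)[OF i h]] by (simp_all add: sx_def)
  show "sx e b f c k u h \<in> {0..a e}" "sy e b f c k u h \<in> {0..a f}"
    using 1 strip_bounds[OF i h] by (auto simp: sy_def)
qed

lemma strip_level:
  assumes i: "(e, b, f, c, k) \<in> strips lo hi" and h: "h \<in> {lo<..<hi}" and u: "u \<in> {0..1}"
  shows "\<delta> (pt e b (sx e b f c k u h)) (pt f c (sy e b f c k u h)) = h"
proof -
  define x y where "x = sx e b f c k u h" and "y = sy e b f c k u h"
  have e: "e \<in> E" and f: "f \<in> E" and thr: "hi \<le> threshold e f" using i by (auto simp: strips_def)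
  have xy: "x \<in> {0..a e}" "y \<in> {0..a f}" "xlo e b f c k h \<le> x" "x \<le> xhi e b f c k h"
    using strip_range[OF i h u] by (auto simp: x_def y_def)
  have sum: "x + y = h - offset e b f c k" by (simp add: x_def y_def sy_def)
  have "\<delta> (pt e b x) (pt f c y) = h"
  proof (cases "e = f")
    case True
    then have c: "c = (\<not> b)" using i by (auto simp: strips_def split: if_splits)
    have y': "a e - y \<in> {0..a e}" using xy True by auto
    have "pt f c y = pt e b (a e - y)" using True c pt_reverse[of e b y] by simp
    then have D: "\<delta> (pt e b x) (pt f c y) = min \<bar>x - (a e - y)\<bar> (min (x + \<delta> (src e b) (src e (\<not> b)) + y) ((a e - y) + \<delta> (src e b) (src e (\<not> b)) + a e - x))"
      using dist_pt_same[OF e xy(1) y', of b] by simp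
    have thr': "2 * h < a e + \<delta> (src e b) (src e (\<not> b))" using thr h threshold_same(1)[OF e, of b] True by simp
    have "0 \<le> \<delta> (src e b) (src e (\<not> b))" using src_in_X[OF e] by (intro dist_nonneg)
    show ?thesis
    proof (cases k)
      case k: True
      then have "x + y = h - \<delta> (src e b) (src e (\<not> b))" using sum True c by (simp add: offset_def)
      then show ?thesis unfolding D using thr' xy True \<open>0 \<le> \<delta> (src e b) (src e (\<not> b))\<close>
        by (simp add: min_def abs_if)
    next
      case k: False
      then have "x + y = h + a e" using sum True c by (simp add: offset_def)
      then show ?thesis unfolding D using thr' h lo xy True by (simp add: min_def abs_if)
    qed
  next
    case False
    then have k: "k" using i by (auto simp: strips_def split: if_splits)
    note src_in_X[OF e, of b] src_in_X[OF f, of c] src_in_X[OF e, of "\<not> b"]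
    note X = this
    have mu: "peak (src f c) e = (\<delta> (src e b) (src f c) + \<delta> (src e (\<not> b)) (src f c) + a e) / 2"
      using peak_src[of "src f c" e b] dist_sym[OF X(2,1)] dist_sym[OF X(2,3)] by simp
    have "2 * h \<le> a e + a f + \<delta> (src e b) (src f c) + \<delta> (src e (\<not> b)) (src f (\<not> c))"
      using pair_peak_src_le(1)[of e f b c] thr h False by (simp add: threshold_def)
    moreover have "h - peak (src e b) f \<le> x" "x \<le> peak (src f c) e - \<delta> (src e b) (src f c)"
      using xy k by (auto simp: xlo_def xhi_def)
    moreover have "x + y = h - \<delta> (src e b) (src f c)" using sum k by (simp add: offset_def)
    ultimately show ?thesis
      unfolding dist_pt_pt[OF e f False xy(1,2)] using mu peak_src[of "src e b" f c] 
      by (simp add: min_def field_simps)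
  qed
  then show ?thesis by (simp add: x_def y_def)
qed

text \<open>The affine function that equals \<open>\<delta>\<close> on the strip is an upper bound on the whole rectangle, up to sign.
This determines the velocity of lines of other strips that pass through a point of this one.\<close>

lemma strip_majorant:
  assumes i: "(e, b, f, c, k) \<in> strips lo hi" and xy: "x \<in> {0..a e}" "y \<in> {0..a f}"
  shows "\<delta> (pt e b x) (pt f c y) \<le> \<bar>offset e b f c k + x + y\<bar>"
proof -
  have e: "e \<in> E" and f: "f \<in> E" using i by (auto simp: strips_def)
  show ?thesis
  proof (cases k)
    case True
    then show ?thesis using dist_pt_le[OF e f xy, of b c] by (simp add: offset_def)
  next
    case False
    then have "f = e" "c = (\<not> b)" using i by (auto simp: strips_def)
    then show ?thesis
      using dist_pt_same[OF e xy(1), of "a e - y" b] xy(2) False pt_reverse[of e b y]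
      by (simp add: offset_def min_def abs_if split: if_splits)
  qed
qed

text \<open>No critical value lies between \<open>lo\<close> and \<open>hi\<close>, so the maximum in \<open>xlo\<close> and the minimum in \<open>xhi\<close> are
attained by the same argument at all levels.\<close>

lemma strip_affine:
  assumes i: "(e, b, f, c, k) \<in> strips lo hi"
  shows "\<exists>m. \<forall>h\<in>{lo<..<hi}. \<forall>h'\<in>{lo<..<hi}. sx e b f c k u h' = sx e b f c k u h + m * (h' - h)"
proof -
  have e: "e \<in> E" and f: "f \<in> E" using i by (auto simp: strips_def)
  have "\<exists>m. \<forall>h\<in>{lo<..<hi}. \<forall>h'\<in>{lo<..<hi}. xlo e b f c k h' = xlo e b f c k h + m * (h' - h)"
  proof (cases k)
    case True
    show ?thesis
      using noncritical_peak[OF src_in_V[OF e, of b] f]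
    proof
      assume "peak (src e b) f \<le> lo"
      then show ?thesis using True by (intro exI[of _ 1]) (auto simp: xlo_def)
    next
      assume "hi \<le> peak (src e b) f"
      then show ?thesis using True by (intro exI[of _ 0]) (auto simp: xlo_def)
    qed
  next
    case False
    then show ?thesis by (intro exI[of _ 1]) (simp add: xlo_def)
  qed
  then obtain m where m: "\<And>h h'. \<lbrakk>h \<in> {lo<..<hi}; h' \<in> {lo<..<hi}\<rbrakk> \<Longrightarrow> xlo e b f c k h' = xlo e b f c k h + m * (h' - h)" by blast
  have "\<exists>m. \<forall>h\<in>{lo<..<hi}. \<forall>h'\<in>{lo<..<hi}. xhi e b f c k h' = xhi e b f c k h + m * (h' - h)"
  proof (cases k)
    case True
    show ?thesis
      using noncritical_peak[OF src_in_V[OF f, of c] e]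
    proof
      assume "peak (src f c) e \<le> lo"
      then show ?thesis using True by (intro exI[of _ 0]) (auto simp: xhi_def)
    next
      assume "hi \<le> peak (src f c) e"
      then show ?thesis using True by (intro exI[of _ 1]) (auto simp: xhi_def)
    qed
  next
    case False
    then show ?thesis by (intro exI[of _ 0]) (simp add: xhi_def)
  qed
  then obtain n where n: "\<And>h h'. \<lbrakk>h \<in> {lo<..<hi}; h' \<in> {lo<..<hi}\<rbrakk> \<Longrightarrow> xhi e b f c k h' = xhi e b f c k h + n * (h' - h)" by blast
  show ?thesis
  proof (intro exI[of _ "(1 - u) * m + u * n"] ballI)
    fix h h' assume *: "h \<in> {lo<..<hi}" "h' \<in> {lo<..<hi}"
    show "sx e b f c k u h' = sx e b f c k u h + ((1 - u) * m + u * n) * (h' - h)"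
      unfolding sx_def m[OF *] n[OF *] by (simp add: algebra_simps)
  qed
qed

text \<open>Two lines of one strip meet only where its width vanishes. The width is affine in the level and
non-negative, so it then vanishes at all levels.\<close>

lemma strip_lines_meet:
  assumes i: "(e, b, f, c, k) \<in> strips lo hi" and h: "h \<in> {lo<..<hi}" and h': "h' \<in> {lo<..<hi}"
    and uv: "u \<in> {0..1}" "v \<in> {0..1}" and eq: "sx e b f c k u h = sx e b f c k v h"
  shows "sx e b f c k u h' = sx e b f c k v h'"
proof (cases "u = v")
  case False
  let ?w = "\<lambda>h. sx e b f c k 1 h - sx e b f c k 0 h"
  have w: "?w h = xhi e b f c k h - xlo e b f c k h" for h by (simp add: sx_def)
  have diff: "sx e b f c k u h - sx e b f c k v h = (u - v) * ?w h" for h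
    by (simp add: sx_def algebra_simps)
  obtain m n where mn: "\<forall>h\<in>{lo<..<hi}. \<forall>h'\<in>{lo<..<hi}. sx e b f c k 1 h' = sx e b f c k 1 h + m * (h' - h)"
    "\<forall>h\<in>{lo<..<hi}. \<forall>h'\<in>{lo<..<hi}. sx e b f c k 0 h' = sx e b f c k 0 h + n * (h' - h)"
    using strip_affine[OF i, of 1] strip_affine[OF i, of 0] by blast
  have aff: "?w h' = ?w h + (m - n) * (h' - h)" if "h' \<in> {lo<..<hi}" for h'
    using mn(1)[rule_format, OF h that] mn(2)[rule_format, OF h that] by (simp add: algebra_simps)
  have "(u - v) * ?w h = 0" using diff[of h] eq by simp
  then have w0: "?w h = 0" using False by simp
  have "m - n = 0"
  proof (rule slope_zero_if_range_attained[OF h, of "?w h" _ "a e"])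
    fix h' assume h': "h' \<in> {lo<..<hi}"
    show "?w h + (m - n) * (h' - h) \<in> {0..a e}"
      unfolding aff[OF h', symmetric] using strip_bounds[OF i h'] w[of h'] by auto
  qed (use w0 in simp)
  then have "?w h' = 0" using aff[OF h'] w0 by simp
  then show ?thesis using diff[of h'] by simp
qed simp

text \<open>A line through the point with the coordinates \<open>x\<close> and \<open>y\<close> at level \<open>h\<close>, with velocity \<open>(\<alpha>, \<beta>)\<close>, on which
\<open>\<delta>\<close> is the level, together with an affine function of gradient \<open>(s, t)\<close> that bounds \<open>\<delta>\<close> and is attained
there.\<close>

definition level_line where
  "level_line h e f x \<alpha> y \<beta> s t k \<longleftrightarrow> e \<in> E \<and> f \<in> E \<and>
     (\<forall>h'\<in>{lo<..<hi}. x + \<alpha> * (h' - h) \<in> {0..a e} \<and> y + \<beta> * (h' - h) \<in> {0..a f} \<and>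
        \<delta> (\<psi> e (x + \<alpha> * (h' - h))) (\<psi> f (y + \<beta> * (h' - h))) = h') \<and>
     (\<forall>x\<in>{0..a e}. \<forall>y\<in>{0..a f}. \<delta> (\<psi> e x) (\<psi> f y) \<le> \<bar>s * x + t * y + k\<bar>) \<and>
     s * x + t * y + k = h \<and> s * \<alpha> + t * \<beta> = 1 \<and> (s = 1 \<or> s = - 1) \<and> (t = 1 \<or> t = (- 1 :: real))"

lemma level_lineD:
  assumes "level_line h e f x \<alpha> y \<beta> s t k"
  shows "e \<in> E" "f \<in> E"
    "\<And>h'. h' \<in> {lo<..<hi} \<Longrightarrow> x + \<alpha> * (h' - h) \<in> {0..a e}"
    "\<And>h'. h' \<in> {lo<..<hi} \<Longrightarrow> y + \<beta> * (h' - h) \<in> {0..a f}"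
    "\<And>h'. h' \<in> {lo<..<hi} \<Longrightarrow> \<delta> (\<psi> e (x + \<alpha> * (h' - h))) (\<psi> f (y + \<beta> * (h' - h))) = h'"
    "\<And>x y. \<lbrakk>x \<in> {0..a e}; y \<in> {0..a f}\<rbrakk> \<Longrightarrow> \<delta> (\<psi> e x) (\<psi> f y) \<le> \<bar>s * x + t * y + k\<bar>"
    "s * x + t * y + k = h" "s * \<alpha> + t * \<beta> = 1" "s = 1 \<or> s = - 1" "t = 1 \<or> t = - 1"
  using assms unfolding level_line_def by blast+

lemma vertex_coordinate: "\<lbrakk>e \<in> E; z \<in> {0..a e}; \<psi> e z \<in> V\<rbrakk> \<Longrightarrow> z = 0 \<or> z = a e"
  using inner[of e z] by (auto simp: less_le)

lemma inner_coordinate: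
  assumes "e \<in> E" "z \<in> {0..a e}" "\<psi> e z \<notin> V"
  shows "0 < z" "z < a e"
proof -
  have "z \<noteq> 0" "z \<noteq> a e" using assms(3) start_in_V[OF assms(1)] end_in_V[OF assms(1)] by auto
  then show "0 < z" "z < a e" using assms(2) by auto
qed

text \<open>Two lines through the same point move alike. By the bounds of both lines, the velocity of each has
inner product one with both gradients. If the point lies in the interior of a rectangle and the
gradients differ, then this determines the velocity; opposite gradients are impossible. If one of
the two points of the pair is a vertex, its coordinate cannot move, since it is at an end of its range,
and the sign of the other velocity is determined in the same way. The pair does not consist of two
vertices, because its distance is not critical.\<close>

lemma level_lines_agree:
  assumes h: "h \<in> {lo<..<hi}"
    and 1: "level_line h e f x \<alpha> y \<beta> s t k" and 2: "level_line h e' f' x' \<alpha>' y' \<beta>' s' t' k'"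
    and meet: "\<psi> e x = \<psi> e' x'" "\<psi> f y = \<psi> f' y'"
    and same: "\<lbrakk>e = e'; f = f'; x = x'; y = y'; s = s'; t = t'\<rbrakk> \<Longrightarrow> \<alpha> = \<alpha>'"
  shows "\<psi> e (x + \<alpha> * (h' - h)) = \<psi> e' (x' + \<alpha>' * (h' - h)) \<and>
         \<psi> f (y + \<beta> * (h' - h)) = \<psi> f' (y' + \<beta>' * (h' - h))"
proof -
  note l1 = level_lineD[OF 1] and l2 = level_lineD[OF 2]
  note E = l1(1,2) l2(1,2)
  have range: "x \<in> {0..a e}" "y \<in> {0..a f}" "x' \<in> {0..a e'}" "y' \<in> {0..a f'}" "\<delta> (\<psi> e x) (\<psi> f y) = h"
    using l1(3-5)[OF h] l2(3,4)[OF h] by simp_all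
  note slopes = l1(8) l2(8)
  note signs = l1(9,10) l2(9,10)
  consider "\<psi> e x \<in> V" "\<psi> f y \<in> V" | "\<psi> e x \<in> V" "\<psi> f y \<notin> V" | "\<psi> e x \<notin> V" "\<psi> f y \<in> V"
    | "\<psi> e x \<notin> V" "\<psi> f y \<notin> V" by blast
  then show ?thesis
  proof cases
    case 1
    then show ?thesis using noncritical_dist[OF 1] range(5) h by auto
  next
    case 2
    have \<alpha>: "\<alpha> = 0"
      by (rule slope_zero_if_range_attained[OF h l1(3) vertex_coordinate[OF E(1) range(1) 2(1)]])
    have \<alpha>': "\<alpha>' = 0"
      by (rule slope_zero_if_range_attained[OF h l2(3) vertex_coordinate[OF E(3) range(3) 2(1)[unfolded meet(1)]]])
    have ff: "f = f'" "y = y'"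
      using inj[OF E(2,4) inner_coordinate[OF E(2) range(2) 2(2)] range(4) meet(2)] by auto
    have "t' * \<beta> = 1"
    proof (rule slope_one_if_majorant[OF h lo])
      fix h' assume h': "h' \<in> {lo<..<hi}"
      have "h' = \<delta> (\<psi> e' x') (\<psi> f' (y + \<beta> * (h' - h)))"
        using l1(5)[OF h'] \<alpha> meet(1) ff by simp
      also have "\<dots> \<le> \<bar>s' * x' + t' * (y + \<beta> * (h' - h)) + k'\<bar>"
        using l2(6)[OF range(3)] l1(4)[OF h'] ff by simp
      also have "s' * x' + t' * (y + \<beta> * (h' - h)) + k' = h + t' * \<beta> * (h' - h)"
        using l2(7) ff by (simp add: algebra_simps)
      finally show "h' \<le> \<bar>h + t' * \<beta> * (h' - h)\<bar>" .
    qed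
    then have "\<beta> = \<beta>'" using slopes \<alpha> \<alpha>' signs by auto
    then show ?thesis using \<alpha> \<alpha>' ff meet by simp
  next
    case 3
    have \<beta>: "\<beta> = 0"
      by (rule slope_zero_if_range_attained[OF h l1(4) vertex_coordinate[OF E(2) range(2) 3(2)]])
    have \<beta>': "\<beta>' = 0"
      by (rule slope_zero_if_range_attained[OF h l2(4) vertex_coordinate[OF E(4) range(4) 3(2)[unfolded meet(2)]]])
    have ee: "e = e'" "x = x'"
      using inj[OF E(1,3) inner_coordinate[OF E(1) range(1) 3(1)] range(3) meet(1)] by auto
    have "s' * \<alpha> = 1"
    proof (rule slope_one_if_majorant[OF h lo])
      fix h' assume h': "h' \<in> {lo<..<hi}"
      have "h' = \<delta> (\<psi> e' (x + \<alpha> * (h' - h))) (\<psi> f' y')"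
        using l1(5)[OF h'] \<beta> meet(2) ee by simp
      also have "\<dots> \<le> \<bar>s' * (x + \<alpha> * (h' - h)) + t' * y' + k'\<bar>"
        using l2(6)[OF _ range(4)] l1(3)[OF h'] ee by simp
      also have "s' * (x + \<alpha> * (h' - h)) + t' * y' + k' = h + s' * \<alpha> * (h' - h)"
        using l2(7) ee by (simp add: algebra_simps)
      finally show "h' \<le> \<bar>h + s' * \<alpha> * (h' - h)\<bar>" .
    qed
    then have "\<alpha> = \<alpha>'" using slopes \<beta> \<beta>' signs by auto
    then show ?thesis using \<beta> \<beta>' ee meet by simp
  next
    case 4
    have eq: "e = e'" "x = x'" "f = f'" "y = y'"
      using inj[OF E(1,3) inner_coordinate[OF E(1) range(1) 4(1)] range(3) meet(1)]
        inj[OF E(2,4) inner_coordinate[OF E(2) range(2) 4(2)] range(4) meet(2)] by auto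
    have "s' * \<alpha> + t' * \<beta> = 1"
    proof (rule slope_one_if_majorant[OF h lo])
      fix h' assume h': "h' \<in> {lo<..<hi}"
      have "h' = \<delta> (\<psi> e' (x + \<alpha> * (h' - h))) (\<psi> f' (y + \<beta> * (h' - h)))"
        using l1(5)[OF h'] eq by simp
      also have "\<dots> \<le> \<bar>s' * (x + \<alpha> * (h' - h)) + t' * (y + \<beta> * (h' - h)) + k'\<bar>"
        using l2(6) l1(3,4)[OF h'] eq by simp
      also have "s' * (x + \<alpha> * (h' - h)) + t' * (y + \<beta> * (h' - h)) + k' = h + (s' * \<alpha> + t' * \<beta>) * (h' - h)"
        using l2(7) eq by (simp add: algebra_simps)
      finally show "h' \<le> \<bar>h + (s' * \<alpha> + t' * \<beta>) * (h' - h)\<bar>" .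
    qed
    moreover have "s * \<alpha>' + t * \<beta>' = 1"
    proof (rule slope_one_if_majorant[OF h lo])
      fix h' assume h': "h' \<in> {lo<..<hi}"
      have "h' = \<delta> (\<psi> e (x + \<alpha>' * (h' - h))) (\<psi> f (y + \<beta>' * (h' - h)))"
        using l2(5)[OF h'] eq by simp
      also have "\<dots> \<le> \<bar>s * (x + \<alpha>' * (h' - h)) + t * (y + \<beta>' * (h' - h)) + k\<bar>"
        using l1(6) l2(3,4)[OF h'] eq by simp
      also have "s * (x + \<alpha>' * (h' - h)) + t * (y + \<beta>' * (h' - h)) + k = h + (s * \<alpha>' + t * \<beta>') * (h' - h)"
        using l1(7) by (simp add: algebra_simps)
      finally show "h' \<le> \<bar>h + (s * \<alpha>' + t * \<beta>') * (h' - h)\<bar>" .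
    qed
    ultimately have "\<alpha> = \<alpha>' \<and> \<beta> = \<beta>'"
    proof (cases "s = s' \<and> t = t'")
      case True
      then have "\<alpha> = \<alpha>'" using same eq by blast
      then show ?thesis using slopes True signs by auto
    next
      case False
      then show ?thesis using slopes signs \<open>s' * \<alpha> + t' * \<beta> = 1\<close> \<open>s * \<alpha>' + t * \<beta>' = 1\<close> by auto
    qed
    then show ?thesis using eq by simp
  qed
qed

text \<open>The change between the coordinate of a dart and that of its edge.\<close>

definition flip :: "'e \<Rightarrow> bool \<Rightarrow> real \<Rightarrow> real" where
  "flip e b z = (if b then a e - z else z)"

lemma flip_flip [simp]: "flip e b (flip e b z) = z"
  by (simp add: flip_def)

lemma strip_level_line:
  assumes i: "(e, b, f, c, k) \<in> strips lo hi" and h: "h \<in> {lo<..<hi}" and u: "u \<in> {0..1}"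
  obtains \<alpha> \<beta> where
    "level_line h e f (flip e b (sx e b f c k u h)) \<alpha> (flip f c (sy e b f c k u h)) \<beta>
       (if b then - 1 else 1) (if c then - 1 else 1)
       (offset e b f c k + (if b then a e else 0) + (if c then a f else 0))"
    "\<And>h'. h' \<in> {lo<..<hi} \<Longrightarrow> flip e b (sx e b f c k u h') = flip e b (sx e b f c k u h) + \<alpha> * (h' - h)"
    "\<And>h'. h' \<in> {lo<..<hi} \<Longrightarrow> flip f c (sy e b f c k u h') = flip f c (sy e b f c k u h) + \<beta> * (h' - h)"
proof -
  let ?x = "sx e b f c k u" and ?y = "sy e b f c k u"
  obtain m where m: "\<forall>h\<in>{lo<..<hi}. \<forall>h'\<in>{lo<..<hi}. ?x h' = ?x h + m * (h' - h)"
    using strip_affine[OF i] by blast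
  define \<alpha> \<beta> where "\<alpha> = (if b then - m else m)" and "\<beta> = (if c then m - 1 else 1 - m)"
  have X: "flip e b (?x h') = flip e b (?x h) + \<alpha> * (h' - h)" if "h' \<in> {lo<..<hi}" for h'
    using m[rule_format, OF h that] by (simp add: flip_def \<alpha>_def)
  have Y: "flip f c (?y h') = flip f c (?y h) + \<beta> * (h' - h)" if "h' \<in> {lo<..<hi}" for h'
    unfolding flip_def \<beta>_def sy_def m[rule_format, OF h that] by (simp add: algebra_simps)
  have e: "e \<in> E" and f: "f \<in> E" using i by (auto simp: strips_def)
  have pt: "pt g d z = \<psi> g (flip g d z)" for g d z by (simp add: pt_def flip_def)
  have "level_line h e f (flip e b (?x h)) \<alpha> (flip f c (?y h)) \<beta>
       (if b then - 1 else 1) (if c then - 1 else 1)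
       (offset e b f c k + (if b then a e else 0) + (if c then a f else 0))"
    unfolding level_line_def
  proof (intro conjI ballI)
    show "e \<in> E" "f \<in> E" by fact+
    show "flip e b (?x h) + \<alpha> * (h' - h) \<in> {0..a e}" if "h' \<in> {lo<..<hi}" for h'
      using strip_range(3)[OF i that u] unfolding X[OF that, symmetric] by (auto simp: flip_def)
    show "flip f c (?y h) + \<beta> * (h' - h) \<in> {0..a f}" if "h' \<in> {lo<..<hi}" for h'
      using strip_range(4)[OF i that u] unfolding Y[OF that, symmetric] by (auto simp: flip_def)
    show "\<delta> (\<psi> e (flip e b (?x h) + \<alpha> * (h' - h))) (\<psi> f (flip f c (?y h) + \<beta> * (h' - h))) = h'"
      if "h' \<in> {lo<..<hi}" for h'
      unfolding X[OF that, symmetric] Y[OF that, symmetric] pt[symmetric] by (rule strip_level[OF i that u])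
    fix x y assume xy: "x \<in> {0..a e}" "y \<in> {0..a f}"
    have "flip e b x \<in> {0..a e}" "flip f c y \<in> {0..a f}" using xy by (auto simp: flip_def)
    from strip_majorant[OF i this]
    have "\<delta> (\<psi> e x) (\<psi> f y) \<le> \<bar>offset e b f c k + flip e b x + flip f c y\<bar>"
      by (simp only: pt flip_flip)
    also have "offset e b f c k + flip e b x + flip f c y =
      (if b then - 1 else 1) * x + (if c then - 1 else 1) * y
        + (offset e b f c k + (if b then a e else 0) + (if c then a f else 0))"
      by (simp add: flip_def)
    finally show "\<delta> (\<psi> e x) (\<psi> f y) \<le> \<bar>(if b then - 1 else 1) * x + (if c then - 1 else 1) * y
        + (offset e b f c k + (if b then a e else 0) + (if c then a f else 0))\<bar>" .
  qed (auto simp: flip_def sy_def \<alpha>_def \<beta>_def)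
  then show thesis using X Y by (rule that)
qed

lemma strips_parallel:
  assumes i: "i \<in> strips lo hi" and j: "j \<in> strips lo hi" and uv: "u \<in> {0..1}" "v \<in> {0..1}"
    and h: "h \<in> {lo<..<hi}" and h': "h' \<in> {lo<..<hi}" and meet: "strip i u h = strip j v h"
  shows "strip i u h' = strip j v h'"
proof -
  obtain e b f c k where i': "i = (e, b, f, c, k)" by (cases i)
  obtain e' b' f' c' k' where j': "j = (e', b', f', c', k')" by (cases j)
  note i = i[unfolded i'] and j = j[unfolded j']
  let ?x = "\<lambda>h. flip e b (sx e b f c k u h)" and ?y = "\<lambda>h. flip f c (sy e b f c k u h)"
  let ?x' = "\<lambda>h. flip e' b' (sx e' b' f' c' k' v h)" and ?y' = "\<lambda>h. flip f' c' (sy e' b' f' c' k' v h)"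
  have si: "strip i u h = (\<psi> e (?x h), \<psi> f (?y h))" for h by (simp add: strip_def i' pt_def flip_def)
  have sj: "strip j v h = (\<psi> e' (?x' h), \<psi> f' (?y' h))" for h by (simp add: strip_def j' pt_def flip_def)
  obtain \<alpha> \<beta> where 1:
    "level_line h e f (?x h) \<alpha> (?y h) \<beta> (if b then - 1 else 1) (if c then - 1 else 1)
       (offset e b f c k + (if b then a e else 0) + (if c then a f else 0))"
    "\<And>h'. h' \<in> {lo<..<hi} \<Longrightarrow> ?x h' = ?x h + \<alpha> * (h' - h)"
    "\<And>h'. h' \<in> {lo<..<hi} \<Longrightarrow> ?y h' = ?y h + \<beta> * (h' - h)"
    by (rule strip_level_line[OF i h uv(1)]) (rule that)
  obtain \<alpha>' \<beta>' where 2: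
    "level_line h e' f' (?x' h) \<alpha>' (?y' h) \<beta>' (if b' then - 1 else 1) (if c' then - 1 else 1)
       (offset e' b' f' c' k' + (if b' then a e' else 0) + (if c' then a f' else 0))"
    "\<And>h'. h' \<in> {lo<..<hi} \<Longrightarrow> ?x' h' = ?x' h + \<alpha>' * (h' - h)"
    "\<And>h'. h' \<in> {lo<..<hi} \<Longrightarrow> ?y' h' = ?y' h + \<beta>' * (h' - h)"
    by (rule strip_level_line[OF j h uv(2)]) (rule that)
  have meets: "\<psi> e (?x h) = \<psi> e' (?x' h)" "\<psi> f (?y h) = \<psi> f' (?y' h)" using meet si sj by simp_all
  have same: "\<alpha> = \<alpha>'" if eq: "e = e'" "f = f'" "?x h = ?x' h" "?y h = ?y' h"
      "(if b then - 1 else 1) = (if b' then - 1 else (1::real))" "(if c then - 1 else 1) = (if c' then - 1 else (1::real))"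
  proof -
    have bc: "b' = b" "c' = c" using eq(5,6) by (auto split: if_splits)
    have sxy: "sx e b f c k u h = sx e b f c k' v h" "sy e b f c k u h = sy e b f c k' v h"
      using eq(1-4) bc by (auto simp: flip_def split: if_splits)
    then have off: "offset e b f c k = offset e b f c k'" by (simp add: sy_def)
    have "e \<in> E" "f \<in> E" using i by (auto simp: strips_def)
    then have "0 < a e" "0 \<le> \<delta> (src e b) (src f c)" using a_pos dist_nonneg src_in_X by blast+
    then have k: "k' = k" using off by (cases k; cases k') (auto simp: offset_def)
    define h1 where "h1 = (h + hi) / 2"
    have h1: "h1 \<in> {lo<..<hi}" "h1 - h \<noteq> 0" using h by (auto simp: h1_def)
    have "sx e b f c k u h1 = sx e b f c k v h1"
      by (rule strip_lines_meet[OF i h h1(1) uv sxy(1)[unfolded k]])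
    then have "?x h1 = ?x' h1" using eq(1,2) bc k by simp
    then show ?thesis using 1(2)[OF h1(1)] 2(2)[OF h1(1)] eq(3) h1(2) by simp
  qed
  have "\<psi> e (?x h') = \<psi> e' (?x' h') \<and> \<psi> f (?y h') = \<psi> f' (?y' h')"
    unfolding 1(2,3)[OF h'] 2(2,3)[OF h']
    by (rule level_lines_agree[OF h 1(1) 2(1) meets same])
  then show ?thesis using si sj by simp
qed

text \<open>The strip through a pair of points is found from the affine function at which the minimum for their
distance is attained.\<close>

lemma strips_cover:
  assumes p: "p \<in> topspace X" and q: "q \<in> topspace X" and J: "\<delta> p q \<in> {lo<..<hi}"
  shows "\<exists>i\<in>strips lo hi. \<exists>u\<in>{0..1}. (p, q) = strip i u (\<delta> p q)"
proof -
  define h where "h = \<delta> p q"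
  have h: "h \<in> {lo<..<hi}" using J by (simp add: h_def)
  obtain e x where e: "e \<in> E" "x \<in> {0..a e}" "p = \<psi> e x" using covered[OF p] by blast
  obtain f y where f: "f \<in> E" "y \<in> {0..a f}" "q = \<psi> f y" using covered[OF q] by blast
  have place: ?thesis
    if i: "(e, b, f, c, k) \<in> strips lo hi" and p: "p = pt e b x" and q: "q = pt f c y"
      and sum: "x + y = h - offset e b f c k" and x: "xlo e b f c k h \<le> x" "x \<le> xhi e b f c k h" for e b f c k x y
  proof -
    from convex_comb_ex[OF x] obtain u where u: "u \<in> {0..1}" "x = sx e b f c k u h"
      unfolding sx_def by (elim bexE)
    have y: "y = sy e b f c k u h" unfolding sy_def u(2)[symmetric] using sum by simp
    have "strip (e, b, f, c, k) u h = (p, q)"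
      unfolding strip_def prod.case p q u(2)[symmetric] y[symmetric] by (rule refl)
    then have "(p, q) = strip (e, b, f, c, k) u (\<delta> p q)" unfolding h_def by (rule sym)
    then show ?thesis using i u(1) by (intro bexI)
  qed
  show ?thesis
  proof (cases "e = f")
    case False
    define x' where "x' b = (if b then a e - x else x)" for b
    define y' where "y' c = (if c then a f - y else y)" for c
    have pq: "p = pt e b (x' b)" "q = pt f c (y' c)" for b c
      using e f by (simp_all add: x'_def y'_def pt_def)
    have range: "x' b \<in> {0..a e}" "y' c \<in> {0..a f}" for b c
      using e f by (auto simp: x'_def y'_def)
    have rev: "x' (\<not> b) = a e - x' b" "y' (\<not> c) = a f - y' c" for b c
      by (simp_all add: x'_def y'_def)
    have le: "h \<le> x' b + y' c + \<delta> (src e b) (src f c)" for b c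
      using dist_pt_le[OF e(1) f(1) range(1)[of b] range(2)[of c], of b c] pq(1)[of b] pq(2)[of c] by (simp add: h_def)
    have "h = \<delta> (pt e False (x' False)) (pt f False (y' False))" using pq(1)[of False] pq(2)[of False] by (simp add: h_def)
    also have "\<dots> = min (min (x' False + y' False + \<delta> (src e False) (src f False)) (x' False + y' True + \<delta> (src e False) (src f True)))
        (min (x' True + y' False + \<delta> (src e True) (src f False)) (x' True + y' True + \<delta> (src e True) (src f True)))"
      using dist_pt_pt[OF e(1) f(1) False range(1)[of False] range(2)[of False], of False False]
        rev(1)[of False] rev(2)[of False] by simp
    finally have "h = x' False + y' False + \<delta> (src e False) (src f False) \<or> h = x' False + y' True + \<delta> (src e False) (src f True)
      \<or> h = x' True + y' False + \<delta> (src e True) (src f False) \<or> h = x' True + y' True + \<delta> (src e True) (src f True)"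
      by linarith
    then have "\<exists>b c. h = x' b + y' c + \<delta> (src e b) (src f c)" by (elim disjE) (rule exI, rule exI, assumption)+
    then obtain b c where bc: "h = x' b + y' c + \<delta> (src e b) (src f c)" by (elim exE)
    note le' = le[of b "\<not> c"] le[of "\<not> b" c] le[of "\<not> b" "\<not> c"]
    \<comment> \<open>The bounds from the other three corners give the threshold and the position on the segment.\<close>
    have "h \<le> pair_peak e f"
      using bc le' unfolding rev by (intro pair_peak_ge[of h e f b c]) linarith+
    then have thr: "hi \<le> threshold e f"
      using noncritical_threshold[OF e(1) f(1)] h False by (auto simp: threshold_def)
    have "\<delta> (src e b) (src f c) \<le> h" using bc range(1)[of b] range(2)[of c] by simp
    then have "\<delta> (src e b) (src f c) \<le> lo"
      using noncritical_dist[OF src_in_V[OF e(1), of b] src_in_V[OF f(1), of c]] h by auto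
    then have i: "(e, b, f, c, True) \<in> strips lo hi" using e f False thr by (simp add: strips_def)
    note X = src_in_X[OF e(1), of b] src_in_X[OF f(1), of c] src_in_X[OF e(1), of "\<not> b"]
    have mu: "peak (src f c) e = (\<delta> (src e b) (src f c) + \<delta> (src e (\<not> b)) (src f c) + a e) / 2"
      using peak_src[of "src f c" e b] dist_sym[OF X(2,1)] dist_sym[OF X(2,3)] by simp
    show ?thesis
    proof (rule place[OF i pq(1) pq(2)])
      show "x' b + y' c = h - offset e b f c True" using bc by (simp add: offset_def)
      show "xlo e b f c True h \<le> x' b"
        using bc le' rev(1)[of b] rev(2)[of c] range(1)[of b] range(2)[of c] peak_src[of "src e b" f c] by (simp add: xlo_def field_simps)
      show "x' b \<le> xhi e b f c True h"
        using bc le' rev(1)[of b] rev(2)[of c] range(1)[of b] range(2)[of c] mu by (simp add: xhi_def field_simps)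
    qed
  next
    case True
    have main: ?thesis if y: "z \<in> {0..a e}" "w \<in> {0..a e}" "z \<le> w" and pq: "p = pt e b z" "q = pt e b w" for z w b
    proof -
      define D where "D = \<delta> (src e b) (src e (\<not> b))"
      have D0: "0 \<le> D" "D \<le> a e"
        using dist_nonneg[OF src_in_X[OF e(1)] src_in_X[OF e(1)]] threshold_same(1)[OF e(1), of b] threshold_same(3)[OF e(1)] by (simp_all add: D_def)
      have h_eq: "h = min (w - z) (z + D + a e - w)"
        using dist_pt_same[OF e(1) y(1,2), of b] pq y D0 by (simp add: h_def D_def min_def)
      then have "h \<le> threshold e e" using threshold_same(1)[OF e(1), of b] by (simp add: D_def min_def split: if_splits)
      then have thr: "hi \<le> threshold e e" using noncritical_threshold[OF e(1) e(1)] h by auto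
      then have h_thr: "h < threshold e e" using h by simp
      have q': "q = pt e (\<not> b) (a e - w)" using pq by (simp add: pt_def)
      show ?thesis
      proof (cases "h = w - z")
        case diag: True
        have p': "p = pt e (\<not> b) (a e - z)" using pq by (simp add: pt_def)
        have i: "(e, \<not> b, e, b, False) \<in> strips lo hi" using e thr by (simp add: strips_def)
        show ?thesis
          by (rule place[OF i p' pq(2)]) (use diag y in \<open>simp_all add: offset_def xlo_def xhi_def\<close>)
      next
        case False
        then have h': "h = z + D + a e - w" using h_eq by (simp add: min_def split: if_splits)
        have "D \<le> h" using h' y by simp
        then have "D \<le> lo"
          using noncritical_dist[OF src_in_V[OF e(1), of b] src_in_V[OF e(1), of "\<not> b"]] h by (auto simp: D_def)
        then have i: "(e, b, e, \<not> b, True) \<in> strips lo hi" using e thr by (simp add: strips_def D_def)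
        show ?thesis
        proof (rule place[OF i pq(1) q'])
          show "z + (a e - w) = h - offset e b e (\<not> b) True" using h' by (simp add: offset_def D_def)
          show "xlo e b e (\<not> b) True h \<le> z"
            using y h_thr threshold_same(2)[OF e(1), of b] by (simp add: xlo_def)
          show "z \<le> xhi e b e (\<not> b) True h"
            using y h_thr h' threshold_same(2)[OF e(1), of "\<not> b"] by (simp add: xhi_def D_def)
        qed
      qed
    qed
    show ?thesis
    proof (cases "x \<le> y")
      case le: True
      show ?thesis
        by (rule main[of x y False]) (use e f True le in \<open>simp_all add: pt_def\<close>)
    next
      case False
      show ?thesis
        by (rule main[of "a e - x" "a e - y" True]) (use e f True False in \<open>simp_all add: pt_def\<close>)
    qed
  qed
qed

lemma strip_continuous:
  assumes i: "i \<in> strips lo hi" and rt: "{r..t} \<subseteq> {lo<..<hi}"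
  shows "continuous_map (top_of_set ({0..1} \<times> {r..t})) (prod_topology X X) (\<lambda>(u, h). strip i u h)"
proof -
  obtain e b f c k where i': "i = (e, b, f, c, k)" by (cases i)
  note i = i[unfolded i']
  have e: "e \<in> E" and f: "f \<in> E" using i by (auto simp: strips_def)
  have contx: "continuous_on S (\<lambda>z. sx e b f c k (fst z) (snd z))" for S
    unfolding sx_def xlo_def xhi_def by (cases k) (auto intro!: continuous_intros)
  have conty: "continuous_on S (\<lambda>z. sy e b f c k (fst z) (snd z))" for S
    unfolding sy_def by (intro continuous_intros contx)
  let ?K = "top_of_set ({0..1} \<times> {r..t})"
  have "continuous_map ?K (top_of_set {0..a e}) (\<lambda>z. flip e b (sx e b f c k (fst z) (snd z)))"
  proof -
    have "flip e b (sx e b f c k u h) \<in> {0..a e}" if "u \<in> {0..1}" "h \<in> {r..t}" for u h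
      using strip_range(3)[OF i _ that(1), of h] that(2) rt by (auto simp: flip_def)
    moreover have "continuous_on ({0..1} \<times> {r..t}) (\<lambda>z. flip e b (sx e b f c k (fst z) (snd z)))"
      using contx by (cases b) (simp_all add: flip_def continuous_on_diff)
    ultimately show ?thesis by (auto simp: continuous_map_in_subtopology)
  qed
  from continuous_map_compose[OF this cont[OF e]]
  have 1: "continuous_map ?K X (\<lambda>z. pt e b (sx e b f c k (fst z) (snd z)))" by (simp add: o_def pt_def flip_def)
  have "continuous_map ?K (top_of_set {0..a f}) (\<lambda>z. flip f c (sy e b f c k (fst z) (snd z)))"
  proof -
    have "flip f c (sy e b f c k u h) \<in> {0..a f}" if "u \<in> {0..1}" "h \<in> {r..t}" for u h
      using strip_range(4)[OF i _ that(1), of h] that(2) rt by (auto simp: flip_def)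
    moreover have "continuous_on ({0..1} \<times> {r..t}) (\<lambda>z. flip f c (sy e b f c k (fst z) (snd z)))"
      using conty by (cases c) (simp_all add: flip_def continuous_on_diff)
    ultimately show ?thesis by (auto simp: continuous_map_in_subtopology)
  qed
  from continuous_map_compose[OF this cont[OF f]]
  have 2: "continuous_map ?K X (\<lambda>z. pt f c (sy e b f c k (fst z) (snd z)))" by (simp add: o_def pt_def flip_def)
  from 1 2 show ?thesis
    by (simp add: i' strip_def case_prod_unfold continuous_map_paired)
qed

end

lemma compact_X: "compact_space X"
proof -
  have "compactin X (\<psi> e ` {0..a e})" if "e \<in> E" for e
    by (rule image_compactin[OF _ cont[OF that]]) (simp add: compactin_subtopology)
  then have "compactin X (\<Union>e\<in>E. \<psi> e ` {0..a e})"
    using finite_E by (intro compactin_Union) auto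
  moreover have "(\<Union>e\<in>E. \<psi> e ` {0..a e}) = topspace X"
    using covered in_X by blast
  ultimately show ?thesis by (simp add: compact_space_def)
qed

lemma isotopic_far_pairs:
  assumes "0 < r" "r \<le> s" and fin: "finite critical" and no: "\<And>c. c \<in> critical \<Longrightarrow> c < r \<or> s < c"
  shows "isotopic_in (prod_topology X X) (far_pairs X \<delta> r) (far_pairs X \<delta> s)"
proof -
  define lo where "lo = Max (insert 0 {c \<in> critical. c < r})"
  define hi where "hi = Min (insert (s + 1) {c \<in> critical. s < c})"
  have lo: "0 \<le> lo" "lo < r" using fin assms(1) by (auto simp: lo_def)
  have hi: "s < hi" using fin by (simp add: hi_def)
  have noncritical: "c \<le> lo \<or> hi \<le> c" if "c \<in> critical" for c
    using no[OF that] that fin by (auto simp: lo_def hi_def intro: Max_ge Min_le)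
  define t where "t = (s + hi) / 2"
  have t: "s < t" "t < hi" using hi by (auto simp: t_def)
  have rt: "{r..t} \<subseteq> {lo<..<hi}" using lo t by auto
  let ?Z = "prod_topology X X" and ?d = "\<lambda>(p, q). \<delta> p q"
  have "isotopic_in ?Z {z \<in> topspace ?Z. r \<le> ?d z} {z \<in> topspace ?Z. s \<le> ?d z}"
  proof (rule isotopic_superlevels_if_parallel_strips[where I = "strips lo hi" and \<sigma> = strip and t = t])
    show "compact_space ?Z" using compact_X by (simp add: compact_space_prod_topology)
    show "Hausdorff_space ?Z" using Hausdorff by (simp add: Hausdorff_space_prod_topology)
    show "continuous_map ?Z euclideanreal ?d" by (rule continuous_dist)
    show "finite (strips lo hi)" by (rule finite_strips)
    show "continuous_map (top_of_set ({0..1} \<times> {r..t})) ?Z (\<lambda>(u, h). strip i u h)" if "i \<in> strips lo hi" for i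
      by (rule strip_continuous[OF lo(1) noncritical that rt])
    show "?d (strip i u h) = h" if "i \<in> strips lo hi" "u \<in> {0..1}" "h \<in> {r..t}" for i u h
    proof -
      obtain e b f c k where i: "i = (e, b, f, c, k)" by (cases i)
      have "h \<in> {lo<..<hi}" using that(3) rt by blast
      from strip_level[OF lo(1) noncritical that(1)[unfolded i] this that(2)] show ?thesis
        by (simp add: strip_def i)
    qed
    show "\<exists>i\<in>strips lo hi. \<exists>u\<in>{0..1}. z = strip i u (?d z)" if "z \<in> topspace ?Z" "?d z \<in> {r..t}" for z
    proof -
      obtain p q where z: "z = (p, q)" by (cases z)
      have "p \<in> topspace X" "q \<in> topspace X" "\<delta> p q \<in> {lo<..<hi}" using that z rt by auto
      from strips_cover[OF lo(1) noncritical this] show ?thesis by (simp add: z)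
    qed
    show "strip i u h' = strip j v h'"
      if "i \<in> strips lo hi" "j \<in> strips lo hi" "u \<in> {0..1}" "v \<in> {0..1}" "h \<in> {r..t}" "h' \<in> {r..t}"
        "strip i u h = strip j v h" for i j u v h h'
      using strips_parallel[OF lo(1) noncritical that(1-4) _ _ that(7)] that(5,6) rt by blast
  qed (use assms(2) t in auto)
  moreover have "{z \<in> topspace ?Z. r' \<le> ?d z} = far_pairs X \<delta> r'" for r'
    by (auto simp: far_pairs_def)
  ultimately show ?thesis by simp
qed

end

section \<open>Cell structures and the path metric\<close>

lemma connected_space_closed_split:
  assumes "connected_space X" "closedin X C" "closedin X D" "C \<union> D = topspace X" "C \<inter> D = {}"
  shows "C = {} \<or> D = {}"
  using assms unfolding connected_space_closedin by blast

text \<open>A cell structure with chosen characteristic maps. Injectivity on the open interval is enough, as the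
topology of the cells can be recovered from compactness, see \<open>openin_image\<close> below.\<close>

locale cell_graph =
  fixes X :: "'a topology" and V :: "'a set" and E :: "'a set set" and \<phi> :: "'a set \<Rightarrow> real \<Rightarrow> 'a"
  assumes Hausdorff: "Hausdorff_space X"
    and finite_V: "finite V" and finite_E: "finite E"
    and cells_cover: "V \<union> \<Union>E = topspace X"
    and vertex_notin_cell: "\<lbrakk>e \<in> E; v \<in> V\<rbrakk> \<Longrightarrow> v \<notin> e"
    and cells_disjoint: "\<lbrakk>e \<in> E; f \<in> E; p \<in> e; p \<in> f\<rbrakk> \<Longrightarrow> e = f"
    and cont: "e \<in> E \<Longrightarrow> continuous_map (top_of_set {0..1}) X (\<phi> e)"
    and inj: "e \<in> E \<Longrightarrow> inj_on (\<phi> e) {0<..<1}"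
    and cell_image: "e \<in> E \<Longrightarrow> \<phi> e ` {0<..<1} = e"
    and start_in_V: "e \<in> E \<Longrightarrow> \<phi> e 0 \<in> V" and end_in_V: "e \<in> E \<Longrightarrow> \<phi> e 1 \<in> V"
begin

lemma in_X: "\<lbrakk>e \<in> E; s \<in> {0..1}\<rbrakk> \<Longrightarrow> \<phi> e s \<in> topspace X"
  using continuous_map_image_subset_topspace[OF cont] by fastforce

lemma V_subset: "V \<subseteq> topspace X"
  using cells_cover by blast

lemma in_cell: "\<lbrakk>e \<in> E; 0 < s; s < 1\<rbrakk> \<Longrightarrow> \<phi> e s \<in> e"
  using cell_image[of e] by auto

lemma point_cases:
  assumes "p \<in> topspace X"
  obtains "p \<in> V" | e s where "e \<in> E" "0 < s" "s < 1" "p = \<phi> e s" "p \<in> e"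
proof (cases "p \<in> V")
  case False
  have "p \<in> V \<union> \<Union>E" unfolding cells_cover by (rule assms)
  with False obtain e where e: "e \<in> E" "p \<in> e" by auto
  then have "p \<in> \<phi> e ` {0<..<1}" by (simp add: cell_image)
  then obtain s where "s \<in> {0<..<1}" "p = \<phi> e s" by (rule imageE)
  then show thesis using that(2)[OF e(1) _ _ _ e(2), of s] by simp
qed

lemma closed_edge_cases:
  assumes "s \<in> {0..1}"
  obtains "s = 0" | "s = 1" | "0 < s" "s < (1::real)"
  using assms by fastforce

lemma closed_edge_subset: "e \<in> E \<Longrightarrow> s \<in> {0..1} \<Longrightarrow> \<phi> e s \<in> e \<or> \<phi> e s \<in> V"
  by (erule closed_edge_cases) (auto simp: start_in_V end_in_V in_cell)

lemma closedin_image: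
  assumes "e \<in> E" "closed C" "C \<subseteq> {0..1}"
  shows "closedin X (\<phi> e ` C)"
proof -
  have "compact C" using assms(2,3) by (meson bounded_closed_interval bounded_subset compact_eq_bounded_closed)
  then have "compactin (top_of_set {0..1}) C" using assms(3) by (simp add: compactin_subtopology)
  then show ?thesis using image_compactin cont[OF assms(1)] compactin_imp_closedin Hausdorff by blast
qed

lemma closedin_finite: "\<lbrakk>finite S; S \<subseteq> topspace X\<rbrakk> \<Longrightarrow> closedin X S"
  using Hausdorff closedin_Hausdorff_finite by blast

text \<open>The complement is the union of the vertices, the other closed edges and the rest of the edge \<open>e\<close>,
which are all compact.\<close>

lemma openin_image:
  assumes e: "e \<in> E" and U: "open U" "U \<subseteq> {0<..<1}"
  shows "openin X (\<phi> e ` U)"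
proof -
  let ?C = "V \<union> (\<Union>f\<in>E - {e}. \<phi> f ` {0..1}) \<union> \<phi> e ` ({0..1} - U)"
  have "closedin X (\<Union>f\<in>E - {e}. \<phi> f ` {0..1})"
    using finite_E by (intro closedin_Union) (auto intro: closedin_image)
  moreover have "closedin X (\<phi> e ` ({0..1} - U))"
    using U by (intro closedin_image[OF e]) (auto intro: closed_Diff)
  ultimately have closed: "closedin X ?C"
    using closedin_finite[OF finite_V V_subset] by (intro closedin_Un)
  have "topspace X - ?C = \<phi> e ` U"
  proof (intro subset_antisym subsetI)
    fix p assume p: "p \<in> topspace X - ?C"
    then have p': "p \<in> topspace X" "p \<notin> V" "p \<notin> \<phi> e ` ({0..1} - U)"
      "\<And>f. f \<in> E \<Longrightarrow> f \<noteq> e \<Longrightarrow> p \<notin> \<phi> f ` {0..1}" by simp_all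
    from p'(1) show "p \<in> \<phi> e ` U"
    proof (cases rule: point_cases)
      case 1
      with p'(2) show ?thesis by simp
    next
      case (2 f s)
      then have s: "s \<in> {0..1}" by simp
      have fe: "f = e"
      proof (rule ccontr)
        assume "f \<noteq> e"
        from p'(4)[OF 2(1) this] show False unfolding 2(4) using imageI[OF s] by (rule notE)
      qed
      have "s \<in> U"
      proof (rule ccontr)
        assume "s \<notin> U"
        then have "s \<in> {0..1} - U" using s by simp
        then have "p \<in> \<phi> e ` ({0..1} - U)" unfolding 2(4) fe by (rule imageI)
        with p'(3) show False by (rule notE)
      qed
      then show ?thesis unfolding 2(4) fe by (rule imageI)
    qed
  next
    fix p assume "p \<in> \<phi> e ` U"
    then obtain s where s: "s \<in> U" "p = \<phi> e s" by blast
    then have s01: "0 < s" "s < 1" using U by auto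
    have pe: "p \<in> e" using in_cell[OF e s01] s by simp
    have "p \<in> topspace X" using pe e cells_cover by blast
    moreover have "p \<notin> V" using vertex_notin_cell[OF e] pe by blast
    moreover have "p \<notin> \<phi> f ` {0..1}" if "f \<in> E - {e}" for f
    proof
      assume "p \<in> \<phi> f ` {0..1}"
      then have "p \<in> f" using closed_edge_subset[of f] that \<open>p \<notin> V\<close> by blast
      then show False using cells_disjoint[OF e, of f p] pe that by blast
    qed
    moreover have "p \<notin> \<phi> e ` ({0..1} - U)"
    proof
      assume "p \<in> \<phi> e ` ({0..1} - U)"
      then obtain t where t: "t \<in> {0..1}" "t \<notin> U" "p = \<phi> e t" by blast
      have "t \<noteq> 0" "t \<noteq> 1" using t(3) start_in_V[OF e] end_in_V[OF e] \<open>p \<notin> V\<close> by auto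
      then have "t \<in> {0<..<1}" using t(1) by auto
      then have "t = s" using inj[OF e] s t(3) s01 by (auto dest: inj_onD)
      then show False using s t by blast
    qed
    ultimately show "p \<in> topspace X - ?C" by simp
  qed
  moreover have "openin X (topspace X - ?C)" using closed by (rule openin_diff[OF openin_topspace])
  ultimately show ?thesis by simp
qed

lemma openin_cell: "e \<in> E \<Longrightarrow> openin X e"
  using openin_image[of e "{0<..<1}"] cell_image[of e] by simp

text \<open>The vertices outside all closed edges form a finite set, which is closed; so do the edges.
Connectedness excludes isolated vertices.\<close>

lemma covered_by_edges:
  assumes "connected_space X" "topspace X \<noteq> {}" "\<nexists>p. topspace X = {p}"
  shows "topspace X = (\<Union>e\<in>E. \<phi> e ` {0..1})"
proof -
  let ?C = "\<Union>e\<in>E. \<phi> e ` {0..1}"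
  have C: "closedin X ?C" using finite_E by (intro closedin_Union) (auto intro: closedin_image)
  have D: "closedin X (V - ?C)" using finite_V V_subset by (intro closedin_finite) auto
  have "?C \<subseteq> topspace X" using in_X by blast
  moreover have "topspace X \<subseteq> V \<union> ?C"
  proof
    fix p assume "p \<in> topspace X"
    then show "p \<in> V \<union> ?C"
    proof (cases rule: point_cases)
      case (2 e s)
      then have "p \<in> \<phi> e ` {0..1}" by simp
      then show ?thesis using 2(1) by blast
    qed simp
  qed
  ultimately have un: "?C \<union> (V - ?C) = topspace X" using V_subset by blast
  have "?C = {} \<or> V - ?C = {}"
    by (rule connected_space_closed_split[OF assms(1) C D un]) blast
  then show ?thesis
  proof
    assume "?C = {}"
    then have "E = {}" by fastforce
    then have V: "topspace X = V" using cells_cover by simp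
    then obtain v where v: "v \<in> V" using assms(2) by blast
    have "{v} = {} \<or> V - {v} = {}"
      by (rule connected_space_closed_split[OF assms(1)]) (use v V finite_V in \<open>auto intro!: closedin_finite\<close>)
    then have "topspace X = {v}" unfolding V using v by blast
    then show ?thesis using assms(3) by simp
  next
    assume "V - ?C = {}"
    then show ?thesis using un by blast
  qed
qed

lemma continuous_map_on_edges:
  assumes "topspace X = (\<Union>e\<in>E. \<phi> e ` {0..1})"
    and "\<And>e. e \<in> E \<Longrightarrow> continuous_map (top_of_set {0..1}) Z (\<lambda>s. F (\<phi> e s))"
  shows "continuous_map X Z F"
  by (rule continuous_map_from_compact_cover[OF finite_E Hausdorff, where K = "\<lambda>_. top_of_set {0..1::real}" and g = \<phi>])
    (use assms cont in \<open>simp_all add: compact_space_subtopology\<close>)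

end

locale weighted_cell_graph = cell_graph +
  fixes L :: "'a set \<Rightarrow> real"
  assumes L_pos: "e \<in> E \<Longrightarrow> 0 < L e"
    and connected: "connected_space X"
begin

definition d :: "'a \<Rightarrow> 'a \<Rightarrow> real" where "d = path_metric E \<phi> L"

lemma pl_length_nonneg: "pl_path E \<phi> x p y \<Longrightarrow> 0 \<le> pl_length L p"
proof (induction p arbitrary: x)
  case (Cons z p)
  obtain e s t where z: "z = (e, s, t)" by (cases z)
  have "0 \<le> L e * \<bar>t - s\<bar>" using Cons.prems z L_pos[of e] by (intro mult_nonneg_nonneg) auto
  moreover have "0 \<le> pl_length L p" using Cons z by auto
  ultimately show ?case by (simp add: z pl_length_def)
qed (simp add: pl_length_def)

text \<open>The points that can be joined to \<open>q\<close> form a union of closed edges and vertices, and so does the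
complement. Both are closed.\<close>

lemma pl_path_exists:
  assumes "p \<in> topspace X" "q \<in> topspace X"
  shows "\<exists>w. pl_path E \<phi> p w q"
proof -
  define R where "R = {p \<in> topspace X. \<exists>w. pl_path E \<phi> p w q}"
  have R_edge: "\<phi> e t \<in> R" if e: "e \<in> E" "s \<in> {0..1}" "t \<in> {0..1}" and s: "\<phi> e s \<in> R" for e s t
  proof -
    obtain w where "pl_path E \<phi> (\<phi> e s) w q" using s by (auto simp: R_def)
    then have "pl_path E \<phi> (\<phi> e t) ((e, t, s) # w) q" using e by simp
    then show ?thesis using in_X[OF e(1,3)] unfolding R_def mem_Collect_eq by (intro conjI exI)
  qed
  have closed: "closedin X S"
    if S: "S \<subseteq> topspace X" and edge: "\<And>e s t. \<lbrakk>e \<in> E; s \<in> {0..1}; t \<in> {0..1}; \<phi> e s \<in> S\<rbrakk> \<Longrightarrow> \<phi> e t \<in> S" for S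
  proof -
    let ?U = "\<Union>e\<in>{e \<in> E. \<phi> e ` {0..1} \<subseteq> S}. \<phi> e ` {0..1}"
    have "closedin X (V \<inter> S)" using finite_V V_subset by (intro closedin_finite) auto
    moreover have "closedin X ?U"
      using finite_E by (intro closedin_Union) (auto intro: closedin_image)
    ultimately have "closedin X ((V \<inter> S) \<union> ?U)" by (rule closedin_Un)
    moreover have "(V \<inter> S) \<union> ?U = S"
    proof (intro subset_antisym subsetI)
      fix x assume x: "x \<in> S"
      then have "x \<in> topspace X" using S by blast
      then show "x \<in> (V \<inter> S) \<union> ?U"
      proof (cases rule: point_cases)
        case (2 e s)
        then have s: "s \<in> {0..1}" by simp
        have "\<phi> e ` {0..1} \<subseteq> S"
        proof (rule image_subsetI)
          fix t :: real assume "t \<in> {0..1}"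
          with edge[OF 2(1) s] x 2(4) show "\<phi> e t \<in> S" by simp
        qed
        moreover have "x \<in> \<phi> e ` {0..1}" unfolding 2(4) using s by (rule imageI)
        ultimately show ?thesis using 2(1) by blast
      qed (use x in simp)
    qed blast
    ultimately show ?thesis by simp
  qed
  have R_sub: "R \<subseteq> topspace X" unfolding R_def by (rule Collect_restrict)
  have 1: "closedin X R"
  proof (rule closed[OF R_sub])
    show "\<phi> e t \<in> R" if "e \<in> E" "s \<in> {0..1}" "t \<in> {0..1}" "\<phi> e s \<in> R" for e s t
      by (rule R_edge[OF that])
  qed
  have 2: "closedin X (topspace X - R)"
  proof (rule closed[OF Diff_subset])
    fix e and s t :: real assume e: "e \<in> E" "s \<in> {0..1}" "t \<in> {0..1}" "\<phi> e s \<in> topspace X - R"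
    then show "\<phi> e t \<in> topspace X - R" using R_edge[OF e(1,3,2)] in_X[OF e(1,3)] by blast
  qed
  have "R = {} \<or> topspace X - R = {}"
    by (rule connected_space_closed_split[OF connected 1 2]) (use R_sub in auto)
  moreover have "pl_path E \<phi> q [] q" by simp
  then have "q \<in> R" using assms(2) unfolding R_def mem_Collect_eq by (intro conjI exI)
  ultimately have "topspace X - R = {}" by auto
  then have "p \<in> R" using assms(1) by auto
  then show ?thesis by (auto simp: R_def)
qed

lemma d_le: "pl_path E \<phi> p w q \<Longrightarrow> d p q \<le> pl_length L w"
  unfolding d_def path_metric_def
  by (rule cInf_lower) (auto intro!: bdd_belowI[of _ 0] pl_length_nonneg)

lemma d_ge:
  assumes "p \<in> topspace X" "q \<in> topspace X" "\<And>w. pl_path E \<phi> p w q \<Longrightarrow> c \<le> pl_length L w"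
  shows "c \<le> d p q"
  unfolding d_def path_metric_def
  by (rule cInf_greatest) (use pl_path_exists[OF assms(1,2)] assms(3) in auto)

lemma d_nonneg: "\<lbrakk>p \<in> topspace X; q \<in> topspace X\<rbrakk> \<Longrightarrow> 0 \<le> d p q"
  by (rule d_ge) (auto intro: pl_length_nonneg)

lemma d_self: "p \<in> topspace X \<Longrightarrow> d p p = 0"
  using d_le[of p "[]" p] d_nonneg[of p p] by (simp add: pl_length_def)

lemma d_prepend:
  assumes "e \<in> E" "s \<in> {0..1}" "t \<in> {0..1}" "q \<in> topspace X"
  shows "d (\<phi> e s) q \<le> L e * \<bar>t - s\<bar> + d (\<phi> e t) q"
proof -
  have "d (\<phi> e s) q - L e * \<bar>t - s\<bar> \<le> d (\<phi> e t) q"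
  proof (rule d_ge)
    fix w assume "pl_path E \<phi> (\<phi> e t) w q"
    then have "pl_path E \<phi> (\<phi> e s) ((e, s, t) # w) q" using assms by simp
    from d_le[OF this] show "d (\<phi> e s) q - L e * \<bar>t - s\<bar> \<le> pl_length L w" by (simp add: pl_length_def)
  qed (use assms in_X in auto)
  then show ?thesis by simp
qed

text \<open>Triangle inequality and symmetry are special cases of this, for \<open>h = (\<lambda>p. d p s)\<close> and
\<open>h = (\<lambda>p. - d p q)\<close>.\<close>

lemma d_greatest:
  assumes h: "\<And>e s t. \<lbrakk>e \<in> E; s \<in> {0..1}; t \<in> {0..1}\<rbrakk> \<Longrightarrow> h (\<phi> e s) - h (\<phi> e t) \<le> L e * \<bar>s - t\<bar>"
    and pq: "p \<in> topspace X" "q \<in> topspace X"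
  shows "h p - h q \<le> d p q"
proof (rule d_ge[OF pq])
  fix w assume "pl_path E \<phi> p w q"
  then show "h p - h q \<le> pl_length L w"
  proof (induction w arbitrary: p)
    case (Cons z w)
    obtain e s t where z: "z = (e, s, t)" by (cases z)
    have "h (\<phi> e t) - h q \<le> pl_length L w" using Cons z by auto
    moreover have "h p - h (\<phi> e t) \<le> L e * \<bar>s - t\<bar>" using Cons.prems z h by auto
    ultimately show ?case by (simp add: z pl_length_def abs_minus_commute)
  qed (simp add: pl_length_def)
qed

lemma d_triangle:
  assumes "p \<in> topspace X" "q \<in> topspace X" "s \<in> topspace X"
  shows "d p s \<le> d p q + d q s"
proof -
  have "d p s - d q s \<le> d p q"
  proof (rule d_greatest[where h = "\<lambda>p. d p s", OF _ assms(1,2)])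
    fix e and s' t :: real assume "e \<in> E" "s' \<in> {0..1}" "t \<in> {0..1}"
    from d_prepend[OF this assms(3)] show "d (\<phi> e s') s - d (\<phi> e t) s \<le> L e * \<bar>s' - t\<bar>"
      by (simp add: abs_minus_commute)
  qed
  then show ?thesis by simp
qed

lemma d_sym:
  assumes "p \<in> topspace X" "q \<in> topspace X"
  shows "d p q = d q p"
proof -
  have "d p q \<le> d q p" if pq: "p \<in> topspace X" "q \<in> topspace X" for p q
  proof -
    have "- d q q - - d p q \<le> d q p"
    proof (rule d_greatest[where h = "\<lambda>p. - d p q", OF _ pq(2,1)])
      fix e and s' t :: real assume "e \<in> E" "s' \<in> {0..1}" "t \<in> {0..1}"
      from d_prepend[OF this(1,3,2) pq(2)] show "- d (\<phi> e s') q - - d (\<phi> e t) q \<le> L e * \<bar>s' - t\<bar>"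
        by simp
    qed
    then show ?thesis using d_self[OF pq(2)] by simp
  qed
  then show ?thesis using assms by (meson antisym)
qed

lemma d_lipschitz:
  assumes "e \<in> E" "s \<in> {0..1}" "t \<in> {0..1}" "q \<in> topspace X"
  shows "\<bar>d (\<phi> e s) q - d (\<phi> e t) q\<bar> \<le> L e * \<bar>s - t\<bar>"
  using d_prepend[OF assms] d_prepend[OF assms(1,3,2,4)] by (simp add: abs_minus_commute abs_le_iff)

lemma d_continuous:
  assumes "topspace X = (\<Union>e\<in>E. \<phi> e ` {0..1})" "q \<in> topspace X"
  shows "continuous_map X euclideanreal (\<lambda>p. d p q)"
proof (rule continuous_map_on_edges[OF assms(1)])
  fix e assume e: "e \<in> E"
  have "continuous_on {0..1} (\<lambda>s. d (\<phi> e s) q)"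
  proof (rule lipschitz_on_continuous_on[of "L e"], rule lipschitz_onI)
    show "dist (d (\<phi> e s) q) (d (\<phi> e t) q) \<le> L e * dist s t" if "s \<in> {0..1}" "t \<in> {0..1}" for s t
      using d_lipschitz[OF e that assms(2)] by (simp add: dist_real_def)
  qed (use L_pos[OF e] in simp)
  then show "continuous_map (top_of_set {0..1}) euclideanreal (\<lambda>s. d (\<phi> e s) q)" by simp
qed

end

section \<open>Arc length in another cell structure\<close>

text \<open>On an interval without exceptional points the bound follows by bisection, first inside and then up to
the ends by continuity. The exceptional points cut the interval into finitely many such pieces.\<close>

lemma lipschitz_if_locally_lipschitz:
  fixes f :: "real \<Rightarrow> real"
  assumes cont: "continuous_on {a..b} f" and "finite S" "0 \<le> K"
    and local: "\<And>x. \<lbrakk>x \<in> {a<..<b}; x \<notin> S\<rbrakk> \<Longrightarrow> \<exists>\<epsilon>>0. \<forall>y. \<bar>y - x\<bar> < \<epsilon> \<longrightarrow> \<bar>f y - f x\<bar> \<le> K * \<bar>y - x\<bar>"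
    and xy: "x \<in> {a..b}" "y \<in> {a..b}"
  shows "\<bar>f x - f y\<bar> \<le> K * \<bar>x - y\<bar>"
proof -
  have base: "\<bar>f v - f u\<bar> \<le> K * (v - u)"
    if "a \<le> u" "u \<le> v" "v \<le> b" and free: "\<And>x. \<lbrakk>u < x; x < v\<rbrakk> \<Longrightarrow> x \<notin> S" for u v
  proof (cases "u = v")
    case False
    have inner: "\<bar>f d - f c\<bar> \<le> K * (d - c)" if "u < c" "c \<le> d" "d < v" for c d
      using that(2)
    proof (induction rule: Bolzano)
      case (trans p q r)
      then show ?case by (simp add: algebra_simps abs_le_iff)
    next
      case (local x)
      then have "x \<in> {a<..<b}" "x \<notin> S" using that \<open>a \<le> u\<close> \<open>v \<le> b\<close> free[of x] by auto
      from assms(4)[OF this] obtain \<epsilon> where \<epsilon>: "0 < \<epsilon>" "\<And>y. \<bar>y - x\<bar> < \<epsilon> \<Longrightarrow> \<bar>f y - f x\<bar> \<le> K * \<bar>y - x\<bar>" by blast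
      show ?case
      proof (intro exI[of _ \<epsilon>] conjI allI impI \<epsilon>(1))
        fix p q assume "p \<le> x \<and> x \<le> q \<and> q - p < \<epsilon>"
        then show "\<bar>f q - f p\<bar> \<le> K * (q - p)"
          using \<epsilon>(2)[of p] \<epsilon>(2)[of q] by (auto simp: algebra_simps abs_le_iff)
      qed
    qed
    have uv: "u < v" using False that by simp
    \<comment> \<open>The shift \<open>?g n\<close> tends to zero; the denominator starts at 3 so that the shifted ends stay in order.\<close>
    let ?g = "\<lambda>n::nat. (v - u) / (n + 3)"
    have g: "?g \<longlonglongrightarrow> 0"
      using LIMSEQ_ignore_initial_segment[OF tendsto_divide_0[OF tendsto_const filterlim_real_sequentially[THEN filterlim_at_top_imp_at_infinity]], of "v - u" 3] by (simp add: add.commute)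
    have g_pos: "0 < ?g n" "2 * ?g n < v - u" for n
    proof -
      show "0 < ?g n" using uv by simp
      have "(v - u) * 2 < (v - u) * (real n + 3)" using uv by (intro mult_strict_left_mono) auto
      then show "2 * ?g n < v - u" by (simp add: field_simps)
    qed
    have in_ab: "u + ?g n \<in> {a..b}" "v - ?g n \<in> {a..b}" for n
      using g_pos[of n] that(1,3) unfolding atLeastAtMost_iff by linarith+
    have "(\<lambda>n. u + ?g n) \<longlonglongrightarrow> u + 0" "(\<lambda>n. v - ?g n) \<longlonglongrightarrow> v - 0" by (intro tendsto_intros g)+
    then have lims: "(\<lambda>n. u + ?g n) \<longlonglongrightarrow> u" "(\<lambda>n. v - ?g n) \<longlonglongrightarrow> v" by simp_all
    have uv_ab: "u \<in> {a..b}" "v \<in> {a..b}" using that(1,3) uv by auto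
    have lim_u: "(\<lambda>n. f (u + ?g n)) \<longlonglongrightarrow> f u" and lim_v: "(\<lambda>n. f (v - ?g n)) \<longlonglongrightarrow> f v"
      by (rule continuous_on_tendsto_compose[OF cont lims(1) uv_ab(1)] continuous_on_tendsto_compose[OF cont lims(2) uv_ab(2)],
          intro always_eventually allI in_ab)+
    have "(\<lambda>n. K * (v - u) - \<bar>f (v - ?g n) - f (u + ?g n)\<bar>) \<longlonglongrightarrow> K * (v - u) - \<bar>f v - f u\<bar>"
      by (intro tendsto_intros lim_u lim_v)
    moreover have "0 \<le> K * (v - u) - \<bar>f (v - ?g n) - f (u + ?g n)\<bar>" for n
    proof -
      have "\<bar>f (v - ?g n) - f (u + ?g n)\<bar> \<le> K * ((v - ?g n) - (u + ?g n))"
        by (rule inner) (use g_pos[of n] in linarith)+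
      also have "\<dots> \<le> K * (v - u)" using g_pos[of n] assms(3) by (intro mult_left_mono) linarith+
      finally show ?thesis by simp
    qed
    ultimately have "0 \<le> K * (v - u) - \<bar>f v - f u\<bar>"
      by (intro tendsto_lowerbound[where F = sequentially]) auto
    then show ?thesis by simp
  qed simp
  have main: "\<bar>f v - f u\<bar> \<le> K * (v - u)" if "a \<le> u" "u \<le> v" "v \<le> b" for u v
  proof -
    have "\<bar>f v - f u\<bar> \<le> K * (v - u)" if "a \<le> u" "u \<le> v" "v \<le> b" "card {x \<in> S. u < x \<and> x < v} = n" for n u v
      using that
    proof (induction n arbitrary: u v rule: less_induct)
      case (less n)
      show ?case
      proof (cases "{x \<in> S. u < x \<and> x < v} = {}")
        case True
        then show ?thesis using less.prems by (intro base) auto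
      next
        case False
        then obtain x where x: "x \<in> S" "u < x" "x < v" by blast
        have fin: "finite {x \<in> S. u < x \<and> x < v}" using assms(2) by simp
        have "card {y \<in> S. u < y \<and> y < x} < n" "card {y \<in> S. x < y \<and> y < v} < n"
          unfolding less.prems(4)[symmetric] using x by (intro psubset_card_mono[OF fin]; force)+
        then have "\<bar>f x - f u\<bar> \<le> K * (x - u)" "\<bar>f v - f x\<bar> \<le> K * (v - x)"
          using less.IH[of _ u x] less.IH[of _ x v] less.prems x by auto
        then show ?thesis by (simp add: algebra_simps abs_le_iff)
      qed
    qed
    then show ?thesis using that by blast
  qed
  show ?thesis
  proof (cases "x \<le> y")
    case True
    then show ?thesis using main[of x y] xy by (simp add: abs_minus_commute)
  next
    case False
    then show ?thesis using main[of y x] xy by simp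
  qed
qed

lemma connected_space_open_split:
  assumes "connected_space X" "openin X C" "openin X D" "C \<union> D = topspace X" "C \<inter> D = {}"
  shows "C = {} \<or> D = {}"
  using assms unfolding connected_space_def by blast

lemma strict_mono_extend_closed_interval:
  fixes f :: "real \<Rightarrow> real"
  assumes cd: "c < d" and cont: "continuous_on {c<..<d} f" and mono: "strict_mono_on {c<..<d} f"
    and bound: "\<And>x. x \<in> {c<..<d} \<Longrightarrow> \<bar>f x\<bar> \<le> B"
  obtains g where "continuous_on {c..d} g" "strict_mono_on {c..d} g" "\<And>x. x \<in> {c<..<d} \<Longrightarrow> g x = f x"
proof -
  let ?I = "{c<..<d}"
  define g where "g x = (if x \<le> c then Inf (f ` ?I) else if d \<le> x then Sup (f ` ?I) else f x)" for x
  have ne: "f ` ?I \<noteq> {}" using cd by (auto intro: dense)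
  have bb: "bdd_below (f ` ?I)" "bdd_above (f ` ?I)"
    using bound by (auto intro!: bdd_belowI[of _ "- B"] bdd_aboveI[of _ B] simp: abs_le_iff) fastforce
  have lt: "f x < f y" if "x \<in> ?I" "y \<in> ?I" "x < y" for x y
    using mono that by (simp add: monotone_on_def)
  have le: "f x \<le> f y" if "x \<in> ?I" "y \<in> ?I" "x \<le> y" for x y
    using lt[OF that(1,2)] that(3) by (cases "x = y") auto
  have Inf_less: "Inf (f ` ?I) < f x" if x: "x \<in> ?I" for x
  proof -
    have y: "(c + x) / 2 \<in> ?I" "(c + x) / 2 < x" using x by auto
    have "Inf (f ` ?I) \<le> f ((c + x) / 2)" using bb y by (intro cInf_lower) auto
    also have "\<dots> < f x" by (rule lt[OF y(1) x y(2)])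
    finally show ?thesis .
  qed
  have less_Sup: "f x < Sup (f ` ?I)" if x: "x \<in> ?I" for x
  proof -
    have y: "(x + d) / 2 \<in> ?I" "x < (x + d) / 2" using x by auto
    have "f x < f ((x + d) / 2)" by (rule lt[OF x y])
    also have "\<dots> \<le> Sup (f ` ?I)" using bb y by (intro cSup_upper) auto
    finally show ?thesis .
  qed
  have g_in: "g x = f x" if "x \<in> ?I" for x using that by (simp add: g_def)
  have g_c: "g c = Inf (f ` ?I)" and g_d: "g d = Sup (f ` ?I)" using cd by (simp_all add: g_def)
  have "continuous_on {c..d} g"
    unfolding continuous_on_iff
  proof (intro ballI allI impI)
    fix x and \<epsilon> :: real assume x: "x \<in> {c..d}" and \<epsilon>: "0 < \<epsilon>"
    consider "x = c" | "x = d" | "x \<in> ?I" using x by fastforce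
    then show "\<exists>r>0. \<forall>y\<in>{c..d}. dist y x < r \<longrightarrow> dist (g y) (g x) < \<epsilon>"
    proof cases
      case 1
      have "Inf (f ` ?I) < Inf (f ` ?I) + \<epsilon>" using \<epsilon> by simp
      then obtain m where m: "m \<in> ?I" "f m < Inf (f ` ?I) + \<epsilon>"
        unfolding cInf_less_iff[OF ne bb(1)] by blast
      show ?thesis
      proof (intro exI[of _ "m - c"] conjI ballI impI)
        show "0 < m - c" using m by simp
        fix y assume y: "y \<in> {c..d}" "dist y x < m - c"
        show "dist (g y) (g x) < \<epsilon>"
        proof (cases "y = c")
          case False
          then have yI: "y \<in> ?I" "y \<le> m" using y m 1 by (auto simp: dist_real_def)
          then show ?thesis
            using le[OF yI(1) m(1) yI(2)] m(2) Inf_less[OF yI(1)] g_in[OF yI(1)] g_c 1 by (simp add: dist_real_def)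
        qed (use 1 \<epsilon> in simp)
      qed
    next
      case 2
      have "Sup (f ` ?I) - \<epsilon> < Sup (f ` ?I)" using \<epsilon> by simp
      then obtain m where m: "m \<in> ?I" "Sup (f ` ?I) - \<epsilon> < f m"
        unfolding less_cSup_iff[OF ne bb(2)] by blast
      show ?thesis
      proof (intro exI[of _ "d - m"] conjI ballI impI)
        show "0 < d - m" using m by simp
        fix y assume y: "y \<in> {c..d}" "dist y x < d - m"
        show "dist (g y) (g x) < \<epsilon>"
        proof (cases "y = d")
          case False
          then have yI: "y \<in> ?I" "m \<le> y" using y m 2 by (auto simp: dist_real_def)
          then show ?thesis
            using le[OF m(1) yI(1) yI(2)] m(2) less_Sup[OF yI(1)] g_in[OF yI(1)] g_d 2 by (simp add: dist_real_def)
        qed (use 2 \<epsilon> in simp)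
      qed
    next
      case 3
      then obtain r where r: "0 < r" "\<And>y. y \<in> ?I \<Longrightarrow> dist y x < r \<Longrightarrow> dist (f y) (f x) < \<epsilon>"
        using cont \<epsilon> unfolding continuous_on_iff by blast
      show ?thesis
      proof (intro exI[of _ "min r (min (x - c) (d - x))"] conjI ballI impI)
        show "0 < min r (min (x - c) (d - x))" using r 3 by simp
        fix y assume y: "y \<in> {c..d}" "dist y x < min r (min (x - c) (d - x))"
        then have yI: "y \<in> ?I" by (auto simp: dist_real_def abs_less_iff)
        have "dist y x < r" using y(2) by simp
        from r(2)[OF yI this] show "dist (g y) (g x) < \<epsilon>" using g_in[OF yI] g_in[OF 3] by simp
      qed
    qed
  qed
  moreover have "strict_mono_on {c..d} g"
  proof (rule strict_mono_onI)
    fix x y assume xy: "x \<in> {c..d}" "y \<in> {c..d}" "x < y"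
    define m where "m = (x + y) / 2"
    have m: "m \<in> ?I" "x < m" "m < y" using xy by (auto simp: m_def)
    have "g x < g m"
      using m xy Inf_less[OF m(1)] lt[of x m] g_in[of x] g_in[OF m(1)] g_c by (cases "x = c") auto
    also have "g m < g y"
      using m xy less_Sup[OF m(1)] lt[of m y] g_in[of y] g_in[OF m(1)] g_d by (cases "y = d") auto
    finally show "g x < g y" .
  qed
  ultimately show thesis using g_in by (rule that)
qed

context weighted_cell_graph
begin

text \<open>Near \<open>u\<close> the curve \<open>\<gamma>\<close> runs along a single edge \<open>e\<close>, in the direction given by \<open>\<sigma>\<close>, and \<open>l\<close> measures
its length there.\<close>

definition unit_speed :: "(real \<Rightarrow> 'a) \<Rightarrow> (real \<Rightarrow> real) \<Rightarrow> real \<Rightarrow> real \<Rightarrow> real \<Rightarrow> bool" where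
  "unit_speed \<gamma> l c b u \<longleftrightarrow> (\<exists>e\<in>E. \<exists>s\<in>{0<..<1}. \<exists>\<sigma>\<in>{1, -1}. \<exists>\<epsilon>>0. \<forall>u'. \<bar>u' - u\<bar> < \<epsilon> \<longrightarrow>
     u' \<in> {c<..<b} \<and> s + \<sigma> * (l u' - l u) / L e \<in> {0<..<1} \<and> \<gamma> u' = \<phi> e (s + \<sigma> * (l u' - l u) / L e))"

text \<open>At the points of \<open>V\<close>, where the curve passes from one edge to another, continuity of \<open>l\<close> is all that
is required.\<close>

definition arc_length :: "(real \<Rightarrow> 'a) \<Rightarrow> (real \<Rightarrow> real) \<Rightarrow> real \<Rightarrow> real \<Rightarrow> bool" where
  "arc_length \<gamma> l c b \<longleftrightarrow> continuous_on {c..b} l \<and> strict_mono_on {c..b} l \<and>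
     (\<forall>u\<in>{c<..<b}. \<gamma> u \<notin> V \<longrightarrow> unit_speed \<gamma> l c b u)"

text \<open>By connectedness the curve stays in one open cell. There the transition to the parameter of the cell
is continuous and injective on an interval, hence monotone; up to sign and the length of the edge it
is the arc length.\<close>

lemma arc_length_inside_cell:
  fixes \<gamma> :: "real \<Rightarrow> 'a"
  assumes cb: "c < b" and \<gamma>: "continuous_map (top_of_set {c<..<b}) X \<gamma>" and inj\<gamma>: "inj_on \<gamma> {c<..<b}"
    and free: "\<And>u. u \<in> {c<..<b} \<Longrightarrow> \<gamma> u \<notin> V"
  shows "\<exists>l. arc_length \<gamma> l c b"
proof -
  let ?I = "{c<..<b}"
  have in_X: "\<gamma> u \<in> topspace X" if "u \<in> ?I" for u
    using continuous_map_image_subset_topspace[OF \<gamma>] that by auto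
  have m: "(c + b) / 2 \<in> ?I" using cb by simp
  from in_X[OF m] obtain e where e: "e \<in> E" "\<gamma> ((c + b) / 2) \<in> e"
    by (rule point_cases) (use free[OF m] in auto)
  have open_pre: "openin (top_of_set ?I) {u \<in> ?I. \<gamma> u \<in> U}" if "openin X U" for U
    using openin_continuous_map_preimage[OF \<gamma> that] by simp
  have single: "\<gamma> u \<in> e" if u: "u \<in> ?I" for u
  proof -
    let ?C = "{u \<in> ?I. \<gamma> u \<in> e}" and ?D = "{u \<in> ?I. \<gamma> u \<in> \<Union>(E - {e})}"
    have "?C = {} \<or> ?D = {}"
    proof (rule connected_space_open_split)
      show "connected_space (top_of_set ?I)" using connectedin_iff_connected[of ?I]
        by (simp add: connectedin_def del: connectedin_iff_connected)
      show "openin (top_of_set ?I) ?C" by (rule open_pre[OF openin_cell[OF e(1)]])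
      have "openin X (\<Union>(E - {e}))" by (rule openin_Union) (auto intro: openin_cell)
      then show "openin (top_of_set ?I) ?D" by (rule open_pre)
      show "?C \<union> ?D = topspace (top_of_set ?I)"
      proof (intro subset_antisym subsetI)
        fix u assume "u \<in> topspace (top_of_set ?I)"
        then have u: "u \<in> ?I" by simp
        from in_X[OF u] show "u \<in> ?C \<union> ?D"
          by (cases rule: point_cases) (use free[OF u] u in blast)+
      qed auto
      show "?C \<inter> ?D = {}" using cells_disjoint[OF e(1)] by blast
    qed
    moreover have "(c + b) / 2 \<in> ?C" using e m by blast
    ultimately have "?D = {}" by blast
    show ?thesis
    proof (rule ccontr)
      assume n: "\<gamma> u \<notin> e"
      from in_X[OF u] have "u \<in> ?D"
        by (cases rule: point_cases) (use free[OF u] u n in blast)+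
      with \<open>?D = {}\<close> show False by blast
    qed
  qed
  define \<theta> where "\<theta> u = inv_into {0<..<1} (\<phi> e) (\<gamma> u)" for u
  have \<theta>: "\<theta> u \<in> {0<..<1}" "\<phi> e (\<theta> u) = \<gamma> u" if "u \<in> ?I" for u
  proof -
    have "\<gamma> u \<in> \<phi> e ` {0<..<1}" unfolding cell_image[OF e(1)] by (rule single[OF that])
    then show "\<theta> u \<in> {0<..<1}" "\<phi> e (\<theta> u) = \<gamma> u" unfolding \<theta>_def by (rule inv_into_into, rule f_inv_into_f)
  qed
  have cont\<theta>: "continuous_on ?I \<theta>"
  proof (subst continuous_on_open_vimage[OF open_greaterThanLessThan], intro allI impI)
    fix B :: "real set" assume B: "open B"
    have "\<theta> -` B \<inter> ?I = {u \<in> ?I. \<gamma> u \<in> \<phi> e ` (B \<inter> {0<..<1})}"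
    proof (intro subset_antisym subsetI)
      fix u assume "u \<in> \<theta> -` B \<inter> ?I"
      then have u: "u \<in> ?I" "\<theta> u \<in> B" by auto
      have "\<phi> e (\<theta> u) \<in> \<phi> e ` (B \<inter> {0<..<1})" using \<theta>(1)[OF u(1)] u(2) by blast
      then show "u \<in> {u \<in> ?I. \<gamma> u \<in> \<phi> e ` (B \<inter> {0<..<1})}" using \<theta>(2)[OF u(1)] u(1) by simp
    next
      fix u assume "u \<in> {u \<in> ?I. \<gamma> u \<in> \<phi> e ` (B \<inter> {0<..<1})}"
      then obtain t where t: "u \<in> ?I" "t \<in> B" "t \<in> {0<..<1}" "\<gamma> u = \<phi> e t" by blast
      have "\<theta> u = t" using inj_onD[OF inj[OF e(1)], of "\<theta> u" t] \<theta>[OF t(1)] t(3,4) by simp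
      then show "u \<in> \<theta> -` B \<inter> ?I" using t by simp
    qed
    moreover have "openin (top_of_set ?I) {u \<in> ?I. \<gamma> u \<in> \<phi> e ` (B \<inter> {0<..<1})}"
      by (rule open_pre[OF openin_image[OF e(1)]]) (use B in auto)
    ultimately show "open (\<theta> -` B \<inter> ?I)" by (simp add: openin_open_eq)
  qed
  have "inj_on \<theta> ?I"
  proof (rule inj_onI)
    fix u v assume "u \<in> ?I" "v \<in> ?I" "\<theta> u = \<theta> v"
    then show "u = v" using \<theta>(2)[of u] \<theta>(2)[of v] inj_onD[OF inj\<gamma>, of u v] by simp
  qed
  then have "strict_mono_on ?I \<theta> \<or> strict_antimono_on ?I \<theta>"
    using injective_eq_monotone_map[of ?I \<theta>] cont\<theta> by (simp add: is_interval_oo)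
  then obtain \<sigma> :: real where \<sigma>: "\<sigma> \<in> {1, -1}" "strict_mono_on ?I (\<lambda>u. \<sigma> * \<theta> u)"
  proof
    assume "strict_mono_on ?I \<theta>"
    then show thesis using that[of 1] by simp
  next
    assume "strict_antimono_on ?I \<theta>"
    then have "strict_mono_on ?I (\<lambda>u. - 1 * \<theta> u)" by (simp add: monotone_on_def)
    then show thesis using that[of "- 1"] by simp
  qed
  have "continuous_on ?I (\<lambda>u. \<sigma> * \<theta> u)" by (intro continuous_intros cont\<theta>)
  moreover have "\<bar>\<sigma> * \<theta> u\<bar> \<le> 1" if "u \<in> ?I" for u using \<sigma>(1) \<theta>(1)[OF that] by auto
  ultimately obtain g where g: "continuous_on {c..b} g" "strict_mono_on {c..b} g" "\<And>u. u \<in> ?I \<Longrightarrow> g u = \<sigma> * \<theta> u"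
    using strict_mono_extend_closed_interval[OF cb _ \<sigma>(2)] by metis
  have Le: "0 < L e" by (rule L_pos[OF e(1)])
  have "arc_length \<gamma> (\<lambda>u. L e * g u) c b"
    unfolding arc_length_def
  proof (intro conjI ballI impI)
    show "continuous_on {c..b} (\<lambda>u. L e * g u)" by (intro continuous_intros g)
    show "strict_mono_on {c..b} (\<lambda>u. L e * g u)" using g(2) Le by (auto simp: monotone_on_def)
    fix u assume u: "u \<in> ?I"
    show "unit_speed \<gamma> (\<lambda>u. L e * g u) c b u"
      unfolding unit_speed_def
    proof (intro bexI[OF _ e(1)] bexI[OF _ \<theta>(1)[OF u]] bexI[OF _ \<sigma>(1)] exI[of _ "min (u - c) (b - u)"] conjI allI impI)
      show "0 < min (u - c) (b - u)" using u by simp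
      fix u' assume "\<bar>u' - u\<bar> < min (u - c) (b - u)"
      then show u': "u' \<in> ?I" by (auto simp: abs_less_iff)
      have "\<theta> u + \<sigma> * (L e * g u' - L e * g u) / L e = \<theta> u + \<sigma> * (\<sigma> * \<theta> u' - \<sigma> * \<theta> u)"
        using Le g(3)[OF u] g(3)[OF u'] by (simp add: field_simps)
      also have "\<dots> = \<theta> u'" using \<sigma>(1) by auto
      finally have eq: "\<theta> u + \<sigma> * (L e * g u' - L e * g u) / L e = \<theta> u'" .
      show "\<theta> u + \<sigma> * (L e * g u' - L e * g u) / L e \<in> {0<..<1}" "\<gamma> u' = \<phi> e (\<theta> u + \<sigma> * (L e * g u' - L e * g u) / L e)"
        unfolding eq using \<theta>[OF u'] by simp_all
    qed
  qed
  then show ?thesis by (rule exI[of "\<lambda>l. arc_length \<gamma> l c b"])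
qed

lemma unit_speed_cong:
  assumes "unit_speed \<gamma> l c b u" "c' \<le> c" "b \<le> b'" "u \<in> {c<..<b}"
    and "\<And>u. u \<in> {c<..<b} \<Longrightarrow> l' u = l u + k"
  shows "unit_speed \<gamma> l' c' b' u"
proof -
  obtain e s \<sigma> \<epsilon> where *: "e \<in> E" "s \<in> {0<..<1}" "\<sigma> \<in> {1, -1}" "0 < \<epsilon>"
    "\<And>u'. \<bar>u' - u\<bar> < \<epsilon> \<Longrightarrow> u' \<in> {c<..<b} \<and> s + \<sigma> * (l u' - l u) / L e \<in> {0<..<1} \<and> \<gamma> u' = \<phi> e (s + \<sigma> * (l u' - l u) / L e)"
    using assms(1) unfolding unit_speed_def by blast
  show ?thesis
    unfolding unit_speed_def
  proof (intro bexI[OF _ *(1)] bexI[OF _ *(2)] bexI[OF _ *(3)] exI[of _ \<epsilon>] conjI allI impI *(4))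
    fix u' assume "\<bar>u' - u\<bar> < \<epsilon>"
    note ** = *(5)[OF this]
    have eq: "l' u' - l' u = l u' - l u" using assms(4,5) ** by simp
    show "u' \<in> {c'<..<b'}" using ** assms(2,3) by auto
    show "s + \<sigma> * (l' u' - l' u) / L e \<in> {0<..<1}" "\<gamma> u' = \<phi> e (s + \<sigma> * (l' u' - l' u) / L e)"
      unfolding eq using ** by blast+
  qed
qed

lemma arc_length_glue:
  assumes 1: "arc_length \<gamma> l1 c m" and 2: "arc_length \<gamma> l2 m b" and m: "c < m" "m < b" "\<gamma> m \<in> V"
  shows "\<exists>l. arc_length \<gamma> l c b"
proof -
  define l' where "l' u = (if u \<le> m then l1 u else l2 u + (l1 m - l2 m))" for u
  have left: "l' u = l1 u + 0" if "u \<le> m" for u using that by (simp add: l'_def)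
  have right: "l' u = l2 u + (l1 m - l2 m)" if "m \<le> u" for u using that by (auto simp: l'_def)
  have "arc_length \<gamma> l' c b"
    unfolding arc_length_def
  proof (intro conjI ballI impI)
    have "continuous_on ({c..m} \<union> {m..b}) l'"
      unfolding l'_def using 1 2 by (intro continuous_on_cases continuous_intros) (auto simp: arc_length_def)
    moreover have "{c..m} \<union> {m..b} = {c..b}" using m by auto
    ultimately show "continuous_on {c..b} l'" by simp
    have mono1: "l1 u < l1 v" if "u \<in> {c..m}" "v \<in> {c..m}" "u < v" for u v
      using 1 that by (simp add: arc_length_def monotone_on_def)
    have mono2: "l2 u < l2 v" if "u \<in> {m..b}" "v \<in> {m..b}" "u < v" for u v
      using 2 that by (simp add: arc_length_def monotone_on_def)
    show "strict_mono_on {c..b} l'"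
    proof (rule strict_mono_onI)
      fix u v assume uv: "u \<in> {c..b}" "v \<in> {c..b}" "u < v"
      consider "v \<le> m" | "m \<le> u" | "u < m" "m < v" by linarith
      then show "l' u < l' v"
      proof cases
        case 1 then show ?thesis using uv mono1[of u v] by (simp add: left)
      next
        case 2 then show ?thesis using uv mono2[of u v] by (simp add: right)
      next
        case 3
        then show ?thesis using uv m mono1[of u m] mono2[of m v] by (simp add: left right)
      qed
    qed
    fix u assume u: "u \<in> {c<..<b}" "\<gamma> u \<notin> V"
    then have "u \<noteq> m" using m by auto
    then consider "u \<in> {c<..<m}" | "u \<in> {m<..<b}" using u by fastforce
    then show "unit_speed \<gamma> l' c b u"
    proof cases
      case 1
      with assms(1) u have "unit_speed \<gamma> l1 c m u" by (simp add: arc_length_def)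
      then show ?thesis by (rule unit_speed_cong) (use 1 m left in auto)
    next
      case 2
      with assms(2) u have "unit_speed \<gamma> l2 m b u" by (simp add: arc_length_def)
      then show ?thesis by (rule unit_speed_cong) (use 2 m right in auto)
    qed
  qed
  then show ?thesis by (rule exI[of "\<lambda>l. arc_length \<gamma> l c b"])
qed

text \<open>The curve is cut at the finitely many vertices that it passes.\<close>

lemma arc_length_exists:
  fixes \<gamma> :: "real \<Rightarrow> 'a"
  assumes \<gamma>: "continuous_map (top_of_set {0<..<1}) X \<gamma>" and inj\<gamma>: "inj_on \<gamma> {0<..<1}"
  shows "\<exists>l. arc_length \<gamma> l 0 1"
proof -
  have fin: "finite {u \<in> {0<..<1}. \<gamma> u \<in> V}"
  proof -
    have "finite (\<gamma> -` V \<inter> {0<..<1})" using finite_V inj\<gamma> by (rule finite_vimage_IntI)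
    then show ?thesis by (rule rev_finite_subset) auto
  qed
  have "\<exists>l. arc_length \<gamma> l c b" if "0 \<le> c" "c < b" "b \<le> 1" "card {u \<in> {c<..<b}. \<gamma> u \<in> V} = n" for n c b
    using that
  proof (induction n arbitrary: c b rule: less_induct)
    case (less n)
    have sub: "{c<..<b} \<subseteq> {0<..<1}" using less.prems by auto
    have finc: "finite {u \<in> {c<..<b}. \<gamma> u \<in> V}" by (rule finite_subset[OF _ fin]) (use sub in auto)
    show ?case
    proof (cases "{u \<in> {c<..<b}. \<gamma> u \<in> V} = {}")
      case True
      show ?thesis
      proof (rule arc_length_inside_cell[OF less.prems(2)])
        show "continuous_map (top_of_set {c<..<b}) X \<gamma>"
          using continuous_map_from_subtopology_mono[OF \<gamma> sub] .
        show "inj_on \<gamma> {c<..<b}" by (rule inj_on_subset[OF inj\<gamma> sub])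
      qed (use True in blast)
    next
      case False
      then obtain m where m: "m \<in> {c<..<b}" "\<gamma> m \<in> V" by blast
      have "{u \<in> {c<..<m}. \<gamma> u \<in> V} \<subset> {u \<in> {c<..<b}. \<gamma> u \<in> V}"
        "{u \<in> {m<..<b}. \<gamma> u \<in> V} \<subset> {u \<in> {c<..<b}. \<gamma> u \<in> V}" using m by force+
      then have "card {u \<in> {c<..<m}. \<gamma> u \<in> V} < n" "card {u \<in> {m<..<b}. \<gamma> u \<in> V} < n"
        using psubset_card_mono[OF finc] less.prems(4) by auto
      then obtain l1 l2 where "arc_length \<gamma> l1 c m" "arc_length \<gamma> l2 m b"
        using less.IH[of _ c m] less.IH[of _ m b] less.prems m by auto
      then show ?thesis by (rule arc_length_glue) (use m in auto)
    qed
  qed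
  from this[OF order_refl zero_less_one order_refl refl] show ?thesis .
qed

lemma arc_length_parametrization:
  fixes \<gamma> :: "real \<Rightarrow> 'a"
  assumes \<gamma>: "continuous_map (top_of_set {0..1}) X \<gamma>" and inj\<gamma>: "inj_on \<gamma> {0<..<1}"
  shows "\<exists>a \<psi>. 0 < a \<and> continuous_map (top_of_set {0..a}) X \<psi> \<and> \<psi> 0 = \<gamma> 0 \<and> \<psi> a = \<gamma> 1 \<and>
    \<psi> ` {0..a} = \<gamma> ` {0..1} \<and> \<psi> ` {0<..<a} = \<gamma> ` {0<..<1} \<and> inj_on \<psi> {0<..<a} \<and>
    (\<forall>x\<in>{0<..<a}. \<psi> x \<notin> V \<longrightarrow> unit_speed \<psi> (\<lambda>x. x) 0 a x)"
proof -
  have "continuous_map (top_of_set {0<..<1}) X \<gamma>"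
    by (rule continuous_map_from_subtopology_mono[OF \<gamma>]) (rule greaterThanLessThan_subseteq_atLeastAtMost_iff[THEN iffD2], simp)
  then obtain l0 where l0: "arc_length \<gamma> l0 0 1" using arc_length_exists inj\<gamma> by blast
  define l' where "l' u = l0 u - l0 0" for u
  define a where "a = l' 1"
  have cont: "continuous_on {0..1} l'" using l0 unfolding l'_def arc_length_def by (intro continuous_intros) auto
  have mono: "l' u < l' v" if "u \<in> {0..1}" "v \<in> {0..1}" "u < v" for u v
    using l0 that unfolding l'_def arc_length_def by (simp add: monotone_on_def)
  have l'0: "l' 0 = 0" by (simp add: l'_def)
  have a: "0 < a" using mono[of 0 1] l'0 by (simp add: a_def)
  have inj: "inj_on l' {0..1}"
  proof (rule inj_onI)
    fix u v assume uv: "u \<in> {0..1}" "v \<in> {0..1}" "l' u = l' v"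
    then show "u = v" using mono[of u v] mono[of v u] by (cases u v rule: linorder_cases) auto
  qed
  have img: "l' ` {0..1} = {0..a}"
  proof (intro subset_antisym subsetI)
    fix x assume "x \<in> l' ` {0..1}"
    then obtain u where u: "u \<in> {0..1}" "x = l' u" by blast
    have "0 \<le> l' u" using mono[of 0 u] u l'0 by (cases "u = 0") auto
    moreover have "l' u \<le> a" using mono[of u 1] u by (cases "u = 1") (auto simp: a_def)
    ultimately show "x \<in> {0..a}" using u by simp
  next
    fix x assume "x \<in> {0..a}"
    then obtain u where "0 \<le> u" "u \<le> 1" "l' u = x"
      using IVT'[of l' 0 x 1] cont l'0 by (auto simp: a_def)
    then show "x \<in> l' ` {0..1}" by auto
  qed
  define \<mu> where "\<mu> = inv_into {0..1} l'"
  have \<mu>l: "\<mu> (l' u) = u" if "u \<in> {0..1}" for u unfolding \<mu>_def using inj that by (rule inv_into_f_f)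
  have l\<mu>: "l' (\<mu> x) = x" "\<mu> x \<in> {0..1}" if "x \<in> {0..a}" for x
    using that f_inv_into_f[of x l' "{0..1}"] inv_into_into[of x l' "{0..1}"] by (simp_all only: \<mu>_def img)
  have cont\<mu>: "continuous_on {0..a} \<mu>"
    using continuous_on_inv[OF cont, of \<mu>] \<mu>l img by simp
  have \<mu>0: "\<mu> 0 = 0" using \<mu>l[of 0] l'0 by simp
  have \<mu>a: "\<mu> a = 1" using \<mu>l[of 1] by (simp add: a_def)
  have \<mu>_inner: "\<mu> x \<in> {0<..<1}" if x: "x \<in> {0<..<a}" for x
  proof -
    have "\<mu> x \<in> {0..1}" "l' (\<mu> x) = x" using l\<mu>[of x] x by auto
    moreover from this have "\<mu> x \<noteq> 0" "\<mu> x \<noteq> 1" using x l'0 by (auto simp: a_def)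
    ultimately show ?thesis by auto
  qed
  have l_inner: "l' u \<in> {0<..<a}" if "u \<in> {0<..<1}" for u
    using mono[of 0 u] mono[of u 1] that l'0 by (auto simp: a_def)
  define \<psi> where "\<psi> x = \<gamma> (\<mu> x)" for x
  have "continuous_map (top_of_set {0..a}) X \<psi>"
  proof -
    have "continuous_map (top_of_set {0..a}) (top_of_set {0..1}) \<mu>"
      using cont\<mu> l\<mu>(2) by (auto simp: continuous_map_in_subtopology)
    from continuous_map_compose[OF this \<gamma>] show ?thesis by (simp add: o_def \<psi>_def[abs_def])
  qed
  moreover have "\<psi> ` {0..a} = \<gamma> ` {0..1}"
  proof -
    have "\<mu> ` {0..a} = {0..1}"
      unfolding img[symmetric] image_image using \<mu>l by simp
    then show ?thesis unfolding \<psi>_def[abs_def] image_image[of \<gamma> \<mu>, symmetric] by simp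
  qed
  moreover have "\<psi> ` {0<..<a} = \<gamma> ` {0<..<1}"
  proof -
    have "\<mu> ` {0<..<a} = {0<..<1}"
    proof (intro subset_antisym subsetI)
      fix u :: real assume u: "u \<in> {0<..<1}"
      then have "u = \<mu> (l' u)" using \<mu>l[of u] by simp
      then show "u \<in> \<mu> ` {0<..<a}" using l_inner[OF u] by (rule image_eqI)
    qed (use \<mu>_inner in blast)
    then show ?thesis unfolding \<psi>_def[abs_def] image_image[of \<gamma> \<mu>, symmetric] by simp
  qed
  moreover have "inj_on \<psi> {0<..<a}"
  proof (rule inj_onI)
    fix x y assume xy: "x \<in> {0<..<a}" "y \<in> {0<..<a}" "\<psi> x = \<psi> y"
    then have "\<mu> x = \<mu> y" using inj_onD[OF inj\<gamma> _ \<mu>_inner \<mu>_inner] by (simp add: \<psi>_def)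
    then have "l' (\<mu> x) = l' (\<mu> y)" by (rule arg_cong)
    moreover have "x \<in> {0..a}" "y \<in> {0..a}" using xy by auto
    ultimately show "x = y" using l\<mu>(1)[of x] l\<mu>(1)[of y] by metis
  qed
  moreover have "unit_speed \<psi> (\<lambda>x. x) 0 a x" if x: "x \<in> {0<..<a}" "\<psi> x \<notin> V" for x
  proof -
    have "unit_speed \<gamma> l0 0 1 (\<mu> x)" using l0 \<mu>_inner[OF x(1)] x(2) by (simp add: arc_length_def \<psi>_def)
    then obtain e s \<sigma> \<epsilon> where *: "e \<in> E" "s \<in> {0<..<1}" "\<sigma> \<in> {1, -1}" "0 < \<epsilon>"
      "\<And>u'. \<bar>u' - \<mu> x\<bar> < \<epsilon> \<Longrightarrow> u' \<in> {0<..<1} \<and> s + \<sigma> * (l0 u' - l0 (\<mu> x)) / L e \<in> {0<..<1} \<and> \<gamma> u' = \<phi> e (s + \<sigma> * (l0 u' - l0 (\<mu> x)) / L e)"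
      unfolding unit_speed_def by blast
    have xa: "x \<in> {0..a}" using x by simp
    obtain r where r: "0 < r" "\<And>y. y \<in> {0..a} \<Longrightarrow> \<bar>y - x\<bar> < r \<Longrightarrow> \<bar>\<mu> y - \<mu> x\<bar> < \<epsilon>"
      using cont\<mu>[unfolded continuous_on_iff, rule_format, OF xa *(4)] unfolding dist_real_def by blast
    show ?thesis
      unfolding unit_speed_def
    proof (intro bexI[OF _ *(1)] bexI[OF _ *(2)] bexI[OF _ *(3)] exI[of _ "min r (min x (a - x))"] conjI allI impI)
      show "0 < min r (min x (a - x))" using r x by simp
      fix y assume y: "\<bar>y - x\<bar> < min r (min x (a - x))"
      then show ya: "y \<in> {0<..<a}" by (auto simp: abs_less_iff)
      have ya': "y \<in> {0..a}" using ya by simp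
      have "\<bar>\<mu> y - \<mu> x\<bar> < \<epsilon>" by (rule r(2)[OF ya']) (use y in simp)
      note ** = *(5)[OF this]
      have eq: "l0 (\<mu> y) - l0 (\<mu> x) = y - x" using l\<mu>(1)[OF ya'] l\<mu>(1)[OF xa] by (simp add: l'_def)
      show "s + \<sigma> * (y - x) / L e \<in> {0<..<1}" "\<psi> y = \<phi> e (s + \<sigma> * (y - x) / L e)"
        using ** unfolding eq \<psi>_def by blast+
    qed
  qed
  ultimately show ?thesis using a \<mu>0 \<mu>a
    by (intro exI[of _ a] exI[of _ \<psi>] conjI ballI impI) (simp_all add: \<psi>_def)
qed

end

context weighted_cell_graph
begin

text \<open>The metric comes from the edges of one cell structure, while the edges of another one are to be
parametrized by arc length. Away from the finitely many vertices of both structures the two edge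
coordinates differ by a translation and a sign. By \<open>lipschitz_if_locally_lipschitz\<close>, a continuous
function is therefore 1-Lipschitz along the edges of one structure if and only if it is so along those
of the other, which transfers the characterization of the path metric.\<close>

lemma length_graph_exists:
  assumes T: "cell_graph X W F \<gamma>" and no_loop: "\<And>f. f \<in> F \<Longrightarrow> \<gamma> f 0 \<noteq> \<gamma> f 1"
    and nonempty: "topspace X \<noteq> {}" and not_point: "\<nexists>p. topspace X = {p}"
  shows "\<exists>\<psi> a. length_graph X W F \<psi> a d"
proof -
  interpret T: cell_graph X W F \<gamma> by (rule T)
  define P where "P f a \<psi> \<longleftrightarrow> 0 < a \<and> continuous_map (top_of_set {0..a}) X \<psi> \<and> \<psi> 0 = \<gamma> f 0 \<and> \<psi> a = \<gamma> f 1 \<and>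
    \<psi> ` {0..a} = \<gamma> f ` {0..1} \<and> \<psi> ` {0<..<a} = \<gamma> f ` {0<..<1} \<and> inj_on \<psi> {0<..<a} \<and>
    (\<forall>x\<in>{0<..<a}. \<psi> x \<notin> V \<longrightarrow> unit_speed \<psi> (\<lambda>x. x) 0 a x)" for f a \<psi>
  have "\<forall>f\<in>F. \<exists>z. P f (fst z) (snd z)"
  proof
    fix f assume f: "f \<in> F"
    from arc_length_parametrization[OF T.cont[OF f] T.inj[OF f]]
    obtain a \<psi> where "P f a \<psi>" unfolding P_def by (elim exE)
    then have "P f (fst (a, \<psi>)) (snd (a, \<psi>))" by simp
    then show "\<exists>z. P f (fst z) (snd z)" by (rule exI[of "\<lambda>z. P f (fst z) (snd z)"])
  qed
  from bchoice[OF this] obtain z where z: "\<forall>f\<in>F. P f (fst (z f)) (snd (z f))" ..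
  define a \<psi> where "a f = fst (z f)" and "\<psi> f = snd (z f)" for f
  have P: "P f (a f) (\<psi> f)" if "f \<in> F" for f using z that by (simp add: a_def \<psi>_def)
  have a: "0 < a f" and cont: "continuous_map (top_of_set {0..a f}) X (\<psi> f)" and ends: "\<psi> f 0 = \<gamma> f 0" "\<psi> f (a f) = \<gamma> f 1"
    and img: "\<psi> f ` {0..a f} = \<gamma> f ` {0..1}" and img': "\<psi> f ` {0<..<a f} = f" and injf: "inj_on (\<psi> f) {0<..<a f}"
    and speed: "\<And>x. x \<in> {0<..<a f} \<Longrightarrow> \<psi> f x \<notin> V \<Longrightarrow> unit_speed (\<psi> f) (\<lambda>x. x) 0 (a f) x" if "f \<in> F" for f
    using P[OF that] T.cell_image[OF that] unfolding P_def by simp_all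
  note in_cell_edge = in_cell
  have in_cell: "\<psi> f x \<in> f" if "f \<in> F" "0 < x" "x < a f" for f x
    using imageI[of x "{0<..<a f}" "\<psi> f"] that(2,3) unfolding img'[OF that(1)] by simp
  have covE: "topspace X = (\<Union>e\<in>E. \<phi> e ` {0..1})" by (rule covered_by_edges[OF connected nonempty not_point])
  have covF: "topspace X = (\<Union>f\<in>F. \<psi> f ` {0..a f})"
    using T.covered_by_edges[OF connected nonempty not_point] img by simp
  have param_in_X: "\<psi> f x \<in> topspace X" if "f \<in> F" "x \<in> {0..a f}" for f x
    unfolding covF using that(1) imageI[OF that(2), of "\<psi> f"] by blast
  have speedE: "\<exists>e\<in>E. \<exists>s\<in>{0<..<1}. \<exists>\<sigma>\<in>{1, -1}. \<exists>\<epsilon>>0. \<forall>y. \<bar>y - x\<bar> < \<epsilon> \<longrightarrow>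
      y \<in> {0<..<a f} \<and> s + \<sigma> * (y - x) / L e \<in> {0<..<1} \<and> \<psi> f y = \<phi> e (s + \<sigma> * (y - x) / L e)"
    if "f \<in> F" "x \<in> {0<..<a f}" "\<psi> f x \<notin> V" for f x
    using speed[OF that] unfolding unit_speed_def .
  have "length_graph X W F \<psi> a d"
  proof
    show "Hausdorff_space X" by (rule Hausdorff)
    show "finite W" "finite F" "W \<subseteq> topspace X" by (rule T.finite_V T.finite_E T.V_subset)+
    fix f assume f: "f \<in> F"
    show "0 < a f" "continuous_map (top_of_set {0..a f}) X (\<psi> f)" by (rule a[OF f] cont[OF f])+
    show "\<psi> f 0 \<in> W" "\<psi> f (a f) \<in> W" "\<psi> f 0 \<noteq> \<psi> f (a f)"
      unfolding ends[OF f] by (rule T.start_in_V[OF f] T.end_in_V[OF f] no_loop[OF f])+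
    show notW: "\<psi> f x \<notin> W" if "0 < x" "x < a f" for x
      using T.vertex_notin_cell[OF f, of "\<psi> f x"] in_cell[OF f that] by auto
    show "f = g \<and> x = y" if g: "g \<in> F" and x: "0 < x" "x < a f" and y: "y \<in> {0..a g}" and eq: "\<psi> f x = \<psi> g y" for g x y
    proof -
      have "y \<noteq> 0" using notW[OF x] ends(1)[OF g] T.start_in_V[OF g] eq by auto
      moreover have "y \<noteq> a g" using notW[OF x] ends(2)[OF g] T.end_in_V[OF g] eq by auto
      ultimately have y': "0 < y" "y < a g" using y by auto
      have "f = g" using T.cells_disjoint[OF f g, of "\<psi> f x"] in_cell[OF f x] in_cell[OF g y'] eq by simp
      moreover have "x = y" using inj_onD[OF injf[OF f], of x y] eq x y' calculation by simp
      ultimately show ?thesis ..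
    qed
  next
    fix p assume "p \<in> topspace X"
    then show "\<exists>f\<in>F. \<exists>x\<in>{0..a f}. p = \<psi> f x" unfolding covF by blast
  next
    show "d p p = 0" if "p \<in> topspace X" for p by (rule d_self[OF that])
    show "d p q = d q p" if "p \<in> topspace X" "q \<in> topspace X" for p q by (rule d_sym[OF that])
    show "d p s \<le> d p q + d q s" if "p \<in> topspace X" "q \<in> topspace X" "s \<in> topspace X" for p q s
      by (rule d_triangle[OF that])
  next
    fix f x y assume f: "f \<in> F" and x: "x \<in> {0..a f}" and y: "y \<in> {0..a f}"
    define q where "q = \<psi> f y"
    have q: "q \<in> topspace X" unfolding q_def by (rule param_in_X[OF f y])
    have "\<bar>d (\<psi> f x) q - d (\<psi> f y) q\<bar> \<le> 1 * \<bar>x - y\<bar>"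
    proof (rule lipschitz_if_locally_lipschitz[of 0 "a f" "\<lambda>x. d (\<psi> f x) q" "\<psi> f -` V \<inter> {0<..<a f}" 1, OF _ _ _ _ x y])
      have "continuous_map (top_of_set {0..a f}) euclideanreal ((\<lambda>p. d p q) \<circ> \<psi> f)"
        by (rule continuous_map_compose[OF cont[OF f] d_continuous[OF covE q]])
      then show "continuous_on {0..a f} (\<lambda>x. d (\<psi> f x) q)" by (simp add: o_def)
      show "finite (\<psi> f -` V \<inter> {0<..<a f})" by (rule finite_vimage_IntI[OF finite_V injf[OF f]])
      fix u assume u: "u \<in> {0<..<a f}" "u \<notin> \<psi> f -` V \<inter> {0<..<a f}"
      then have "\<psi> f u \<notin> V" by simp
      from speedE[OF f u(1) this] obtain e s \<sigma> \<epsilon> where *: "e \<in> E" "s \<in> {0<..<1}" "\<sigma> \<in> {1, -1}" "0 < \<epsilon>"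
        "\<And>y. \<bar>y - u\<bar> < \<epsilon> \<Longrightarrow> s + \<sigma> * (y - u) / L e \<in> {0<..<1} \<and> \<psi> f y = \<phi> e (s + \<sigma> * (y - u) / L e)"
        by blast
      show "\<exists>\<epsilon>>0. \<forall>y. \<bar>y - u\<bar> < \<epsilon> \<longrightarrow> \<bar>d (\<psi> f y) q - d (\<psi> f u) q\<bar> \<le> 1 * \<bar>y - u\<bar>"
      proof (intro exI[of _ \<epsilon>] conjI allI impI *(4))
        fix w assume w: "\<bar>w - u\<bar> < \<epsilon>"
        let ?s = "s + \<sigma> * (w - u) / L e"
        have w': "?s \<in> {0..1}" "s \<in> {0..1}" "\<psi> f w = \<phi> e ?s" using *(5)[OF w] *(2) by auto
        have u': "\<psi> f u = \<phi> e s" using *(5)[of u] *(4) by simp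
        have "\<bar>d (\<psi> f w) q - d (\<psi> f u) q\<bar> \<le> L e * \<bar>?s - s\<bar>"
          unfolding w'(3) u' by (rule d_lipschitz[OF *(1) w'(1,2) q])
        also have "\<dots> = \<bar>w - u\<bar>" using L_pos[OF *(1)] *(3) by (auto simp: abs_mult)
        finally show "\<bar>d (\<psi> f w) q - d (\<psi> f u) q\<bar> \<le> 1 * \<bar>w - u\<bar>" by simp
      qed
    qed simp
    moreover have "d (\<psi> f y) q = 0" unfolding q_def by (rule d_self[OF param_in_X[OF f y]])
    ultimately show "d (\<psi> f x) (\<psi> f y) \<le> \<bar>x - y\<bar>" unfolding q_def by simp
  next
    fix h :: "'a \<Rightarrow> real" and p q
    assume h0: "\<And>f x y. \<lbrakk>f \<in> F; x \<in> {0..a f}; y \<in> {0..a f}\<rbrakk> \<Longrightarrow> h (\<psi> f x) - h (\<psi> f y) \<le> \<bar>x - y\<bar>"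
      and pq: "p \<in> topspace X" "q \<in> topspace X"
    have h: "\<bar>h (\<psi> f x) - h (\<psi> f y)\<bar> \<le> \<bar>x - y\<bar>" if "f \<in> F" "x \<in> {0..a f}" "y \<in> {0..a f}" for f x y
      using h0[OF that] h0[OF that(1,3,2)] by linarith
    have conth: "continuous_map X euclideanreal h"
    proof (rule continuous_map_from_compact_cover[OF T.finite_E Hausdorff, where K = "\<lambda>f. top_of_set {0..a f}" and g = \<psi>])
      fix f assume f: "f \<in> F"
      show "compact_space (top_of_set {0..a f})" by (simp add: compact_space_subtopology)
      show "continuous_map (top_of_set {0..a f}) X (\<psi> f)" by (rule cont[OF f])
      have "continuous_on {0..a f} (\<lambda>x. h (\<psi> f x))"
        by (rule lipschitz_on_continuous_on[of 1], rule lipschitz_onI) (use h[OF f] in \<open>simp_all add: dist_real_def\<close>)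
      then show "continuous_map (top_of_set {0..a f}) euclideanreal (\<lambda>x. h (\<psi> f x))" by simp
    qed (simp add: covF)
    show "h p - h q \<le> d p q"
    proof (rule d_greatest[OF _ pq])
      fix e and s t :: real assume e: "e \<in> E" and s: "s \<in> {0..1}" and t: "t \<in> {0..1}"
      have Le: "0 < L e" by (rule L_pos[OF e])
      have "\<bar>h (\<phi> e s) - h (\<phi> e t)\<bar> \<le> L e * \<bar>s - t\<bar>"
      proof (rule lipschitz_if_locally_lipschitz[of 0 1 "\<lambda>s. h (\<phi> e s)" "\<phi> e -` W \<inter> {0<..<1}" "L e", OF _ _ _ _ s t])
        have "continuous_map (top_of_set {0..1}) euclideanreal (h \<circ> \<phi> e)"
          by (rule continuous_map_compose[OF cell_graph.cont[OF cell_graph_axioms e] conth])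
        then show "continuous_on {0..1} (\<lambda>s. h (\<phi> e s))" by (simp add: o_def)
        show "finite (\<phi> e -` W \<inter> {0<..<1})" by (rule finite_vimage_IntI[OF T.finite_V inj[OF e]])
        show "0 \<le> L e" using Le by simp
        fix u :: real assume u: "u \<in> {0<..<1}" "u \<notin> \<phi> e -` W \<inter> {0<..<1}"
        then have u01: "0 < u" "u < 1" and nW: "\<phi> e u \<notin> W" by auto
        have ue: "\<phi> e u \<in> e" by (rule in_cell_edge[OF e u01])
        have nV: "\<phi> e u \<notin> V" using vertex_notin_cell[OF e, of "\<phi> e u"] ue by auto
        have uX: "\<phi> e u \<in> topspace X" using in_X[OF e, of u] u01 by simp
        have "\<exists>f\<in>F. \<phi> e u \<in> f"
          using uX
        proof (cases rule: T.point_cases)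
          case 1
          with nW show ?thesis by (rule notE)
        next
          case (2 f s)
          then show ?thesis by (intro bexI)
        qed
        then obtain f where f: "f \<in> F" "\<phi> e u \<in> f" by (rule bexE)
        then have "\<phi> e u \<in> \<psi> f ` {0<..<a f}" by (simp add: img')
        then obtain x where x: "\<phi> e u = \<psi> f x" "x \<in> {0<..<a f}" by (rule imageE)
        note x = x(2,1)
        have xV: "\<psi> f x \<notin> V" using nV x(2) by simp
        from speedE[OF f(1) x(1) xV] obtain e' s' \<sigma> \<epsilon> where *: "e' \<in> E" "s' \<in> {0<..<1}" "\<sigma> \<in> {1, -1}" "0 < \<epsilon>"
          "\<And>y. \<bar>y - x\<bar> < \<epsilon> \<Longrightarrow> y \<in> {0<..<a f} \<and> s' + \<sigma> * (y - x) / L e' \<in> {0<..<1} \<and> \<psi> f y = \<phi> e' (s' + \<sigma> * (y - x) / L e')"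
          by blast
        have xe': "\<psi> f x = \<phi> e' s'" using *(5)[of x] *(4) by simp
        have "\<phi> e' s' \<in> e'" using *(2) by (intro in_cell_edge[OF *(1)]) auto
        then have ee: "e' = e" using cells_disjoint[OF *(1) e, of "\<phi> e' s'"] ue x(2) xe' by simp
        have "\<phi> e s' = \<phi> e u" unfolding x(2) xe' ee ..
        from inj_onD[OF inj[OF e] this *(2) u(1)] have su: "s' = u" .
        show "\<exists>\<epsilon>>0. \<forall>v. \<bar>v - u\<bar> < \<epsilon> \<longrightarrow> \<bar>h (\<phi> e v) - h (\<phi> e u)\<bar> \<le> L e * \<bar>v - u\<bar>"
        proof (intro exI[of _ "\<epsilon> / L e"] conjI allI impI)
          show "0 < \<epsilon> / L e" using *(4) Le by simp
          fix v assume v: "\<bar>v - u\<bar> < \<epsilon> / L e"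
          define y where "y = x + \<sigma> * (L e * (v - u))"
          have yx: "\<bar>y - x\<bar> = L e * \<bar>v - u\<bar>" using *(3) Le by (auto simp: y_def abs_mult)
          also have "\<dots> < \<epsilon>" using v Le by (simp add: pos_less_divide_eq mult.commute)
          finally have "\<bar>y - x\<bar> < \<epsilon>" .
          note ** = *(5)[OF this]
          have "s' + \<sigma> * (y - x) / L e' = v" using *(3) Le by (auto simp: y_def su ee)
          then have "\<phi> e v = \<psi> f y" using ** ee by simp
          moreover have "\<bar>h (\<psi> f y) - h (\<psi> f x)\<bar> \<le> \<bar>y - x\<bar>" using ** x by (intro h[OF f(1)]) auto
          ultimately show "\<bar>h (\<phi> e v) - h (\<phi> e u)\<bar> \<le> L e * \<bar>v - u\<bar>" using x(2) yx by simp
        qed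
      qed
      then show "h (\<phi> e s) - h (\<phi> e t) \<le> L e * \<bar>s - t\<bar>" by simp
    qed
  qed
  then show ?thesis by blast
qed

end

context cell_graph
begin

text \<open>A single edge that is not a loop is an arc.\<close>

lemma two_edges:
  assumes "connected_space X" "topspace X \<noteq> {}" "\<nexists>p. topspace X = {p}"
    and no_loop: "\<And>e. e \<in> E \<Longrightarrow> \<phi> e 0 \<noteq> \<phi> e 1"
    and not_arc: "\<not> X homeomorphic_space top_of_set {0..1::real}"
  shows "2 \<le> card E"
proof (rule ccontr)
  assume "\<not> 2 \<le> card E"
  then have "card E = 0 \<or> card E = 1" by auto
  moreover note cov = covered_by_edges[OF assms(1-3)]
  ultimately have "card E = 1" using finite_E assms(2) by auto
  then obtain e where E: "E = {e}" by (rule card_1_singletonE)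
  then have e: "e \<in> E" by simp
  have inj01: "inj_on (\<phi> e) {0..1}"
  proof (rule inj_onI)
    fix s t :: real assume s: "s \<in> {0..1}" and t: "t \<in> {0..1}" and eq: "\<phi> e s = \<phi> e t"
    have iff: "0 < s \<and> s < 1 \<longleftrightarrow> \<phi> e s \<notin> V" if "s \<in> {0..1}" for s
      using that by (cases rule: closed_edge_cases)
        (use start_in_V[OF e] end_in_V[OF e] vertex_notin_cell[OF e] in_cell[OF e] in auto)
    show "s = t"
    proof (cases "0 < s \<and> s < 1")
      case True
      then have "0 < t \<and> t < 1" using iff[OF s] iff[OF t] eq by simp
      with True show ?thesis using inj_onD[OF inj[OF e] eq] by simp
    next
      case False
      then have "\<not> (0 < t \<and> t < 1)" using iff[OF s] iff[OF t] eq by simp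
      then have "s = 0 \<or> s = 1" "t = 0 \<or> t = 1" using False s t by auto
      then show ?thesis using eq no_loop[OF e] by auto
    qed
  qed
  have "homeomorphic_map (top_of_set {0..1}) X (\<phi> e)"
    by (rule continuous_imp_homeomorphic_map[OF cont[OF e]])
      (use Hausdorff inj01 cov E in \<open>simp_all add: compact_space_subtopology\<close>)
  then have "top_of_set {0..1::real} homeomorphic_space X" by (rule homeomorphic_map_imp_homeomorphic_space)
  then show False using not_arc homeomorphic_space_sym by blast
qed

end

lemma cell_graph_if_cell_structure:
  assumes "cell_structure X V E" and \<phi>: "\<And>e. e \<in> E \<Longrightarrow> characteristic_map X V e (\<phi> e)"
  shows "cell_graph X V E \<phi>"
proof -
  have X: "Hausdorff_space X" "finite V" "finite E" "V \<union> \<Union>E = topspace X" "disjnt V (\<Union>E)" "pairwise disjnt E"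
    using assms(1) by (auto simp: cell_structure_def)
  have hom: "homeomorphic_map (top_of_set {0<..<1}) (subtopology X e) (\<phi> e)" if "e \<in> E" for e
    using \<phi>[OF that] by (simp add: characteristic_map_def)
  show ?thesis
  proof
    show "Hausdorff_space X" "finite V" "finite E" "V \<union> \<Union>E = topspace X" by (rule X)+
    show "v \<notin> e" if "e \<in> E" "v \<in> V" for e v using X(5) that by (auto simp: disjnt_def)
    show "e = f" if "e \<in> E" "f \<in> E" "p \<in> e" "p \<in> f" for e f p
      using X(6) that by (auto simp: pairwise_def disjnt_def)
    fix e assume e: "e \<in> E"
    show "continuous_map (top_of_set {0..1}) X (\<phi> e)" "\<phi> e 0 \<in> V" "\<phi> e 1 \<in> V"
      using \<phi>[OF e] by (simp_all add: characteristic_map_def)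
    show "inj_on (\<phi> e) {0<..<1}" using homeomorphic_imp_injective_map[OF hom[OF e]] by simp
    have "e \<subseteq> topspace X" using e X(4) by blast
    then show "\<phi> e ` {0<..<1} = e" using homeomorphic_imp_surjective_map[OF hom[OF e]] by (simp add: Int_absorb1)
  qed
qed

section \<open>Subdivision of loops\<close>

text \<open>The cells of the subdivided structure are images of \<open>{l<..<r}\<close> for the triples \<open>(e, l, r)\<close> in a set \<open>P\<close>:
the whole interval for an edge with two ends, and the two halves for a loop. This treats the three
kinds of cells at once.\<close>

lemma regular_cell_graph:
  assumes "minimal_regular_structure X \<delta> V E"
  shows "\<exists>\<gamma>. cell_graph X V E \<gamma> \<and> (\<forall>f\<in>E. \<gamma> f 0 \<noteq> \<gamma> f 1)"
proof -
  obtain V0 E0 \<phi> where min: "minimal_cell_structure X V0 E0"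
    and loop: "\<forall>e\<in>loops X V0 E0. characteristic_map X V0 e (\<phi> e) \<and> constant_speed \<delta> (\<phi> e)"
    and V: "V = V0 \<union> (\<lambda>e. \<phi> e (1/2)) ` loops X V0 E0"
    and E: "E = (E0 - loops X V0 E0) \<union> (\<lambda>e. \<phi> e ` {0<..<1/2}) ` loops X V0 E0 \<union> (\<lambda>e. \<phi> e ` {1/2<..<1}) ` loops X V0 E0"
    using assms unfolding minimal_regular_structure_def by blast
  let ?L = "loops X V0 E0"
  have struct: "cell_structure X V0 E0" using min by (simp add: minimal_cell_structure_def)
  have LE: "?L \<subseteq> E0" by (auto simp: loops_def)
  define \<theta> where "\<theta> e = (if e \<in> ?L then \<phi> e else SOME \<theta>. characteristic_map X V0 e \<theta>)" for e
  have char: "characteristic_map X V0 e (\<theta> e)" if "e \<in> E0" for e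
  proof (cases "e \<in> ?L")
    case True
    then show ?thesis using loop by (simp add: \<theta>_def)
  next
    case False
    have "\<exists>\<theta>. characteristic_map X V0 e \<theta>" using struct that by (auto simp: cell_structure_def)
    then show ?thesis using False by (simp add: \<theta>_def someI_ex)
  qed
  interpret G: cell_graph X V0 E0 \<theta> by (rule cell_graph_if_cell_structure[OF struct char])
  define P where "P = (\<lambda>e. (e, 0::real, 1::real)) ` (E0 - ?L) \<union> (\<lambda>e. (e, 0, 1/2)) ` ?L \<union> (\<lambda>e. (e, 1/2, 1)) ` ?L"
  define cell where "cell = (\<lambda>(e, l, r). \<theta> e ` {l<..<r::real})"
  have E': "E = cell ` P"
  proof -
    have "cell ` (\<lambda>e. (e, 0, 1)) ` (E0 - ?L) = E0 - ?L"
      using G.cell_image by (simp add: image_image cell_def cong: image_cong_simp)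
    moreover have "cell ` (\<lambda>e. (e, 0, 1/2)) ` ?L = (\<lambda>e. \<phi> e ` {0<..<1/2}) ` ?L"
      unfolding image_image by (rule image_cong) (simp_all add: cell_def \<theta>_def)
    moreover have "cell ` (\<lambda>e. (e, 1/2, 1)) ` ?L = (\<lambda>e. \<phi> e ` {1/2<..<1}) ` ?L"
      unfolding image_image by (rule image_cong) (simp_all add: cell_def \<theta>_def)
    ultimately show ?thesis by (simp only: E P_def image_Un)
  qed
  have V': "V = V0 \<union> (\<lambda>e. \<theta> e (1/2)) ` ?L"
    unfolding V by (simp add: \<theta>_def cong: image_cong_simp)
  have P_cases: thesis
    if "(e, l, r) \<in> P" and "\<lbrakk>e \<in> E0; e \<notin> ?L; l = 0; r = 1\<rbrakk> \<Longrightarrow> thesis"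
      "\<lbrakk>e \<in> ?L; l = 0; r = 1/2\<rbrakk> \<Longrightarrow> thesis" "\<lbrakk>e \<in> ?L; l = 1/2; r = 1\<rbrakk> \<Longrightarrow> thesis" for e l r thesis
    using that by (auto simp: P_def)
  have P_E0: "e \<in> E0" "0 \<le> l" "l < r" "r \<le> 1" if "(e, l, r) \<in> P" for e l r
    using that LE by (auto elim!: P_cases)
  have mid_V: "\<theta> e (1/2) \<in> V" if "e \<in> ?L" for e using that unfolding V' by blast
  have mid_notV: "\<theta> e (1/2) \<notin> V0" if "e \<in> ?L" for e
    using G.vertex_notin_cell[of e "\<theta> e (1/2)"] G.in_cell[of e "1/2"] that LE by auto
  have non_loop: "\<theta> e 0 \<noteq> \<theta> e 1" if "e \<in> E0" "e \<notin> ?L" for e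
  proof
    assume "\<theta> e 0 = \<theta> e 1"
    with char[OF that(1)] that(1) have "e \<in> ?L" unfolding loops_def mem_Collect_eq by (intro conjI exI)
    with that(2) show False by (rule notE)
  qed
  have param: "\<exists>c. continuous_map (top_of_set {0..1}) X c \<and> inj_on c {0<..<1} \<and> c ` {0<..<1} = f \<and>
      c 0 \<in> V \<and> c 1 \<in> V \<and> c (0::real) \<noteq> c 1" if f: "f \<in> E" for f
  proof -
    obtain e l r where p: "(e, l, r) \<in> P" "f = \<theta> e ` {l<..<r}" using f unfolding E' cell_def by auto
    note p' = P_E0[OF p(1)]
    define c where "c s = \<theta> e (l + (r - l) * s)" for s
    have lr: "l + (r - l) * s \<in> {l..r}" if "s \<in> {0..1}" for s
    proof -
      have "0 \<le> (r - l) * s" "(r - l) * s \<le> (r - l) * 1" using that p' by (auto intro: mult_left_mono)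
      then show ?thesis by simp
    qed
    have lin: "(\<lambda>s. l + (r - l) * s) ` {0<..<1} = {l<..<r}"
    proof (intro subset_antisym subsetI)
      fix x assume "x \<in> (\<lambda>s. l + (r - l) * s) ` {0<..<1}"
      then obtain s where s: "0 < s" "s < 1" "x = l + (r - l) * s" by auto
      have "0 < (r - l) * s" using s p' by simp
      moreover have "(r - l) * s < (r - l) * 1" using s p' by (intro mult_strict_left_mono) auto
      ultimately show "x \<in> {l<..<r}" using s(3) by simp
    next
      fix x assume x: "x \<in> {l<..<r}"
      have "x = l + (r - l) * ((x - l) / (r - l))" using p' by simp
      moreover have "(x - l) / (r - l) \<in> {0<..<1}" using x by simp
      ultimately show "x \<in> (\<lambda>s. l + (r - l) * s) ` {0<..<1}" by (rule image_eqI)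
    qed
    have "continuous_map (top_of_set {0..1}) (top_of_set {0..1}) (\<lambda>s. l + (r - l) * s)"
      using lr p' by (force simp: continuous_map_in_subtopology intro!: continuous_intros)
    from continuous_map_compose[OF this G.cont[OF p'(1)]]
    have "continuous_map (top_of_set {0..1}) X c" by (simp add: o_def c_def[abs_def])
    moreover have "inj_on c {0<..<1}"
    proof (rule inj_onI)
      fix s t :: real assume st: "s \<in> {0<..<1}" "t \<in> {0<..<1}" "c s = c t"
      have "l + (r - l) * s \<in> {l<..<r}" "l + (r - l) * t \<in> {l<..<r}" using lin st by blast+
      then have "l + (r - l) * s = l + (r - l) * t"
        using inj_onD[OF G.inj[OF p'(1)] st(3)[unfolded c_def]] p' by simp
      then show "s = t" using p' by simp
    qed
    moreover have "c ` {0<..<1} = f" unfolding p(2) lin[symmetric] image_image by (simp add: c_def)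
    moreover have c01: "c 0 = \<theta> e l" "c 1 = \<theta> e r" by (simp_all add: c_def)
    have "c 0 \<in> V \<and> c 1 \<in> V \<and> c 0 \<noteq> c 1"
      using p(1)
    proof (rule P_cases)
      assume "e \<in> E0" "e \<notin> ?L" "l = 0" "r = 1"
      then show ?thesis using G.start_in_V G.end_in_V non_loop V' c01 by simp
    next
      assume *: "e \<in> ?L" "l = 0" "r = 1/2"
      then have "\<theta> e 0 \<in> V0" using G.start_in_V LE by blast
      then show ?thesis using mid_V[OF *(1)] mid_notV[OF *(1)] V' c01 * by auto
    next
      assume *: "e \<in> ?L" "l = 1/2" "r = 1"
      then have "\<theta> e 1 \<in> V0" using G.end_in_V LE by blast
      then show ?thesis using mid_V[OF *(1)] mid_notV[OF *(1)] V' c01 * by auto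
    qed
    ultimately show ?thesis by (intro exI[of _ c]) simp
  qed
  then have "\<forall>f\<in>E. \<exists>c. continuous_map (top_of_set {0..1}) X c \<and> inj_on c {0<..<1} \<and> c ` {0<..<1} = f \<and>
      c 0 \<in> V \<and> c 1 \<in> V \<and> c (0::real) \<noteq> c 1" by blast
  from bchoice[OF this] obtain \<gamma> where \<gamma>: "\<forall>f\<in>E. continuous_map (top_of_set {0..1}) X (\<gamma> f) \<and> inj_on (\<gamma> f) {0<..<1} \<and>
      \<gamma> f ` {0<..<1} = f \<and> \<gamma> f 0 \<in> V \<and> \<gamma> f 1 \<in> V \<and> \<gamma> f (0::real) \<noteq> \<gamma> f 1" ..
  have same_cell: "(e, l, r) = (e', l', r')"
    if p: "(e, l, r) \<in> P" "(e', l', r') \<in> P" and s: "s \<in> {l<..<r}" "s' \<in> {l'<..<r'}" and eq: "\<theta> e s = \<theta> e' s'" for e l r e' l' r' s s'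
  proof -
    have s01: "0 < s" "s < 1" "0 < s'" "s' < 1" using P_E0[OF p(1)] P_E0[OF p(2)] s by auto
    have "\<theta> e s \<in> e" "\<theta> e' s' \<in> e'" using s01 P_E0(1)[OF p(1)] P_E0(1)[OF p(2)] by (auto intro: G.in_cell)
    then have ee: "e = e'" using G.cells_disjoint P_E0(1)[OF p(1)] P_E0(1)[OF p(2)] eq by metis
    then have "s = s'" using inj_onD[OF G.inj[OF P_E0(1)[OF p(1)]], of s s'] eq s01 by simp
    then show ?thesis using p s ee by (auto elim!: P_cases)
  qed
  have "cell_graph X V E \<gamma>"
  proof
    show "Hausdorff_space X" by (rule G.Hausdorff)
    have finL: "finite ?L" using LE G.finite_E by (rule finite_subset)
    show "finite V" "finite E" using finL G.finite_V G.finite_E by (simp_all add: V' E)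
    show "V \<union> \<Union>E = topspace X"
    proof (intro subset_antisym subsetI)
      fix p assume "p \<in> V \<union> \<Union>E"
      then show "p \<in> topspace X"
      proof
        assume "p \<in> V"
        then show ?thesis using G.V_subset G.in_X[of _ "1/2"] LE unfolding V' by auto
      next
        assume "p \<in> \<Union>E"
        then obtain e l r s where "(e, l, r) \<in> P" "s \<in> {l<..<r}" "p = \<theta> e s" unfolding E' cell_def by auto
        then show ?thesis using P_E0[of e l r] G.in_X[of e s] by simp
      qed
    next
      fix p assume "p \<in> topspace X"
      then show "p \<in> V \<union> \<Union>E"
      proof (cases rule: G.point_cases)
        case 1
        then show ?thesis by (simp add: V')
      next
        case (2 e s)
        note es = this
        have inE: "p \<in> \<Union>E" if "(e, l, r) \<in> P" "s \<in> {l<..<r}" for l r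
        proof -
          have "p \<in> cell (e, l, r)" unfolding cell_def prod.case 2(4) using that(2) by (rule imageI)
          then show ?thesis unfolding E' using that(1) by blast
        qed
        show ?thesis
        proof (cases "e \<in> ?L")
          case True
          consider "s < 1/2" | "s = 1/2" | "1/2 < s" by linarith
          then show ?thesis
          proof cases
            case 1 then show ?thesis using inE[of 0 "1/2"] True es by (simp add: P_def)
          next
            case 2
            have "p \<in> V" unfolding es(4) 2 by (rule mid_V[OF True])
            then show ?thesis by (rule UnI1)
          next
            case 3 then show ?thesis using inE[of "1/2" 1] True es by (simp add: P_def)
          qed
        next
          case False
          then show ?thesis using inE[of 0 1] 2 by (simp add: P_def)
        qed
      qed
    qed
    show "v \<notin> f" if f: "f \<in> E" and v: "v \<in> V" for f v
    proof
      assume "v \<in> f"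
      then obtain e l r s where p: "(e, l, r) \<in> P" "s \<in> {l<..<r}" "v = \<theta> e s" using f unfolding E' cell_def by auto
      have s01: "0 < s" "s < 1" using P_E0[OF p(1)] p(2) by auto
      have ve: "v \<in> e" unfolding p(3) by (rule G.in_cell[OF P_E0(1)[OF p(1)] s01])
      then have "v \<notin> V0" using G.vertex_notin_cell P_E0(1)[OF p(1)] by blast
      then obtain e' where e': "e' \<in> ?L" "v = \<theta> e' (1/2)" using v unfolding V' by blast
      then have "v \<in> e'" using G.in_cell[of e' "1/2"] LE by auto
      then have "e = e'" using G.cells_disjoint[of e e' v] ve P_E0(1)[OF p(1)] e'(1) LE by blast
      then have "s = 1/2" using inj_onD[OF G.inj[OF P_E0(1)[OF p(1)]], of s "1/2"] e'(2) p(3) s01 by simp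
      then show False using p(1,2) e'(1) \<open>e = e'\<close> by (auto elim!: P_cases)
    qed
    show "f = g" if f: "f \<in> E" and g: "g \<in> E" and "p \<in> f" "p \<in> g" for f g p
    proof -
      obtain e l r s where 1: "(e, l, r) \<in> P" "f = \<theta> e ` {l<..<r}" "s \<in> {l<..<r}" "p = \<theta> e s"
        using f \<open>p \<in> f\<close> unfolding E' cell_def by auto
      obtain e' l' r' s' where 2: "(e', l', r') \<in> P" "g = \<theta> e' ` {l'<..<r'}" "s' \<in> {l'<..<r'}" "p = \<theta> e' s'"
        using g \<open>p \<in> g\<close> unfolding E' cell_def by auto
      have "(e, l, r) = (e', l', r')" by (rule same_cell[OF 1(1) 2(1) 1(3) 2(3)]) (use 1(4) 2(4) in simp)
      then show "f = g" using 1(2) 2(2) by simp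
    qed
    fix f assume "f \<in> E"
    with \<gamma> show "continuous_map (top_of_set {0..1}) X (\<gamma> f)" "inj_on (\<gamma> f) {0<..<1}" "\<gamma> f ` {0<..<1} = f" "\<gamma> f 0 \<in> V" "\<gamma> f 1 \<in> V"
      by simp_all
  qed
  moreover have "\<forall>f\<in>E. \<gamma> f 0 \<noteq> \<gamma> f 1" using \<gamma> by simp
  ultimately show ?thesis by blast
qed

section \<open>The number of types\<close>

lemma card_quotient_le_key:
  fixes key :: "'r \<Rightarrow> nat"
  assumes R: "equiv (f ` S) R"
    and same: "\<And>r s. \<lbrakk>r \<in> S; s \<in> S; key r = key s\<rbrakk> \<Longrightarrow> (f r, f s) \<in> R"
    and bound: "\<And>r. r \<in> S \<Longrightarrow> key r \<le> N"
  shows "finite ((f ` S) // R) \<and> card ((f ` S) // R) \<le> N + 1"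
proof -
  define g where "g n = (SOME r. r \<in> S \<and> key r = n)" for n
  have "(f ` S) // R \<subseteq> (\<lambda>n. R `` {f (g n)}) ` {..N}"
  proof
    fix C assume "C \<in> (f ` S) // R"
    then obtain r where r: "r \<in> S" "C = R `` {f r}" by (auto elim!: quotientE)
    have "g (key r) \<in> S \<and> key (g (key r)) = key r" unfolding g_def by (rule someI[of _ r]) (use r in simp)
    then have "(f r, f (g (key r))) \<in> R" using same r by simp
    then have "C = R `` {f (g (key r))}" unfolding r(2) by (rule equiv_class_eq[OF R])
    then show "C \<in> (\<lambda>n. R `` {f (g n)}) ` {..N}" using bound[OF r(1)] by simp
  qed
  note sub = this
  have "card ((f ` S) // R) \<le> card {..N}" by (rule surj_card_le[OF finite_atMost sub])
  then show ?thesis using finite_subset[OF sub] by simp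
qed

lemma far_pairs_subset: "far_pairs X \<delta> r \<subseteq> topspace (prod_topology X X)"
  by (auto simp: far_pairs_def)

context length_graph
begin

text \<open>The key of \<open>r\<close> increases by one when \<open>r\<close> reaches a critical value and by one more when it passes it. Equal
keys mean that no critical value lies between, ends included.\<close>

lemma isotopic_if_same_key:
  assumes fin: "finite critical" and rs: "0 < r" "0 < s"
    and key: "card {c \<in> critical. c < r} + card {c \<in> critical. c \<le> r} = card {c \<in> critical. c < s} + card {c \<in> critical. c \<le> s}"
  shows "isotopic_in (prod_topology X X) (far_pairs X \<delta> r) (far_pairs X \<delta> s)"
proof -
  have main: "isotopic_in (prod_topology X X) (far_pairs X \<delta> r) (far_pairs X \<delta> s)"
    if r: "0 < r" and "r \<le> s"
    and key: "card {c \<in> critical. c < r} + card {c \<in> critical. c \<le> r} = card {c \<in> critical. c < s} + card {c \<in> critical. c \<le> s}" for r s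
  proof (cases "r = s")
    case True
    then show ?thesis using isotopic_in_refl[OF far_pairs_subset] by simp
  next
    case False
    then have rs: "r < s" using that by simp
    have sub: "{c \<in> critical. c < r} \<subseteq> {c \<in> critical. c < s}" "{c \<in> critical. c \<le> r} \<subseteq> {c \<in> critical. c \<le> s}"
      using rs by auto
    have fs: "finite {c \<in> critical. c < s}" "finite {c \<in> critical. c \<le> s}" using fin by simp_all
    have "card {c \<in> critical. c < r} = card {c \<in> critical. c < s}" "card {c \<in> critical. c \<le> r} = card {c \<in> critical. c \<le> s}"
      using card_mono[OF fs(1) sub(1)] card_mono[OF fs(2) sub(2)] key by linarith+
    then have eq: "{c \<in> critical. c < r} = {c \<in> critical. c < s}" "{c \<in> critical. c \<le> r} = {c \<in> critical. c \<le> s}"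
      using card_subset_eq[OF fs(1) sub(1)] card_subset_eq[OF fs(2) sub(2)] by blast+
    have "c < r \<or> s < c" if c: "c \<in> critical" for c
    proof (rule ccontr)
      assume n: "\<not> (c < r \<or> s < c)"
      then have "c \<in> {c \<in> critical. c \<le> s}" using c by simp
      then have "c \<in> {c \<in> critical. c \<le> r}" using eq by simp
      then have "c \<in> {c \<in> critical. c < s}" using rs by simp
      then have "c \<in> {c \<in> critical. c < r}" using eq by simp
      then show False using n by simp
    qed
    then show ?thesis by (rule isotopic_far_pairs[OF r \<open>r \<le> s\<close> fin])
  qed
  show ?thesis
  proof (cases "r \<le> s")
    case True
    then show ?thesis using main rs key by simp
  next
    case False
    then have "isotopic_in (prod_topology X X) (far_pairs X \<delta> s) (far_pairs X \<delta> r)" using main rs key by simp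
    then show ?thesis by (rule isotopic_in_sym[OF _ far_pairs_subset])
  qed
qed

lemma card_types_le:
  assumes E2: "2 \<le> card E" and F: "F = far_pairs X \<delta> ` {r. r > 0}"
    and R: "equiv F R" and iso: "\<And>A B. \<lbrakk>A \<in> F; B \<in> F; isotopic_in (prod_topology X X) A B\<rbrakk> \<Longrightarrow> (A, B) \<in> R"
  shows "finite (F // R) \<and> card (F // R) \<le> 4 * card E * (card E - 1) + 1"
proof -
  note fin = card_critical(1)[OF E2]
  define key where "key r = card {c \<in> critical. c < r} + card {c \<in> critical. c \<le> r}" for r
  have "key r \<le> 2 * card critical" for r
    using card_mono[OF fin, of "{c \<in> critical. c < r}"] card_mono[OF fin, of "{c \<in> critical. c \<le> r}"]
    by (simp add: key_def)
  moreover have "2 * card critical \<le> 2 * (2 * card E * (card E - 1))"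
    by (rule mult_le_mono2[OF card_critical(2)[OF E2]])
  ultimately have "key r \<le> 2 * (2 * card E * (card E - 1))" for r by (rule order_trans)
  then have key: "key r \<le> 4 * card E * (card E - 1)" for r by (simp add: mult.assoc)
  show ?thesis
    unfolding F
  proof (rule card_quotient_le_key[of _ _ R key])
    show "equiv (far_pairs X \<delta> ` {r. r > 0}) R" using R by (simp add: F)
    fix r s :: real assume "r \<in> {r. r > 0}" "s \<in> {r. r > 0}" "key r = key s"
    then show "(far_pairs X \<delta> r, far_pairs X \<delta> s) \<in> R"
      unfolding key_def by (intro iso isotopic_if_same_key[OF fin]) (auto simp: F)
  qed (rule key)
qed

end

lemma equiv_isotopic:
  assumes "\<And>A. A \<in> F \<Longrightarrow> A \<subseteq> topspace Z"
  shows "equiv F {(A, B). A \<in> F \<and> B \<in> F \<and> isotopic_in Z A B}" (is "equiv F ?R")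
proof (rule equivI)
  show "?R \<subseteq> F \<times> F" by auto
  show "refl_on F ?R"
    by (simp add: refl_on_def isotopic_in_refl[OF assms])
  show "sym ?R"
    using isotopic_in_sym[OF _ assms] by (intro symI) simp
  show "trans ?R"
  proof (rule transI)
    fix A B C assume "(A, B) \<in> ?R"
      and "(B, C) \<in> ?R"
    then show "(A, C) \<in> ?R"
      using isotopic_in_trans[of Z A B C] assms[of A] by simp
  qed
qed

lemma equiv_homotopy_equivalent:
  "equiv F {(A, B). A \<in> F \<and> B \<in> F \<and> subtopology Z A homotopy_equivalent_space subtopology Z B}" (is "equiv F ?R")
proof (rule equivI)
  show "?R \<subseteq> F \<times> F" by auto
  show "refl_on F ?R"
    by (simp add: refl_on_def homotopy_equivalent_space_refl)
  show "sym ?R"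
  proof (rule symI)
    fix A B assume "(A, B) \<in> ?R"
    then show "(B, A) \<in> ?R"
      using homotopy_equivalent_space_sym[of "subtopology Z A" "subtopology Z B"] by simp
  qed
  show "trans ?R"
  proof (rule transI)
    fix A B C assume "(A, B) \<in> ?R"
      and "(B, C) \<in> ?R"
    then show "(A, C) \<in> ?R"
      using homotopy_eqv_trans[of "subtopology Z A" "subtopology Z B" "subtopology Z C"] by simp
  qed
qed

theorem mainTheorem2:
  fixes X :: "'a topology" and V\<^sub>0 V :: "'a set" and E\<^sub>0 E :: "'a set set"
    and \<phi> :: "'a set \<Rightarrow> real \<Rightarrow> 'a" and L :: "'a set \<Rightarrow> real"
    and \<delta> :: "'a \<Rightarrow> 'a \<Rightarrow> real" and F :: "('a \<times> 'a) set set"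
  assumes "metric_graph X V\<^sub>0 E\<^sub>0 \<phi> L"
    and "\<nexists>a. topspace X = {a}"
    and "\<not> X homeomorphic_space top_of_set {0..1::real}"
    and "\<not> X homeomorphic_space top_of_set (sphere (0::complex) 1)"
    and "\<delta> = path_metric E\<^sub>0 \<phi> L"
    and "minimal_regular_structure X \<delta> V E"
    and "F = far_pairs X \<delta> ` {r. r > 0}"
  shows "finite (homotopy_types (prod_topology X X) F) \<and>
         real (card (homotopy_types (prod_topology X X) F))
           \<le> 9/2 * real (card E) ^ 2 - 5/2 * real (card E) \<and>
         finite (isotopy_types (prod_topology X X) F) \<and>
         real (card (isotopy_types (prod_topology X X) F))
           \<le> 9 * real (card E) ^ 2 - 5 * real (card E) - 1"
proof -
  have X: "cell_structure X V\<^sub>0 E\<^sub>0" "connected_space X" "topspace X \<noteq> {}"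
    "\<And>e. e \<in> E\<^sub>0 \<Longrightarrow> characteristic_map X V\<^sub>0 e (\<phi> e)" "\<And>e. e \<in> E\<^sub>0 \<Longrightarrow> 0 < L e"
    using assms(1) by (auto simp: metric_graph_def)
  have "cell_graph X V\<^sub>0 E\<^sub>0 \<phi>" by (rule cell_graph_if_cell_structure[OF X(1,4)])
  then interpret G: weighted_cell_graph X V\<^sub>0 E\<^sub>0 \<phi> L
    using X by (simp add: weighted_cell_graph_def weighted_cell_graph_axioms_def)
  have \<delta>: "\<delta> = G.d" unfolding assms(5) G.d_def ..
  obtain \<gamma> where \<gamma>: "cell_graph X V E \<gamma>" "\<And>f. f \<in> E \<Longrightarrow> \<gamma> f 0 \<noteq> \<gamma> f 1"
    using regular_cell_graph[OF assms(6)] by blast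
  have E2: "2 \<le> card E" by (rule cell_graph.two_edges[OF \<gamma>(1) X(2,3) assms(2) \<gamma>(2) assms(3)])
  obtain \<psi> a where "length_graph X V E \<psi> a \<delta>"
    using G.length_graph_exists[OF \<gamma> X(3) assms(2)] unfolding \<delta> by blast
  then interpret T: length_graph X V E \<psi> a \<delta> .
  let ?Z = "prod_topology X X"
  have sub: "A \<subseteq> topspace ?Z" if "A \<in> F" for A
    using that far_pairs_subset unfolding assms(7) by blast
  have iso: "finite (isotopy_types ?Z F) \<and> card (isotopy_types ?Z F) \<le> 4 * card E * (card E - 1) + 1"
    unfolding isotopy_types_def by (rule T.card_types_le[OF E2 assms(7) equiv_isotopic[OF sub]]) auto
  have hom: "finite (homotopy_types ?Z F) \<and> card (homotopy_types ?Z F) \<le> 4 * card E * (card E - 1) + 1"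
    unfolding homotopy_types_def
  proof (rule T.card_types_le[OF E2 assms(7) equiv_homotopy_equivalent])
    fix A B assume "A \<in> F" "B \<in> F" "isotopic_in ?Z A B"
    then show "(A, B) \<in> {(A, B). A \<in> F \<and> B \<in> F \<and> subtopology ?Z A homotopy_equivalent_space subtopology ?Z B}"
      using isotopic_in_imp_homotopy_equivalent[of ?Z A B] sub[of A] by simp
  qed
  define m where "m = real (card E)"
  have m: "2 \<le> m" using E2 by (simp add: m_def)
  have "real (4 * card E * (card E - 1) + 1) = 4 * m\<^sup>2 - 4 * m + 1"
    using E2 by (simp add: m_def of_nat_diff power2_eq_square algebra_simps)
  moreover have "2 * m \<le> m * m" using m by (intro mult_right_mono) auto
  ultimately have "real (4 * card E * (card E - 1) + 1) \<le> 9/2 * m\<^sup>2 - 5/2 * m"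
    "real (4 * card E * (card E - 1) + 1) \<le> 9 * m\<^sup>2 - 5 * m - 1"
    using m unfolding power2_eq_square by linarith+
  moreover have "real (card (homotopy_types ?Z F)) \<le> real (4 * card E * (card E - 1) + 1)"
    "real (card (isotopy_types ?Z F)) \<le> real (4 * card E * (card E - 1) + 1)"
    using hom iso unfolding of_nat_le_iff by simp_all
  ultimately show ?thesis using hom iso unfolding m_def by linarith
qed

end
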